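(* Consider the Buschman–Erdélyi operators of zero-order smoothness ${}_1S^\nu_{0+},{}_1P^\nu_{0+},{}_1P^\nu_-,{}_1S^\nu_-$ on $(0,\infty)$. 1. They act as multipliers in Mellin images, $M[Af](s)=m_A(s)\,M[f](s)$, with the symbols $$m_{{}_1S^\nu_{0+}}(s)=\frac{\Gamma(-\frac s2+\frac\nu2+1)\Gamma(-\frac s2-\frac\nu2+\frac12)}{\Gamma(\frac12-\frac s2)\Gamma(1-\frac s2)}=\frac{2^{-s}}{\sqrt\pi}\frac{\Gamma(-\frac s2-\frac\nu2+\frac12)\Gamma(-\frac s2+\frac\nu2+1)}{\Gamma(1-s)},\quad \operatorname{Re}s<\min(2+\operatorname{Re}\nu,1-\operatorname{Re}\nu);$$ $$m_{{}_1P^\nu_{0+}}(s)=\frac{\Gamma(\frac12-\frac s2)\Gamma(1-\frac s2)}{\Gamma(-\frac s2+\frac\nu2+1)\Gamma(-\frac s2-\frac\nu2+\frac12)},\quad\operatorname{Re}s<1;$$ $$m_{{}_1P^\nu_-}(s)=\frac{\Gamma(\frac s2+\frac\nu2+\frac12)\Gamma(\frac s2-\frac\nu2)}{\Gamma(\frac s2)\Gamma(\frac s2+\frac12)},\quad\operatorname{Re}s>\max(\operatorname{Re}\nu,-1-\operatorname{Re}\nu);$$ $$m_{{}_1S^\nu_-}(s)=\frac{\Gamma(\frac s2)\Gamma(\frac s2+\frac12)}{\Gamma(\frac s2+\frac\nu2+\frac12)\Gamma(\frac s2-\frac\nu2)},\quad\operatorname{Re}s>0.$$ 2. The symbols satisfy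 $m_{{}_1P^\nu_{0+}}(s)=1/m_{{}_1S^\nu_{0+}}(s)$, $m_{{}_1P^\nu_-}(s)=1/m_{{}_1S^\nu_-}(s)$, $m_{{}_1P^\nu_-}(s)=m_{{}_1S^\nu_{0+}}(1-s)$, $m_{{}_1P^\nu_{0+}}(s)=m_{{}_1S^\nu_-}(1-s)$. For real $\nu$: 3. The norms in $L_2(0,\infty)$ are $$\|{}_1S^\nu_{0+}\|=\|{}_1P^\nu_-\|=\frac1{\min(1,\sqrt{1-\sin\pi\nu})},\qquad\|{}_1P^\nu_{0+}\|=\|{}_1S^\nu_-\|=\max(1,\sqrt{1-\sin\pi\nu}).$$ 4. The norms of all four operators are $2$-periodic with respect to $\nu$. 5. The norms of ${}_1S^\nu_{0+}$ and ${}_1P^\nu_-$ are not bounded in total with respect to $\nu$, and each of these norms is not less than $1$. If $\sin\pi\nu\le0$, then these norms are equal to $1$. These operators are unbounded in $L_2$ if and only if $\sin\pi\nu=1$ (i.e. $\nu=2k+\frac12$, $k\in\mathbb Z$). 6. The norms of ${}_1P^\nu_{0+}$ and ${}_1S^\nu_-$ are bounded in total with respect to $\nu$, and each of these norms does not exceed $\sqrt2$. All these operators are bounded in $L_2$ for all $\nu$. If $\sin\pi\nu\ge0$, then their $L_2$-norm is equal to $1$. The greatest value of the norm, equal to $\sqrt2$, is achieved if and only if $\sin\pi\nu=-1$ (i.e. $\nu=-\frac12+2k$, $k\in\mathbb Z$).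
   Context: $P_\nu$ is the Legendre function of the first kind (order $\mu=0$): $P_\nu(z)={}_2F_1(-\nu,\nu+1;1;\frac{1-z}2)$ for $z>-1$. The operators are defined on suitable functions (e.g. $f\in C_c^\infty(0,\infty)$) by $${}_1S^\nu_{0+}f(x)=\frac d{dx}\int_0^xP_\nu\Big(\frac xt\Big)f(t)\,dt,\qquad{}_1P^\nu_{0+}f(x)=\int_0^xP_\nu\Big(\frac tx\Big)f'(t)\,dt,$$ $${}_1P^\nu_-f(x)=-\int_x^\infty P_\nu\Big(\frac tx\Big)f'(t)\,dt,\qquad{}_1S^\nu_-f(x)=-\frac d{dx}\int_x^\infty P_\nu\Big(\frac xt\Big)f(t)\,dt.$$ The Mellin transformation is $M[f](s)=\int_0^\infty x^{s-1}f(x)\,dx$. Boundedness, norms and extensions in $L_2(0,\infty)$ are understood in the sense of Mellin multipliers: an operator with symbol $m$ (continued analytically) is identified in $L_2(0,\infty)$ with multiplication of $M[f](s)$ by $m(s)$ on the line $\operatorname{Re}s=\frac12$, so that it is bounded iff $\sup_{\xi\in\mathbb R}|m(\frac12+i\xi)|<\infty$ and the norm equals this supremum. *)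

theory Defs
  imports "HOL-Complex_Analysis.Complex_Analysis"
begin

(* Principal branch of 2F1(a,b;c;z): the value at z of the analytic continuation, along the
   segment from 0 to z, of the Gauss series (whose n-th coefficient is
   (a)_n (b)_n / ((c)_n n!)).  On the plane cut along [1, \<infinity>), which is star-shaped about 0,
   this is the usual single-valued branch. *)
definition hyp2F1 :: "complex \<Rightarrow> complex \<Rightarrow> complex \<Rightarrow> complex \<Rightarrow> complex" where
  "hyp2F1 a b c z = (THE v. \<exists>F. F analytic_on closed_segment 0 z \<and>
     F has_fps_expansion fps_hypergeo [a, b] [c] 1 \<and> v = F z)"

definition legendre_P :: "complex \<Rightarrow> real \<Rightarrow> complex" where
  "legendre_P \<nu> z = hyp2F1 (- \<nu>) (\<nu> + 1) 1 (complex_of_real ((1 - z) / 2))"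

definition BE_S0plus :: "complex \<Rightarrow> (real \<Rightarrow> complex) \<Rightarrow> real \<Rightarrow> complex" where
  "BE_S0plus \<nu> f x =
     vector_derivative (\<lambda>y. LBINT t:{0<..<y}. legendre_P \<nu> (y / t) * f t) (at x)"

definition BE_P0plus :: "complex \<Rightarrow> (real \<Rightarrow> complex) \<Rightarrow> real \<Rightarrow> complex" where
  "BE_P0plus \<nu> f x = (LBINT t:{0<..<x}. legendre_P \<nu> (t / x) * vector_derivative f (at t))"

definition BE_Pminus :: "complex \<Rightarrow> (real \<Rightarrow> complex) \<Rightarrow> real \<Rightarrow> complex" where
  "BE_Pminus \<nu> f x = - (LBINT t:{x<..}. legendre_P \<nu> (t / x) * vector_derivative f (at t))"

definition BE_Sminus :: "complex \<Rightarrow> (real \<Rightarrow> complex) \<Rightarrow> real \<Rightarrow> complex" where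
  "BE_Sminus \<nu> f x =
     - vector_derivative (\<lambda>y. LBINT t:{y<..}. legendre_P \<nu> (y / t) * f t) (at x)"

(* The space of smooth functions with compact support in (0, \<infinity>), extended by 0 to the real
   line; D n is the n-th derivative of f. *)
definition test_funs :: "(real \<Rightarrow> complex) set" where
  "test_funs = {f.
     (\<exists>D. D 0 = f \<and> (\<forall>n x. (D n has_vector_derivative D (Suc n) x) (at x))) \<and>
     (\<exists>a b. 0 < a \<and> a < b \<and> (\<forall>x. x \<notin> {a..b} \<longrightarrow> f x = 0))}"

definition mellin_integrable :: "(real \<Rightarrow> complex) \<Rightarrow> complex \<Rightarrow> bool" where
  "mellin_integrable f s \<longleftrightarrow>
     set_integrable lborel {0<..} (\<lambda>x. complex_of_real x powr (s - 1) * f x)"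

definition mellin :: "(real \<Rightarrow> complex) \<Rightarrow> complex \<Rightarrow> complex" where
  "mellin f s = (LBINT x:{0<..}. complex_of_real x powr (s - 1) * f x)"

definition mellin_multiplier ::
  "((real \<Rightarrow> complex) \<Rightarrow> real \<Rightarrow> complex) \<Rightarrow> (complex \<Rightarrow> complex) \<Rightarrow> complex set \<Rightarrow> bool" where
  "mellin_multiplier A m S \<longleftrightarrow> (\<forall>f\<in>test_funs. \<forall>s\<in>S.
     mellin_integrable (A f) s \<and> mellin (A f) s = m s * mellin f s)"

(* In the next four definitions the convention Gamma z = 0 at the poles z = 0, -1, -2, ...
   together with w / 0 = 0 makes a denominator factor 1 / Gamma z vanish at those points, as
   it should.  A pole of a numerator factor gives the isolated value 0. *)
definition symbol_S0plus :: "complex \<Rightarrow> complex \<Rightarrow> complex" where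
  "symbol_S0plus \<nu> s =
     Gamma (- s / 2 + \<nu> / 2 + 1) * Gamma (- s / 2 - \<nu> / 2 + 1 / 2) /
     (Gamma (1 / 2 - s / 2) * Gamma (1 - s / 2))"

definition symbol_P0plus :: "complex \<Rightarrow> complex \<Rightarrow> complex" where
  "symbol_P0plus \<nu> s =
     Gamma (1 / 2 - s / 2) * Gamma (1 - s / 2) /
     (Gamma (- s / 2 + \<nu> / 2 + 1) * Gamma (- s / 2 - \<nu> / 2 + 1 / 2))"

definition symbol_Pminus :: "complex \<Rightarrow> complex \<Rightarrow> complex" where
  "symbol_Pminus \<nu> s =
     Gamma (s / 2 + \<nu> / 2 + 1 / 2) * Gamma (s / 2 - \<nu> / 2) /
     (Gamma (s / 2) * Gamma (s / 2 + 1 / 2))"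

definition symbol_Sminus :: "complex \<Rightarrow> complex \<Rightarrow> complex" where
  "symbol_Sminus \<nu> s =
     Gamma (s / 2) * Gamma (s / 2 + 1 / 2) /
     (Gamma (s / 2 + \<nu> / 2 + 1 / 2) * Gamma (s / 2 - \<nu> / 2))"

(* The symbol of A, determined by its values on a vertical strip and continued to a
   meromorphic function on the plane.  The choice is unique up to the values at isolated
   points (those of the poles, for instance), which do not affect the L2 notions below. *)
definition mellin_symbol ::
  "((real \<Rightarrow> complex) \<Rightarrow> real \<Rightarrow> complex) \<Rightarrow> complex \<Rightarrow> complex" where
  "mellin_symbol A = (SOME m. m meromorphic_on UNIV \<and>
     (\<exists>a b. a < b \<and> mellin_multiplier A m {s. a < Re s \<and> Re s < b}))"

(* C bounds the L2(0, \<infinity>) operator norm of A on the dense subspace of test functions, where A is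
   understood in L2 as multiplication of the Mellin image by the continued symbol on the line
   Re s = 1/2.  The square of the L2(0, \<infinity>) norm of the image is computed in Mellin images:
   by Parseval's equality it is (1 / (2 pi)) times the integral of the squared modulus of the
   Mellin image over that line. *)
definition L2_bound :: "((real \<Rightarrow> complex) \<Rightarrow> real \<Rightarrow> complex) \<Rightarrow> ennreal \<Rightarrow> bool" where
  "L2_bound A C \<longleftrightarrow> (\<forall>f\<in>test_funs.
     ennreal (1 / (2 * pi)) *
       (\<integral>\<^sup>+ \<xi>. ennreal ((cmod (mellin_symbol A (Complex (1/2) \<xi>) * mellin f (Complex (1/2) \<xi>)))\<^sup>2)
          \<partial>lborel)
     \<le> C\<^sup>2 * (\<integral>\<^sup>+ x\<in>{0<..}. ennreal ((cmod (f x))\<^sup>2) \<partial>lborel))"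

definition L2_bounded :: "((real \<Rightarrow> complex) \<Rightarrow> real \<Rightarrow> complex) \<Rightarrow> bool" where
  "L2_bounded A \<longleftrightarrow> (\<exists>C::real. L2_bound A (ennreal C))"

(* Equals \<infinity> exactly for the operators that are not bounded. *)
definition L2_norm :: "((real \<Rightarrow> complex) \<Rightarrow> real \<Rightarrow> complex) \<Rightarrow> ennreal" where
  "L2_norm A = Inf {C. L2_bound A C}"

end

(* The Pfaff transformation P_nu(y) = ((1+y)/2)^nu * 2F1(-nu,-nu;1;(y-1)/(y+1)) represents P_nu on
   (0,oo) by a series in a variable of the unit interval.  It yields Legendre's equation there and the
   growth y^max(nu,-1-nu) (up to a logarithm) at infinity.  After integration by parts every operator
   is the identity plus a multiplicative convolution with a kernel built from P_nu', so its symbol is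
   1 plus the Mellin transform of P_nu' over (1,oo), or 1 minus that over (0,1).  Legendre's equation
   turns into a recurrence with step 2 for these two functions; both tend to 1 at infinity, so Euler's
   limit formula for the Gamma function determines them.

   On the critical line the reflection formula gives
   |m|^2 = cosh(pi xi) / (cosh(pi xi) - sin(pi nu)), or the reciprocal.  By Plancherel the norm is the
   essential supremum of |m|: test functions x^(-1/2-i xi0) psi(ln x / n) have Mellin transforms
   concentrating at xi0.  The continued symbol is unique because the image of a test function vanishes
   near 0 or near infinity, so its Mellin transform is holomorphic on a half-plane that contains both
   strips on which the two symbols are given. *)
theory Submission
  imports Defs "HOL-Probability.Probability"
begin

section \<open>The hypergeometric series with c = 1\<close>

text \<open>The Gauss series of P_\<nu> in (1 - y) / 2 converges in general only for -1 < y < 3; the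
  change of variable trades this interval for the whole half-line. Neither the description behind
  \<open>hyp2F1\<close> nor the choice behind \<open>mellin_symbol\<close> can be computed directly,
  so each comes with an identity theorem. For the symbol this is a real obstacle: outside -3/2 < Re
  \<nu> < 1/2 the half-plane on which the multiplier identity holds for \<open>BE_S0plus\<close> or
  \<open>BE_Pminus\<close> misses the line Re s = 1/2, and the strip belonging to the chosen symbol
  may be disjoint from the known one. Continuation fixes a meromorphic function only off a sparse
  set, so what is known of \<open>mellin_symbol\<close> on the critical line holds almost
  everywhere. The four arguments in the Gamma quotient satisfy a + b = c + d, and this balance
  cancels the powers of n in Euler's limit. On the critical line with real \<nu> they pair up as z
  and 1 - cnj w, so that reflection applies to moduli. The lower bound for the norm rests on Fatou's
  lemma, because the squared modulus of the symbol can be unbounded near \<xi> = 0.\<close>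

lemma pochhammer_over_fact_bound:
  fixes a :: complex
  obtains C where "C > 0" "\<And>n. n \<ge> 1 \<Longrightarrow> norm (pochhammer a (Suc n) / fact n) \<le> C * real n powr Re a"
proof -
  \<comment> \<open>\<open>rGamma_series a n\<close> is Euler's approximation pochhammer a (n + 1) /
    (n! n^a) of 1 / Gamma a; being convergent, it is bounded.\<close>
  have "Bseq (rGamma_series a)"
    using rGamma_series_LIMSEQ convergentI convergent_imp_Bseq by blast
  then obtain C where C: "C > 0" "\<And>n. norm (rGamma_series a n) \<le> C"
    by (auto simp: Bseq_def)
  have "norm (pochhammer a (Suc n) / fact n) \<le> C * real n powr Re a" if "n \<ge> 1" for n
  proof -
    have "norm (pochhammer a (Suc n) / fact n) = norm (rGamma_series a n) * real n powr Re a"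
      using that by (simp add: rGamma_series_def norm_divide norm_mult powr_def)
    also have "\<dots> \<le> C * real n powr Re a"
      by (intro mult_right_mono C) auto
    finally show ?thesis .
  qed
  with C show ?thesis by (intro that[of C]) auto
qed

lemma fps_hypergeo_2_1_nth:
  "fps_nth (fps_hypergeo [a, b] [1] 1) n = pochhammer a n * pochhammer b n / (fact n)\<^sup>2" for a b :: complex
  by (simp add: power2_eq_square pochhammer_fact[symmetric])

text \<open>Comparison of coefficients in the hypergeometric equation with c = 1. Both directions
  are used: the recurrence yields the equation for the series with parameters -\<nu>, -\<nu>, and
  the equation yields the recurrence for the expansion of the transformed function.\<close>

lemma hypergeometric_ode_fps_iff:
  fixes f :: "complex fps" and a b :: complex
  defines "f' \<equiv> fps_deriv f" and "f'' \<equiv> fps_deriv (fps_deriv f)"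
  shows "fps_X * (1 - fps_X) * f'' + (1 - fps_const (a + b + 1) * fps_X) * f' - fps_const (a * b) * f = 0
    \<longleftrightarrow> (\<forall>n. (of_nat n + 1)\<^sup>2 * fps_nth f (Suc n) = (a + of_nat n) * (b + of_nat n) * fps_nth f n)"
    (is "?L = 0 \<longleftrightarrow> _")
proof -
  have "fps_nth ?L n = (of_nat n + 1)\<^sup>2 * fps_nth f (Suc n) - (a + of_nat n) * (b + of_nat n) * fps_nth f n" for n
  proof -
    have "?L = fps_X * f'' - fps_X * (fps_X * f'') + f' - fps_const (a + b + 1) * (fps_X * f') - fps_const (a * b) * f"
      by (simp add: algebra_simps)
    also have "fps_nth \<dots> n = (of_nat n + 1)\<^sup>2 * fps_nth f (Suc n) - (a + of_nat n) * (b + of_nat n) * fps_nth f n"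
      by (cases n rule: nat.exhaust; cases "n - 1")
         (auto simp: f'_def f''_def algebra_simps power2_eq_square)
    finally show ?thesis .
  qed
  thus ?thesis by (auto simp: fps_eq_iff)
qed

lemma fps_hypergeo_2_1_recurrence:
  fixes a b :: complex
  shows "(of_nat n + 1)\<^sup>2 * fps_nth (fps_hypergeo [a, b] [1] 1) (Suc n) =
     (a + of_nat n) * (b + of_nat n) * fps_nth (fps_hypergeo [a, b] [1] 1) n"
  unfolding fps_hypergeo_2_1_nth by (simp add: pochhammer_rec' field_simps power2_eq_square del: of_nat_Suc) (simp add: algebra_simps)

text \<open>At 0 the equation has the double exponent 0, so a power series solution is fixed by its
  constant term: the factor (n + 1)^2 in the recurrence never vanishes.\<close>

lemma fps_hypergeo_2_1_unique:
  fixes a b :: complex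
  assumes "fps_nth f 0 = 1"
    and "fps_X * (1 - fps_X) * fps_deriv (fps_deriv f) + (1 - fps_const (a + b + 1) * fps_X) * fps_deriv f - fps_const (a * b) * f = 0"
  shows "f = fps_hypergeo [a, b] [1] 1"
proof -
  have "fps_nth f n = fps_nth (fps_hypergeo [a, b] [1] 1) n" for n
  proof (induction n)
    case (Suc n)
    have "(of_nat n + 1)\<^sup>2 * fps_nth f (Suc n) = (of_nat n + 1)\<^sup>2 * fps_nth (fps_hypergeo [a, b] [1] 1) (Suc n)"
      using assms(2) Suc unfolding hypergeometric_ode_fps_iff fps_hypergeo_2_1_recurrence by auto
    moreover have "(of_nat n + 1 :: complex)\<^sup>2 \<noteq> 0"
      by (metis of_nat_Suc add.commute of_nat_neq_0 power_not_zero)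
    ultimately show ?case by (simp del: fps_hypergeo_nth)
  qed (use assms in simp)
  thus ?thesis by (simp add: fps_eq_iff)
qed

text \<open>The quotient of consecutive coefficients tends to 1. Equality can fail, since the series
  terminates when a or b is a nonpositive integer.\<close>

lemma fps_conv_radius_hypergeo_2_1:
  fixes a b :: complex
  shows "fps_conv_radius (fps_hypergeo [a, b] [1] 1) \<ge> 1"
proof -
  let ?h = "fps_nth (fps_hypergeo [a, b] [1] 1)"
  have "summable (\<lambda>n. ?h n * of_real r ^ n)" if r: "0 < r" "ereal r < 1" for r
  proof -
    have r1: "r < 1" using r by (simp add: one_ereal_def)
    have "(\<lambda>n. norm ((a + of_nat n) * (b + of_nat n) / (of_nat n + 1)\<^sup>2) * r) \<longlonglongrightarrow> 1 * r"
    proof (intro tendsto_mult tendsto_const)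
      have *: "(\<lambda>n. (c + of_nat n) / (of_nat n + 1)) \<longlonglongrightarrow> (1::complex)" for c :: complex
      proof -
        have "(\<lambda>n. 1 + (c - 1) * inverse (of_nat (Suc n))) \<longlonglongrightarrow> 1 + (c - 1) * (0::complex)"
          by (intro tendsto_intros LIMSEQ_Suc lim_inverse_n)
        moreover have "1 + (c - 1) * inverse (of_nat (Suc n)) = (c + of_nat n) / (of_nat n + 1)" for n
          using of_nat_neq_0[of n, where ?'a = complex] by (simp add: divide_simps add.commute)
        ultimately show ?thesis by simp
      qed
      have "(\<lambda>n. norm ((a + of_nat n) / (of_nat n + 1) * ((b + of_nat n) / (of_nat n + 1)))) \<longlonglongrightarrow> norm (1 * 1 :: complex)"
        by (intro tendsto_norm tendsto_mult *)
      thus "(\<lambda>n. norm ((a + of_nat n) * (b + of_nat n) / (of_nat n + 1)\<^sup>2)) \<longlonglongrightarrow> 1"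
        by (simp add: power2_eq_square)
    qed
    \<comment> \<open>The midpoint of r and 1 serves as the ratio of the comparison series.\<close>
    hence "eventually (\<lambda>n. norm ((a + of_nat n) * (b + of_nat n) / (of_nat n + 1)\<^sup>2) * r < (1 + r) / 2) sequentially"
      by (rule order_tendstoD) (use r1 in auto)
    then obtain N where N: "\<And>n. n \<ge> N \<Longrightarrow> norm ((a + of_nat n) * (b + of_nat n) / (of_nat n + 1)\<^sup>2) * r < (1 + r) / 2"
      by (auto simp: eventually_sequentially)
    show ?thesis
    proof (rule summable_ratio_test[of "(1 + r) / 2" N])
      fix n assume "n \<ge> N"
      have nz: "(of_nat n + 1 :: complex)\<^sup>2 \<noteq> 0"
        by (metis of_nat_Suc add.commute of_nat_neq_0 power_not_zero)
      have "?h (Suc n) = (a + of_nat n) * (b + of_nat n) / (of_nat n + 1)\<^sup>2 * ?h n"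
        using fps_hypergeo_2_1_recurrence[of n a b] nz by (simp add: field_simps del: fps_hypergeo_nth)
      hence "norm (?h (Suc n) * of_real r ^ Suc n) =
          (norm ((a + of_nat n) * (b + of_nat n) / (of_nat n + 1)\<^sup>2) * r) * norm (?h n * of_real r ^ n)"
        using r by (simp add: norm_mult norm_power norm_divide del: fps_hypergeo_nth)
      also have "\<dots> \<le> (1 + r) / 2 * norm (?h n * of_real r ^ n)"
        using N[OF \<open>n \<ge> N\<close>] by (intro mult_right_mono) auto
      finally show "norm (?h (Suc n) * of_real r ^ Suc n) \<le> (1 + r) / 2 * norm (?h n * of_real r ^ n)" .
    qed (use r1 in simp)
  qed
  thus ?thesis unfolding fps_conv_radius_def by (intro conv_radius_geI_ex')
qed

section \<open>The Pfaff transformation\<close>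

lemma hyp2F1_eqI:
  assumes "F analytic_on closed_segment 0 z" "F has_fps_expansion fps_hypergeo [a, b] [c] 1"
  shows "hyp2F1 a b c z = F z"
  unfolding hyp2F1_def
proof (rule the_equality)
  fix v assume "\<exists>G. G analytic_on closed_segment 0 z \<and> G has_fps_expansion fps_hypergeo [a, b] [c] 1 \<and> v = G z"
  then obtain G where G: "G analytic_on closed_segment 0 z" "G has_fps_expansion fps_hypergeo [a, b] [c] 1" "v = G z"
    by blast
  obtain U where U: "open U" "closed_segment 0 z \<subseteq> U" "F holomorphic_on U"
    using assms(1) by (auto simp: analytic_on_holomorphic)
  obtain V where V: "open V" "closed_segment 0 z \<subseteq> V" "G holomorphic_on V"
    using G(1) by (auto simp: analytic_on_holomorphic)
  \<comment> \<open>The intersection of the two domains may be disconnected; its component at 0 is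
    open and contains the whole segment.\<close>
  define C where "C = connected_component_set (U \<inter> V) 0"
  have C: "open C" "connected C" "C \<subseteq> U \<inter> V"
    using open_connected_component[OF open_Int[OF U(1) V(1)]] connected_component_subset[of "U \<inter> V" 0]
    by (simp_all add: C_def)
  have seg: "closed_segment 0 z \<subseteq> C"
    unfolding C_def using U V by (intro connected_component_maximal) auto
  have "eventually (\<lambda>x. F x - G x = 0) (nhds 0)"
    using assms(2) G(2) unfolding has_fps_expansion_def by (auto elim: eventually_elim2)
  then obtain N where N: "open N" "0 \<in> N" "\<And>x. x \<in> N \<Longrightarrow> F x - G x = 0"
    by (auto simp: eventually_nhds)
  have "F z - G z = 0"
  proof (rule analytic_continuation[of "\<lambda>x. F x - G x" C "N \<inter> C" 0 z])
    show "(\<lambda>x. F x - G x) holomorphic_on C"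
      using C U V by (intro holomorphic_intros) (auto intro: holomorphic_on_subset)
    show "0 islimpt N \<inter> C"
      using N C seg by (intro interior_limit_point) (auto simp: interior_open)
  qed (use C seg N in auto)
  thus "v = F z" using G(3) by simp
qed (use assms in blast)

context
  fixes \<nu> :: complex
begin

private abbreviation (input) "\<phi> \<equiv> fps_hypergeo [-\<nu>, -\<nu>] [1] (1::complex)"
private abbreviation (input) "W \<equiv> \<lambda>z::complex. z / (z - 1)"

text \<open>With z = (1 - y) / 2 the half-plane Re z < 1/2 is Re y > 0. There z / (z - 1) lies in
  the open unit disc and 1 - z avoids the branch cut of the power.\<close>

definition pfaff_legendre :: "complex \<Rightarrow> complex" where
  "pfaff_legendre z = (1 - z) powr \<nu> * eval_fps \<phi> (z / (z - 1))"

text \<open>The first and second derivatives are written out in terms of the values of the series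
  and of its derivatives at z / (z - 1), so that the differential equation becomes an algebraic
  identity.\<close>

definition pfaff_legendre' :: "complex \<Rightarrow> complex" where
  "pfaff_legendre' z = - ((1 - z) powr \<nu>) * (\<nu> / (1 - z) * eval_fps \<phi> (W z)
     + eval_fps (fps_deriv \<phi>) (W z) / (1 - z)\<^sup>2)"

definition pfaff_legendre'' :: "complex \<Rightarrow> complex" where
  "pfaff_legendre'' z = (1 - z) powr \<nu> * (\<nu> * (\<nu> - 1) / (1 - z)\<^sup>2 * eval_fps \<phi> (W z)
     + (2 * \<nu> - 2) / (1 - z) ^ 3 * eval_fps (fps_deriv \<phi>) (W z)
     + eval_fps (fps_deriv (fps_deriv \<phi>)) (W z) / (1 - z) ^ 4)"

lemma norm_pfaff_lt_1:
  assumes "Re z < 1 / 2" shows "norm (z / (z - 1)) < 1"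
proof -
  have "(Re z)\<^sup>2 + (Im z)\<^sup>2 < (Re z - 1)\<^sup>2 + (Im z)\<^sup>2"
    using assms by (simp add: power2_eq_square algebra_simps)
  hence "(norm z)\<^sup>2 < (norm (z - 1))\<^sup>2"
    by (simp add: cmod_power2)
  hence "norm z < norm (z - 1)" by (rule power_less_imp_less_base) simp
  thus ?thesis using assms by (simp add: norm_divide divide_less_eq)
qed

private lemma rad: assumes "Re z < 1 / 2"
  shows "ereal (norm (W z)) < fps_conv_radius \<phi>" "ereal (norm (W z)) < fps_conv_radius (fps_deriv \<phi>)"
    "ereal (norm (W z)) < fps_conv_radius (fps_deriv (fps_deriv \<phi>))"
proof -
  have "ereal (norm (W z)) < 1" using norm_pfaff_lt_1[OF assms] by (simp add: one_ereal_def)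
  thus "ereal (norm (W z)) < fps_conv_radius \<phi>"
    using fps_conv_radius_hypergeo_2_1[of "-\<nu>" "-\<nu>"] less_le_trans by blast
  thus 1: "ereal (norm (W z)) < fps_conv_radius (fps_deriv \<phi>)"
    using fps_conv_radius_deriv[of \<phi>] less_le_trans by blast
  thus "ereal (norm (W z)) < fps_conv_radius (fps_deriv (fps_deriv \<phi>))"
    using fps_conv_radius_deriv[of "fps_deriv \<phi>"] less_le_trans by blast
qed

private lemma D_powr: assumes "Re z < 1 / 2"
  shows "((\<lambda>z. (1 - z) powr \<nu>) has_field_derivative - (\<nu> / (1 - z)) * (1 - z) powr \<nu>) (at z)"
proof -
  have nz: "1 - z \<notin> \<real>\<^sub>\<le>\<^sub>0" "1 - z \<noteq> 0" using assms by (auto simp: complex_nonpos_Reals_iff)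
  have "((\<lambda>z. (1 - z) powr \<nu>) has_field_derivative (\<nu> * (1 - z) powr (\<nu> - 1)) * (0 - 1)) (at z)"
    by (rule DERIV_chain2[where f = "\<lambda>z. z powr \<nu>" and g = "\<lambda>z. 1 - z", OF has_field_derivative_powr[OF nz(1)]])
      (auto intro!: derivative_eq_intros)
  thus ?thesis using nz by (simp add: powr_diff field_simps)
qed

private lemma D_eval: assumes "Re z < 1 / 2" "ereal (norm (W z)) < fps_conv_radius f"
  shows "((\<lambda>z. eval_fps f (W z)) has_field_derivative - eval_fps (fps_deriv f) (W z) / (1 - z)\<^sup>2) (at z)"
proof -
  have nz: "1 - z \<noteq> 0" "z - 1 \<noteq> 0" using assms by auto
  have "(W has_field_derivative (1 * (z - 1) - z * 1) / ((z - 1) * (z - 1))) (at z)"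
    using nz by (auto intro!: derivative_eq_intros)
  moreover have "(1 * (z - 1) - z * 1) / ((z - 1) * (z - 1)) = - 1 / (1 - z)\<^sup>2"
    by (simp add: power2_eq_square algebra_simps)
  ultimately have "(W has_field_derivative - 1 / (1 - z)\<^sup>2) (at z)" by simp
  from DERIV_chain2[OF has_field_derivative_eval_fps[OF assms(2)] this] show ?thesis by simp
qed

lemma pfaff_legendre_deriv:
  assumes "Re z < 1 / 2"
  shows "(pfaff_legendre has_field_derivative pfaff_legendre' z) (at z)"
    "(pfaff_legendre' has_field_derivative pfaff_legendre'' z) (at z)"
proof -
  have nz: "1 - z \<noteq> 0" using assms by auto
  note D = D_powr[OF assms] D_eval[OF assms rad(1)[OF assms]] D_eval[OF assms rad(2)[OF assms]]
  show "(pfaff_legendre has_field_derivative pfaff_legendre' z) (at z)"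
    unfolding pfaff_legendre_def
    by (rule derivative_eq_intros D refl)+ (simp add: pfaff_legendre'_def algebra_simps)
  define A B C u U where "A = eval_fps \<phi> (W z)" and "B = eval_fps (fps_deriv \<phi>) (W z)"
    and "C = eval_fps (fps_deriv (fps_deriv \<phi>)) (W z)" and "u = 1 - z" and "U = u powr \<nu>"
  have u: "u \<noteq> 0" using nz by (auto simp: u_def)
  have 1: "((\<lambda>z. \<nu> / (1 - z)) has_field_derivative \<nu> / u\<^sup>2) (at z)"
    using nz by (auto intro!: derivative_eq_intros simp: u_def power2_eq_square)
  have 2: "((\<lambda>z. 1 / (1 - z)\<^sup>2) has_field_derivative 2 / u ^ 3) (at z)"
  proof -
    have "((\<lambda>z. 1 / (1 - z)\<^sup>2) has_field_derivative 2 * (1 - z) / ((1 - z)\<^sup>2 * (1 - z)\<^sup>2)) (at z)"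
      using nz by (auto intro!: derivative_eq_intros)
    moreover have "2 * (1 - z) / ((1 - z)\<^sup>2 * (1 - z)\<^sup>2) = 2 / u ^ 3"
      unfolding u_def[symmetric] using u by (simp add: power_numeral_reduce divide_simps)
    ultimately show ?thesis by simp
  qed
  have D': "((\<lambda>z. - ((1 - z) powr \<nu>) * (\<nu> / (1 - z) * eval_fps \<phi> (W z)
     + 1 / (1 - z)\<^sup>2 * eval_fps (fps_deriv \<phi>) (W z))) has_field_derivative
       (\<nu> / u * U * (\<nu> / u * A + 1 / u\<^sup>2 * B) + (\<nu> / u\<^sup>2 * A + (- B / u\<^sup>2) * (\<nu> / u) + (2 / u ^ 3 * B + (- C / u\<^sup>2) * (1 / u\<^sup>2))) * (- U))) (at z)"
    using DERIV_mult[OF DERIV_minus[OF D(1)] DERIV_add[OF DERIV_mult[OF 1 D(2)] DERIV_mult[OF 2 D(3)]]]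
    by (simp add: A_def B_def C_def U_def u_def)
  have "(\<nu> / u * U * (\<nu> / u * A + 1 / u\<^sup>2 * B) + (\<nu> / u\<^sup>2 * A + (- B / u\<^sup>2) * (\<nu> / u) + (2 / u ^ 3 * B + (- C / u\<^sup>2) * (1 / u\<^sup>2))) * (- U))
      = pfaff_legendre'' z"
    unfolding pfaff_legendre''_def A_def[symmetric] B_def[symmetric] C_def[symmetric] U_def[symmetric] u_def[symmetric]
    using u by (simp add: power_numeral_reduce divide_simps) (simp add: algebra_simps)
  with D' show "(pfaff_legendre' has_field_derivative pfaff_legendre'' z) (at z)"
    by (simp add: pfaff_legendre'_def[abs_def])
qed

text \<open>Evaluation at w is a ring homomorphism on the series whose radius of convergence exceeds
  the modulus of w (the predicate \<open>R\<close>); it turns the formal equation into an identity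
  between values.\<close>

private lemma eval_ode: assumes "Re z < 1 / 2"
  shows "W z * (1 - W z) * eval_fps (fps_deriv (fps_deriv \<phi>)) (W z)
    + (1 - (1 - 2 * \<nu>) * W z) * eval_fps (fps_deriv \<phi>) (W z) - \<nu>\<^sup>2 * eval_fps \<phi> (W z) = 0"
proof -
  define w where "w = W z"
  define R where "R = (\<lambda>f :: complex fps. ereal (norm w) < fps_conv_radius f)"
  define f where "f = \<phi>"
  have R: "R f" "R (fps_deriv f)" "R (fps_deriv (fps_deriv f))" "R fps_X" "R 1" "\<And>c. R (fps_const c)"
    using rad[OF assms] by (auto simp: R_def w_def f_def)
  have Rm: "R (f * g)" "R (f - g)" "R (f + g)" if "R f" "R g" for f g
    using that fps_conv_radius_mult[of f g] fps_conv_radius_diff[of f g] fps_conv_radius_add[of f g]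
    unfolding R_def by (meson less_le_trans min_less_iff_conj)+
  have e: "eval_fps (f * g) w = eval_fps f w * eval_fps g w" "eval_fps (f + g) w = eval_fps f w + eval_fps g w"
    "eval_fps (f - g) w = eval_fps f w - eval_fps g w" if "R f" "R g" for f g
    using that by (auto simp: R_def eval_fps_mult eval_fps_add eval_fps_diff)
  define c d where "c = (-\<nu> + -\<nu> + 1)" and "d = (-\<nu>) * (-\<nu>)"
  have "fps_X * (1 - fps_X) * fps_deriv (fps_deriv f) + (1 - fps_const c * fps_X) * fps_deriv f - fps_const d * f = 0"
    unfolding c_def d_def hypergeometric_ode_fps_iff f_def using fps_hypergeo_2_1_recurrence by blast
  hence "eval_fps (fps_X * (1 - fps_X) * fps_deriv (fps_deriv f)
     + (1 - fps_const c * fps_X) * fps_deriv f - fps_const d * f) w = 0"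
    by simp
  hence "w * (1 - w) * eval_fps (fps_deriv (fps_deriv f)) w + (1 - c * w) * eval_fps (fps_deriv f) w - d * eval_fps f w = 0"
    by (simp add: e R Rm)
  thus ?thesis by (simp add: c_def d_def f_def w_def power2_eq_square)
qed

text \<open>The operator of the equation in z, applied to \<open>pfaff_legendre\<close>, equals -(1
  - z)^(\<nu> - 1) times the hypergeometric operator with parameters -\<nu>, -\<nu> taken at z / (z
  - 1), which annihilates the series.\<close>

lemma pfaff_legendre_ode:
  assumes "Re z < 1 / 2"
  shows "z * (1 - z) * pfaff_legendre'' z + (1 - 2 * z) * pfaff_legendre' z + \<nu> * (\<nu> + 1) * pfaff_legendre z = 0"
proof -
  define A B C u U where "A = eval_fps \<phi> (W z)" and "B = eval_fps (fps_deriv \<phi>) (W z)"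
    and "C = eval_fps (fps_deriv (fps_deriv \<phi>)) (W z)" and "u = 1 - z" and "U = u powr \<nu>"
  have u: "u \<noteq> 0" using assms by (auto simp: u_def)
  have z: "z = 1 - u" by (simp add: u_def)
  have W: "W z = 1 - 1 / u" using u by (simp add: z divide_simps)
  have ode: "(1 - 1 / u) * (1 - (1 - 1 / u)) * C + (1 - (1 - 2 * \<nu>) * (1 - 1 / u)) * B - \<nu>\<^sup>2 * A = 0"
    using eval_ode[OF assms] unfolding A_def[symmetric] B_def[symmetric] C_def[symmetric] unfolding W .
  have "z * (1 - z) * pfaff_legendre'' z + (1 - 2 * z) * pfaff_legendre' z + \<nu> * (\<nu> + 1) * pfaff_legendre z
     = - U / u * ((1 - 1 / u) * (1 - (1 - 1 / u)) * C + (1 - (1 - 2 * \<nu>) * (1 - 1 / u)) * B - \<nu>\<^sup>2 * A)"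
    unfolding pfaff_legendre''_def pfaff_legendre'_def pfaff_legendre_def
      A_def[symmetric] B_def[symmetric] C_def[symmetric] U_def[symmetric] u_def[symmetric]
    unfolding z using u by (simp add: power_numeral_reduce divide_simps) (simp add: algebra_simps)
  thus ?thesis using ode by simp
qed

text \<open>No series is rearranged: the expansion of \<open>pfaff_legendre\<close> solves the
  hypergeometric equation with parameters -\<nu>, \<nu> + 1 and has constant term 1, which
  determines it.\<close>

lemma pfaff_legendre_fps: "pfaff_legendre has_fps_expansion fps_hypergeo [-\<nu>, \<nu> + 1] [1] 1"
proof -
  let ?H = "{z. Re z < 1 / 2}"
  have op: "open ?H" by (rule open_halfspace_Re_lt)
  have hol: "pfaff_legendre holomorphic_on ?H"
    using pfaff_legendre_deriv(1) op by (auto simp: holomorphic_on_open)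
  define G where "G = fps_expansion pfaff_legendre 0"
  have G: "pfaff_legendre has_fps_expansion G"
    unfolding G_def by (rule has_fps_expansion_fps_expansion[OF op _ hol]) auto
  have ev: "eventually (\<lambda>z. z \<in> ?H) (nhds 0)" by (rule eventually_nhds_in_open[OF op]) simp
  have cong: "g has_fps_expansion F" if "f has_fps_expansion F" "\<And>z. z \<in> ?H \<Longrightarrow> f z = g z" for f g :: "complex \<Rightarrow> complex" and F
    using that(1) unfolding has_fps_expansion_def
    by (auto elim!: eventually_elim2[OF ev] simp: that(2))
  have G1: "pfaff_legendre' has_fps_expansion fps_deriv G"
    by (rule cong[OF has_fps_expansion_deriv[OF G]]) (rule DERIV_imp_deriv, rule pfaff_legendre_deriv, simp)
  have G2: "pfaff_legendre'' has_fps_expansion fps_deriv (fps_deriv G)"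
    by (rule cong[OF has_fps_expansion_deriv[OF G1]]) (rule DERIV_imp_deriv, rule pfaff_legendre_deriv, simp)
  \<comment> \<open>\<open>c\<close> equals 2, but is kept in the form a + b + 1 to fit the
    uniqueness lemma.\<close>
  define c d where "c = -\<nu> + (\<nu> + 1) + 1" and "d = -\<nu> * (\<nu> + 1)"
  have "(\<lambda>z. z * (1 - z) * pfaff_legendre'' z + (1 - c * z) * pfaff_legendre' z - d * pfaff_legendre z)
     has_fps_expansion (fps_X * (1 - fps_X) * fps_deriv (fps_deriv G)
     + (1 - fps_const c * fps_X) * fps_deriv G - fps_const d * G)"
    by (intro fps_expansion_intros G G1 G2)
  hence "(\<lambda>_. 0) has_fps_expansion (fps_X * (1 - fps_X) * fps_deriv (fps_deriv G)
     + (1 - fps_const c * fps_X) * fps_deriv G - fps_const d * G)"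
    by (rule cong) (use pfaff_legendre_ode in \<open>auto simp: c_def d_def algebra_simps\<close>)
  hence ode: "fps_X * (1 - fps_X) * fps_deriv (fps_deriv G)
     + (1 - fps_const c * fps_X) * fps_deriv G - fps_const d * G = 0"
    by (rule fps_expansion_unique_complex) auto
  have "fps_nth G 0 = pfaff_legendre 0"
    using fps_nth_fps_expansion[OF G, of 0] by simp
  also have "\<dots> = 1" by (simp add: pfaff_legendre_def eval_fps_at_0)
  finally have "G = fps_hypergeo [-\<nu>, \<nu> + 1] [1] 1"
    using fps_hypergeo_2_1_unique[of G "-\<nu>" "\<nu> + 1"] ode unfolding c_def d_def by blast
  thus ?thesis using G by simp
qed

lemma legendre_P_eq_pfaff:
  assumes "y > 0"
  shows "legendre_P \<nu> y = pfaff_legendre (of_real ((1 - y) / 2))"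
  unfolding legendre_P_def
proof (rule hyp2F1_eqI[OF _ pfaff_legendre_fps])
  let ?H = "{z. Re z < 1 / 2}"
  have op: "open ?H" by (rule open_halfspace_Re_lt)
  have "convex ?H" by (rule convex_halfspace_Re_lt)
  hence "closed_segment 0 (complex_of_real ((1 - y) / 2)) \<subseteq> ?H"
    using assms by (intro closed_segment_subset) auto
  moreover have "pfaff_legendre analytic_on ?H"
    using pfaff_legendre_deriv(1) op by (auto simp: analytic_on_open holomorphic_on_open)
  ultimately show "pfaff_legendre analytic_on closed_segment 0 (complex_of_real ((1 - y) / 2))"
    by (rule analytic_on_subset[rotated])
qed

end

text \<open>The substitution merely swaps the two upper parameters -\<nu> and \<nu> + 1. It reduces
  the growth estimates to Re \<nu> \<ge> -1/2.\<close>

lemma legendre_P_minus: "legendre_P (-1 - \<nu>) y = legendre_P \<nu> y"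
proof -
  have "fps_hypergeo [-(-1 - \<nu>), (-1 - \<nu>) + 1] [1] 1 = fps_hypergeo [-\<nu>, \<nu> + 1] [1] (1::complex)"
    by (simp add: fps_eq_iff algebra_simps)
  thus ?thesis by (simp only: legendre_P_def hyp2F1_def)
qed

section \<open>Legendre functions on the half-line\<close>

definition legendre_P' :: "complex \<Rightarrow> real \<Rightarrow> complex" where
  "legendre_P' \<nu> y = vector_derivative (legendre_P \<nu>) (at y)"

lemma legendre_P'_minus: "legendre_P' (-1 - \<nu>) y = legendre_P' \<nu> y"
proof -
  have "legendre_P (-1 - \<nu>) = legendre_P \<nu>" by (intro ext legendre_P_minus)
  thus ?thesis by (simp add: legendre_P'_def)
qed

lemma has_vector_derivative_pfaff_legendre:
  assumes "y > 0"
  shows "((\<lambda>y. pfaff_legendre \<nu> (of_real ((1 - y) / 2))) has_vector_derivative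
      - 1 / 2 * pfaff_legendre' \<nu> (of_real ((1 - y) / 2))) (at y)"
    "((\<lambda>y. pfaff_legendre' \<nu> (of_real ((1 - y) / 2))) has_vector_derivative
      - 1 / 2 * pfaff_legendre'' \<nu> (of_real ((1 - y) / 2))) (at y)"
proof -
  have 1: "((\<lambda>y. complex_of_real ((1 - y) / 2)) has_vector_derivative - 1 / 2) (at y)"
    unfolding of_real_divide of_real_diff
    by (auto intro!: derivative_eq_intros)
  have 2: "Re (complex_of_real ((1 - y) / 2)) < 1 / 2" using assms by simp
  show "((\<lambda>y. pfaff_legendre \<nu> (of_real ((1 - y) / 2))) has_vector_derivative
      - 1 / 2 * pfaff_legendre' \<nu> (of_real ((1 - y) / 2))) (at y)"
    using field_vector_diff_chain_at[OF 1 pfaff_legendre_deriv(1)[OF 2]] by (simp add: o_def)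
  show "((\<lambda>y. pfaff_legendre' \<nu> (of_real ((1 - y) / 2))) has_vector_derivative
      - 1 / 2 * pfaff_legendre'' \<nu> (of_real ((1 - y) / 2))) (at y)"
    using field_vector_diff_chain_at[OF 1 pfaff_legendre_deriv(2)[OF 2]] by (simp add: o_def)
qed

lemma has_vector_derivative_cong_pos:
  assumes "(f has_vector_derivative D) (at y)" "y > (0::real)" "\<And>x. x > 0 \<Longrightarrow> g x = f x"
  shows "(g has_vector_derivative D) (at y)"
  by (rule has_vector_derivative_transform_within_open[OF assms(1), of "{0<..}"]) (use assms in auto)

lemma legendre_P'_eq_pfaff:
  assumes "y > 0" shows "legendre_P' \<nu> y = - 1 / 2 * pfaff_legendre' \<nu> (of_real ((1 - y) / 2))"
  unfolding legendre_P'_def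
  by (rule vector_derivative_at, rule has_vector_derivative_cong_pos[OF has_vector_derivative_pfaff_legendre(1)])
     (use assms legendre_P_eq_pfaff in auto)

lemma has_vector_derivative_legendre_P:
  assumes "y > 0" shows "(legendre_P \<nu> has_vector_derivative legendre_P' \<nu> y) (at y)"
  unfolding legendre_P'_eq_pfaff[OF assms]
  by (rule has_vector_derivative_cong_pos[OF has_vector_derivative_pfaff_legendre(1)])
     (use assms legendre_P_eq_pfaff in auto)

lemma legendre_P_one [simp]: "legendre_P \<nu> 1 = 1"
  by (subst legendre_P_eq_pfaff) (auto simp: pfaff_legendre_def eval_fps_at_0)

lemma has_vector_derivative_legendre_P':
  assumes "y > 0" shows "(legendre_P' \<nu> has_vector_derivative 1 / 4 * pfaff_legendre'' \<nu> (of_real ((1 - y) / 2))) (at y)"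
proof (rule has_vector_derivative_cong_pos[where f = "\<lambda>y. - 1 / 2 * pfaff_legendre' \<nu> (of_real ((1 - y) / 2))"])
  show "((\<lambda>y. - 1 / 2 * pfaff_legendre' \<nu> (of_real ((1 - y) / 2))) has_vector_derivative
     1 / 4 * pfaff_legendre'' \<nu> (of_real ((1 - y) / 2))) (at y)"
    by (rule has_vector_derivative_eq_rhs, rule has_vector_derivative_mult_right,
        rule has_vector_derivative_pfaff_legendre(2)[OF assms]) simp
qed (use assms legendre_P'_eq_pfaff in auto)

text \<open>The self-adjoint form of Legendre's equation. With z = (1 - y) / 2 one has 1 - y^2 = 4 z
  (1 - z), and each derivative in y contributes a factor -1/2.\<close>

lemma legendre_ode:
  assumes "y > 0"
  shows "((\<lambda>y. (1 - of_real y ^ 2) * legendre_P' \<nu> y) has_vector_derivative - (\<nu> * (\<nu> + 1)) * legendre_P \<nu> y) (at y)"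
proof -
  define z where "z = complex_of_real ((1 - y) / 2)"
  have y: "of_real y = 1 - 2 * z" by (simp add: z_def field_simps)
  have 1: "((\<lambda>y. 1 - complex_of_real y ^ 2) has_vector_derivative (- 2 * of_real y)) (at y)"
    unfolding power2_eq_square by (auto intro!: derivative_eq_intros)
  have "((\<lambda>y. (1 - of_real y ^ 2) * legendre_P' \<nu> y) has_vector_derivative
     (1 - of_real y ^ 2) * (1 / 4 * pfaff_legendre'' \<nu> z) + (- 2 * of_real y) * legendre_P' \<nu> y) (at y)"
    unfolding z_def by (rule has_vector_derivative_mult[OF 1 has_vector_derivative_legendre_P'[OF assms]])
  also have "(1 - of_real y ^ 2) * (1 / 4 * pfaff_legendre'' \<nu> z) + (- 2 * of_real y) * legendre_P' \<nu> y =
     (z * (1 - z) * pfaff_legendre'' \<nu> z + (1 - 2 * z) * pfaff_legendre' \<nu> z + \<nu> * (\<nu> + 1) * pfaff_legendre \<nu> z)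
      - \<nu> * (\<nu> + 1) * legendre_P \<nu> y"
    using assms by (simp add: legendre_P'_eq_pfaff legendre_P_eq_pfaff flip: z_def)
      (simp add: y power2_eq_square field_simps)
  also have "\<dots> = - (\<nu> * (\<nu> + 1)) * legendre_P \<nu> y"
    using assms by (subst pfaff_legendre_ode) (auto simp: z_def)
  finally show ?thesis .
qed

lemma continuous_on_legendre_P: "continuous_on {0<..} (legendre_P \<nu>)"
  by (rule continuous_on_vector_derivative)
     (auto intro: has_vector_derivative_at_within has_vector_derivative_legendre_P)

lemma continuous_on_legendre_P': "continuous_on {0<..} (legendre_P' \<nu>)"
  by (rule continuous_on_vector_derivative)
     (auto intro: has_vector_derivative_at_within has_vector_derivative_legendre_P')

text \<open>As y tends to 0 the variable (y - 1) / (y + 1) reaches the boundary of the unit disc, so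
  the Gauss series is used instead: for 0 < y \<le> 1 its argument (1 - y) / 2 stays in the compact
  disc of radius 1/2.\<close>

lemma legendre_bounded_near_0:
  obtains K where "K > 0" "\<And>y. y \<in> {0<..1} \<Longrightarrow> norm (legendre_P \<nu> y) \<le> K"
    "\<And>y. y \<in> {0<..1} \<Longrightarrow> norm (legendre_P' \<nu> y) \<le> K"
proof -
  define f where "f = fps_hypergeo [-\<nu>, \<nu> + 1] [1] (1::complex)"
  have rad: "fps_conv_radius f \<ge> 1" "fps_conv_radius (fps_deriv f) \<ge> 1"
    using fps_conv_radius_hypergeo_2_1 fps_conv_radius_deriv[of f] order_trans unfolding f_def by blast+
  have le: "ereal (norm z) < fps_conv_radius f" if "norm z < 1" for z :: complex
    using less_le_trans[OF _ rad(1), of "ereal (norm z)"] that by simp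
  \<comment> \<open>The range -1 < y < 3 is open and contains y = 1, so the equality can be
    differentiated there as well.\<close>
  have P: "legendre_P \<nu> y = eval_fps f (of_real ((1 - y) / 2))" if y: "\<bar>1 - y\<bar> < 2" for y
    unfolding legendre_P_def
  proof (rule hyp2F1_eqI)
    have "closed_segment 0 (complex_of_real ((1 - y) / 2)) \<subseteq> ball 0 1"
      using y by (intro closed_segment_subset convex_ball) (auto simp: norm_divide norm_mult simp flip: of_real_diff)
    moreover have "ball 0 1 \<subseteq> eball (0::complex) (fps_conv_radius f)"
      using le by auto
    ultimately show "eval_fps f analytic_on closed_segment 0 (complex_of_real ((1 - y) / 2))"
      by (intro analytic_on_subset[OF analytic_on_open[THEN iffD2, OF _ holomorphic_on_eval_fps[OF order_refl]]]) auto
    show "eval_fps f has_fps_expansion fps_hypergeo [-\<nu>, \<nu> + 1] [1] 1"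
      unfolding f_def[symmetric] using rad(1) by (intro eval_fps_has_fps_expansion) (auto intro: less_le_trans[of _ 1])
  qed
  have P': "legendre_P' \<nu> y = - 1 / 2 * eval_fps (fps_deriv f) (of_real ((1 - y) / 2))" if y: "\<bar>1 - y\<bar> < 2" for y
    unfolding legendre_P'_def
  proof (rule vector_derivative_at, rule has_vector_derivative_transform_within_open)
    have 1: "((\<lambda>y. complex_of_real ((1 - y) / 2)) has_vector_derivative - 1 / 2) (at y)"
      unfolding of_real_divide of_real_diff by (auto intro!: derivative_eq_intros)
    have "norm (complex_of_real ((1 - y) / 2)) < 1"
      using y by (simp add: norm_divide norm_mult flip: of_real_diff)
    from field_vector_diff_chain_at[OF 1 has_field_derivative_eval_fps[OF le[OF this]]]
    show "((\<lambda>y. eval_fps f (complex_of_real ((1 - y) / 2))) has_vector_derivative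
       - 1 / 2 * eval_fps (fps_deriv f) (of_real ((1 - y) / 2))) (at y)"
      by (simp add: o_def)
    show "y \<in> ball 1 2" "open (ball (1::real) 2)" using y by (auto simp: dist_real_def)
  qed (use P in \<open>auto simp: dist_real_def\<close>)
  have bd: "\<exists>B. \<forall>z\<in>cball 0 (1/2). norm (eval_fps g z) \<le> B" if "fps_conv_radius g \<ge> 1" for g :: "complex fps"
  proof -
    have "ereal (norm z) < fps_conv_radius g" if "norm z < 1" for z :: complex
      using less_le_trans[OF _ \<open>fps_conv_radius g \<ge> 1\<close>, of "ereal (norm z)"] that by simp
    hence "continuous_on (cball 0 (1/2)) (eval_fps g)"
      by (intro continuous_on_subset[OF continuous_on_eval_fps]) auto
    hence "bounded (eval_fps g ` cball 0 (1/2))"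
      by (intro compact_imp_bounded compact_continuous_image compact_cball)
    thus ?thesis by (auto simp: bounded_iff)
  qed
  obtain B1 B2 where B: "\<And>z. z \<in> cball 0 (1/2) \<Longrightarrow> norm (eval_fps f z) \<le> B1"
    "\<And>z. z \<in> cball 0 (1/2) \<Longrightarrow> norm (eval_fps (fps_deriv f) z) \<le> B2"
    using bd[OF rad(1)] bd[OF rad(2)] by blast
  show ?thesis
  proof (rule that[of "\<bar>B1\<bar> + \<bar>B2\<bar> + 1"])
    fix y :: real assume "y \<in> {0<..1}"
    hence y: "0 < y" "y \<le> 1" by auto
    have z: "complex_of_real ((1 - y) / 2) \<in> cball 0 (1/2)"
      using y by (simp add: norm_divide norm_mult flip: of_real_diff)
    show "norm (legendre_P \<nu> y) \<le> \<bar>B1\<bar> + \<bar>B2\<bar> + 1"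
      using B(1)[OF z] y by (subst P) auto
    show "norm (legendre_P' \<nu> y) \<le> \<bar>B1\<bar> + \<bar>B2\<bar> + 1"
      using B(2)[OF z] y by (subst P') (auto simp: norm_mult)
  qed auto
qed

text \<open>The coefficients (pochhammer (-\<nu>) n / n!)^2 are of order n^(-2 Re \<nu> - 2), hence
  O(1/n) when Re \<nu> \<ge> -1/2. The series is therefore dominated by that of -ln (1 - w), and its
  derivative by a geometric series.\<close>

lemma pfaff_series_bounds:
  assumes \<nu>: "Re \<nu> \<ge> - 1 / 2"
  obtains K where "K > 0"
    "\<And>w. 0 \<le> w \<Longrightarrow> w < 1 \<Longrightarrow> norm (eval_fps (fps_hypergeo [-\<nu>, -\<nu>] [1] 1) (of_real w)) \<le> 1 - K * ln (1 - w)"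
    "\<And>w. 0 \<le> w \<Longrightarrow> w < 1 \<Longrightarrow> norm (eval_fps (fps_deriv (fps_hypergeo [-\<nu>, -\<nu>] [1] 1)) (of_real w)) \<le> K / (1 - w)"
proof -
  define f where "f = fps_hypergeo [-\<nu>, -\<nu>] [1] (1::complex)"
  have rad: "fps_conv_radius f \<ge> 1" "fps_conv_radius (fps_deriv f) \<ge> 1"
    using fps_conv_radius_hypergeo_2_1 fps_conv_radius_deriv[of f] order_trans unfolding f_def by blast+
  obtain C where C: "C > 0" "\<And>n. n \<ge> 1 \<Longrightarrow> norm (pochhammer (-\<nu>) (Suc n) / fact n) \<le> C * real n powr Re (-\<nu>)"
    using pochhammer_over_fact_bound by blast
  define K where "K = C\<^sup>2 + (norm \<nu>)\<^sup>2"
  have K: "norm (fps_nth f (Suc n)) * Suc n \<le> K" for n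
  proof (cases "n = 0")
    case True
    thus ?thesis by (simp add: f_def K_def power2_eq_square norm_mult)
  next
    case False
    hence n: "n \<ge> 1" by simp
    have "fps_nth f (Suc n) = (pochhammer (-\<nu>) (Suc n) / fact n)\<^sup>2 / (of_nat (Suc n))\<^sup>2"
      unfolding f_def fps_hypergeo_2_1_nth
      by (simp add: power2_eq_square field_simps del: of_nat_Suc pochhammer_Suc)
    hence "norm (fps_nth f (Suc n)) = (norm (pochhammer (-\<nu>) (Suc n) / fact n))\<^sup>2 / (Suc n)\<^sup>2"
      by (simp add: norm_divide norm_power del: of_nat_Suc)
    also have "\<dots> \<le> (C * real n powr Re (-\<nu>))\<^sup>2 / (Suc n)\<^sup>2"
      by (intro divide_right_mono power_mono C n) auto
    also have "(C * real n powr Re (-\<nu>))\<^sup>2 = C\<^sup>2 * real n powr (- 2 * Re \<nu>)"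
      by (simp add: power2_eq_square flip: powr_add)
    also have "\<dots> \<le> C\<^sup>2 * real n powr 1"
      using n \<nu> by (intro mult_left_mono powr_mono) auto
    also have "C\<^sup>2 * real n powr 1 / (Suc n)\<^sup>2 \<le> C\<^sup>2 / Suc n"
    proof -
      have "C\<^sup>2 * real n powr 1 / (Suc n)\<^sup>2 = C\<^sup>2 / Suc n * (n / Suc n)"
        using n by (simp add: power2_eq_square) (simp add: algebra_simps)
      also have "\<dots> \<le> C\<^sup>2 / Suc n * 1" by (intro mult_left_mono) auto
      finally show ?thesis by simp
    qed
    finally have "norm (fps_nth f (Suc n)) * Suc n \<le> C\<^sup>2"
      by (simp add: pos_le_divide_eq del: of_nat_Suc)
    thus ?thesis by (simp add: K_def add_increasing2 del: of_nat_Suc)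
  qed
  have Kpos: "K > 0" using C by (simp add: K_def add_pos_nonneg)
  show ?thesis
  proof (rule that[OF Kpos], fold f_def)
    fix w :: real assume w: "0 \<le> w" "w < 1"
    have r: "ereal (norm (complex_of_real w)) < fps_conv_radius f" "ereal (norm (complex_of_real w)) < fps_conv_radius (fps_deriv f)"
      using less_le_trans[OF _ rad(1), of "ereal (norm (complex_of_real w))"]
        less_le_trans[OF _ rad(2), of "ereal (norm (complex_of_real w))"] w by auto
    have "(\<lambda>n. K * w ^ n) sums (K * (1 / (1 - w)))"
      using w by (intro sums_mult geometric_sums) auto
    moreover have "norm (fps_nth (fps_deriv f) n * of_real w ^ n) \<le> K * w ^ n" for n
      using K[of n] w mult_right_mono[of "norm (fps_nth f (Suc n)) * Suc n" K "w ^ n"]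
      by (simp add: norm_mult norm_power mult_ac del: of_nat_Suc)
    ultimately show "norm (eval_fps (fps_deriv f) (of_real w)) \<le> K / (1 - w)"
      using norm_sums_le[OF sums_eval_fps[OF r(2)]] by simp
    \<comment> \<open>At n = 0 the division by zero gives 0, so the constant coefficient 1 comes
      from the first summand alone.\<close>
    have "(\<lambda>n. (if n = 0 then 1 else 0) + - K * (- ((- (- w)) ^ n) / of_nat n)) sums (1 + - K * ln (1 + - w))"
      using w by (intro sums_add sums_mult ln_series') (auto simp: sums_single[of 0 "\<lambda>_. 1"])
    moreover have "norm (fps_nth f n * of_real w ^ n) \<le> (if n = 0 then 1 else 0) + - K * (- ((- (- w)) ^ n) / of_nat n)" for n
    proof (cases n)
      case 0
      thus ?thesis by (simp add: f_def)
    next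
      case (Suc m)
      have "norm (fps_nth f n) * w ^ n \<le> K / n * w ^ n"
        using K[of m] w Suc by (intro mult_right_mono) (auto simp: pos_le_divide_eq simp del: of_nat_Suc)
      thus ?thesis using Suc w by (simp add: norm_mult norm_power)
    qed
    ultimately have "norm (eval_fps f (of_real w)) \<le> 1 + - K * ln (1 + - w)"
      by (rule norm_sums_le[OF sums_eval_fps[OF r(1)]])
    thus "norm (eval_fps f (of_real w)) \<le> 1 - K * ln (1 - w)" by simp
  qed
qed

text \<open>For u = (1 + y) / 2 and w = (y - 1) / (y + 1) one has 1 - w = 1 / u, so the logarithmic
  singularity at w = 1 becomes ln y. The singularity 1 / (1 - w) of the derived series is offset by
  the factor 1 / u^2. The case Re \<nu> < -1/2 follows by the symmetry between \<nu> and -1 -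
  \<nu>.\<close>

lemma legendre_growth:
  fixes \<nu> :: complex
  defines "\<sigma> \<equiv> max (Re \<nu>) (-1 - Re \<nu>)"
  obtains K where "K > 0" "\<And>y. y \<ge> 1 \<Longrightarrow> norm (legendre_P \<nu> y) \<le> K * y powr \<sigma> * (1 + ln y)"
    "\<And>y. y \<ge> 1 \<Longrightarrow> norm (legendre_P' \<nu> y) \<le> K * y powr (\<sigma> - 1) * (1 + ln y)"
proof -
  have main: "\<exists>K>0. \<forall>y\<ge>1. norm (legendre_P \<nu> y) \<le> K * y powr Re \<nu> * (1 + ln y) \<and>
       norm (legendre_P' \<nu> y) \<le> K * y powr (Re \<nu> - 1) * (1 + ln y)" if \<nu>: "Re \<nu> \<ge> - 1 / 2" for \<nu> :: complex
  proof -
    obtain K where K: "K > 0"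
      "\<And>w. 0 \<le> w \<Longrightarrow> w < 1 \<Longrightarrow> norm (eval_fps (fps_hypergeo [-\<nu>, -\<nu>] [1] 1) (of_real w)) \<le> 1 - K * ln (1 - w)"
      "\<And>w. 0 \<le> w \<Longrightarrow> w < 1 \<Longrightarrow> norm (eval_fps (fps_deriv (fps_hypergeo [-\<nu>, -\<nu>] [1] 1)) (of_real w)) \<le> K / (1 - w)"
      using pfaff_series_bounds[OF \<nu>] by blast
    define M where "M = 4 * (1 + K) * (1 + norm \<nu>)"
    show ?thesis
    proof (intro exI[of _ M] conjI allI impI)
      show "M > 0" unfolding M_def using K(1) by (intro mult_pos_pos) (auto intro: add_pos_nonneg)
      fix y :: real assume y: "y \<ge> 1"
      define u where "u = (1 + y) / 2"
      define w where "w = (y - 1) / (y + 1)"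
      have w: "0 \<le> w" "w < 1" "1 - w = 1 / u" using y by (auto simp: w_def u_def field_simps)
      have u: "u \<ge> 1" "u \<le> y" "y / 2 \<le> u" using y by (auto simp: u_def)
      define z where "z = complex_of_real ((1 - y) / 2)"
      have z1: "1 - z = of_real u" by (simp add: z_def u_def field_simps)
      have zw: "z / (z - 1) = of_real w"
      proof -
        have "z - 1 = of_real ((- 1 - y) / 2)" by (simp add: z_def field_simps)
        hence "z / (z - 1) = of_real (((1 - y) / 2) / ((- 1 - y) / 2))" unfolding z_def by (simp only: of_real_divide)
        also have "((1 - y) / 2) / ((- 1 - y) / 2) = w" using y by (simp add: w_def divide_simps) (simp add: algebra_simps)
        finally show ?thesis .
      qed
      define A B where "A = eval_fps (fps_hypergeo [-\<nu>, -\<nu>] [1] 1) (complex_of_real w)"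
        and "B = eval_fps (fps_deriv (fps_hypergeo [-\<nu>, -\<nu>] [1] 1)) (complex_of_real w)"
      have lnu: "0 \<le> ln u" "ln u \<le> ln y" using u by auto
      have "norm A \<le> 1 - K * ln (1 - w)" using K(2)[OF w(1,2)] by (simp add: A_def)
      also have "\<dots> = 1 + K * ln u" using u by (simp add: w(3) ln_div)
      also have "\<dots> \<le> (1 + K) * (1 + ln y)"
      proof -
        have "K * ln u \<le> K * ln y" "0 \<le> ln y" using lnu K(1) by (auto intro: mult_left_mono)
        moreover have "(1 + K) * (1 + ln y) = 1 + ln y + K + K * ln y" by (simp add: algebra_simps)
        ultimately show ?thesis using K(1) by linarith
      qed
      finally have A: "norm A \<le> (1 + K) * (1 + ln y)" .
      have B: "norm B \<le> K * u" using K(3)[OF w(1,2)] w(3) u by (simp add: B_def)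
      \<comment> \<open>Since y / 2 \<le> u \<le> y, a negative exponent costs at most 2^(-r). The
        exponents that occur are Re \<nu> and Re \<nu> - 1, both at least -3/2, so the constant 4
        covers them.\<close>
      have pw: "u powr r \<le> 4 * y powr r" if "r \<ge> - 3 / 2" for r
      proof (cases "r \<ge> 0")
        case True
        hence "u powr r \<le> 1 * y powr r" using u by (auto intro: powr_mono2)
        also have "\<dots> \<le> 4 * y powr r" by (intro mult_right_mono) auto
        finally show ?thesis .
      next
        case False
        hence "u powr r \<le> (y / 2) powr r" using u y by (intro powr_mono2') auto
        also have "\<dots> = (1 / 2) powr r * y powr r" using y by (simp add: powr_mult[symmetric])
        also have "(1 / 2) powr r * y powr r \<le> 4 * y powr r"
        proof (intro mult_right_mono)
          have "(1 / 2 :: real) powr r \<le> (1 / 2) powr (- 2)" using that by (intro powr_mono') auto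
          thus "(1 / 2 :: real) powr r \<le> 4" by (simp add: powr_minus powr_numeral power2_eq_square)
        qed simp
        finally show ?thesis by simp
      qed
      have nu: "norm ((1 - z) powr \<nu>) = u powr Re \<nu>"
        unfolding z1 using u by (subst norm_powr_real_powr) auto
      have y0: "y > 0" using y by simp
      have "legendre_P \<nu> y = (1 - z) powr \<nu> * A"
        unfolding legendre_P_eq_pfaff[OF y0] z_def[symmetric] pfaff_legendre_def zw A_def ..
      hence "norm (legendre_P \<nu> y) = u powr Re \<nu> * norm A"
        by (simp only: norm_mult nu)
      also have "\<dots> \<le> (4 * y powr Re \<nu>) * ((1 + K) * (1 + ln y))"
        using \<nu> by (intro mult_mono A pw) auto
      also have "\<dots> = (4 * (1 + K) * 1) * (y powr Re \<nu> * (1 + ln y))" by simp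
      also have "\<dots> \<le> M * (y powr Re \<nu> * (1 + ln y))"
        unfolding M_def using y K(1) by (intro mult_right_mono mult_left_mono mult_nonneg_nonneg) auto
      finally show "norm (legendre_P \<nu> y) \<le> M * y powr Re \<nu> * (1 + ln y)" by (simp only: mult.assoc)
      have "norm (legendre_P' \<nu> y) = 1 / 2 * (u powr Re \<nu> * norm (\<nu> / of_real u * A + B / (of_real u)\<^sup>2))"
        unfolding legendre_P'_eq_pfaff[OF y0] z_def[symmetric] pfaff_legendre'_def zw
        unfolding A_def[symmetric] B_def[symmetric] norm_mult norm_minus_cancel z1 using nu[unfolded z1] by simp
      also have "\<dots> \<le> 1 / 2 * (u powr Re \<nu> * (norm \<nu> / u * ((1 + K) * (1 + ln y)) + K * u / u\<^sup>2))"
      proof (intro mult_left_mono order_trans[OF norm_triangle_ineq] add_mono)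
        show "norm (\<nu> / of_real u * A) \<le> norm \<nu> / u * ((1 + K) * (1 + ln y))"
          unfolding norm_mult using A u by (intro mult_mono) (auto simp: norm_divide)
        show "norm (B / (complex_of_real u)\<^sup>2) \<le> K * u / u\<^sup>2"
          using B u by (simp add: norm_divide norm_power divide_right_mono)
      qed auto
      also have "u powr Re \<nu> * (norm \<nu> / u * ((1 + K) * (1 + ln y)) + K * u / u\<^sup>2)
        = u powr (Re \<nu> - 1) * (norm \<nu> * ((1 + K) * (1 + ln y)) + K)"
        using u by (simp add: powr_diff power2_eq_square field_simps)
      also have "\<dots> \<le> (4 * y powr (Re \<nu> - 1)) * ((1 + K) * (1 + norm \<nu>) * (1 + ln y))"
      proof (intro mult_mono pw)
        have "norm \<nu> * ((1 + K) * (1 + ln y)) + K \<le> norm \<nu> * ((1 + K) * (1 + ln y)) + (1 + K) * (1 + ln y)"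
          using K(1) y by (intro add_left_mono) (simp add: algebra_simps)
        thus "norm \<nu> * ((1 + K) * (1 + ln y)) + K \<le> (1 + K) * (1 + norm \<nu>) * (1 + ln y)"
          by (simp add: algebra_simps)
      qed (use \<nu> y K(1) in auto)
      also have "\<dots> = M * (y powr (Re \<nu> - 1) * (1 + ln y))" by (simp add: M_def)
      finally have "norm (legendre_P' \<nu> y) \<le> 1 / 2 * (M * (y powr (Re \<nu> - 1) * (1 + ln y)))" by simp
      also have "\<dots> \<le> 1 * (M * (y powr (Re \<nu> - 1) * (1 + ln y)))"
        using \<open>M > 0\<close> y by (intro mult_right_mono mult_nonneg_nonneg) auto
      finally show "norm (legendre_P' \<nu> y) \<le> M * y powr (Re \<nu> - 1) * (1 + ln y)" by simp
    qed
  qed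
  show ?thesis
  proof (cases "Re \<nu> \<ge> - 1 / 2")
    case True
    hence "\<sigma> = Re \<nu>" by (simp add: \<sigma>_def)
    thus ?thesis using main[OF True] that by blast
  next
    case False
    hence "\<sigma> = Re (-1 - \<nu>)" "Re (-1 - \<nu>) \<ge> - 1 / 2" by (auto simp: \<sigma>_def)
    thus ?thesis using main[of "-1 - \<nu>"] that unfolding legendre_P_minus legendre_P'_minus by metis
  qed
qed

section \<open>Mellin transforms of the derivative of the Legendre function\<close>

lemma powr_integral_at_infinity:
  fixes a :: real assumes "a < -1"
  shows "set_integrable lborel {1<..} (\<lambda>z. z powr a)" "(LBINT z:{1<..}. z powr a) = - 1 / (a + 1)"
proof -
  define F where "F = (\<lambda>z. z powr (a + 1) / (a + 1))"
  have D: "DERIV F x :> x powr a" if "1 < ereal x" for x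
  proof -
    have "x > 1" using that by simp
    thus ?thesis unfolding F_def using assms by (auto intro!: derivative_eq_intros simp: powr_diff)
  qed
  have C: "isCont (\<lambda>z. z powr a) x" if "1 < ereal x" for x
    using that by (auto intro!: continuous_intros)
  have L1: "((F \<circ> real_of_ereal) \<longlongrightarrow> 1 / (a + 1)) (at_right 1)"
  proof -
    have "(F \<longlongrightarrow> F 1) (at_right 1)"
      unfolding F_def using assms by (intro tendsto_intros) auto
    thus ?thesis by (simp add: ereal_tendsto_simps1 one_ereal_def F_def)
  qed
  have L2: "((F \<circ> real_of_ereal) \<longlongrightarrow> 0) (at_left \<infinity>)"
  proof -
    have "((\<lambda>z. z powr (a + 1)) \<longlongrightarrow> 0) at_top"
      using assms by (intro tendsto_neg_powr filterlim_ident) auto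
    hence "(F \<longlongrightarrow> 0 / (a + 1)) at_top"
      unfolding F_def using assms by (intro tendsto_divide tendsto_const) auto
    thus ?thesis by (simp add: ereal_tendsto_simps1)
  qed
  have ei: "einterval 1 \<infinity> = {1::real<..}" by (auto simp: einterval_def)
  note FTC = interval_integral_FTC_nonneg[of 1 \<infinity> F "\<lambda>z. z powr a", OF _ D C _ L1 L2, unfolded ei]
  show "set_integrable lborel {1<..} (\<lambda>z. z powr a)" by (rule FTC(1)) auto
  have "(LBINT z=1..\<infinity>. z powr a) = 0 - 1 / (a + 1)" by (rule FTC(2)) auto
  thus "(LBINT z:{1<..}. z powr a) = - 1 / (a + 1)"
    by (simp add: interval_lebesgue_integral_def ei)
qed

lemma powr_integral_at_zero:
  fixes a :: real assumes "a > -1"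
  shows "set_integrable lborel {0<..<1} (\<lambda>z. z powr a)" "(LBINT z:{0<..<1}. z powr a) = 1 / (a + 1)"
proof -
  define F where "F = (\<lambda>z. z powr (a + 1) / (a + 1))"
  have D: "DERIV F x :> x powr a" if "0 < ereal x" "ereal x < 1" for x
  proof -
    have "x > 0" using that by simp
    thus ?thesis unfolding F_def using assms by (auto intro!: derivative_eq_intros simp: powr_diff)
  qed
  have C: "isCont (\<lambda>z. z powr a) x" if "0 < ereal x" "ereal x < 1" for x
    using that by (auto intro!: continuous_intros)
  have L1: "((F \<circ> real_of_ereal) \<longlongrightarrow> 0) (at_right 0)"
  proof -
    have "((\<lambda>z. z powr (a + 1)) \<longlongrightarrow> 0 powr (a + 1)) (at_right 0)"
      using assms by (intro tendsto_powr' tendsto_const tendsto_ident_at) (auto simp: eventually_at_right_less intro: eventually_mono[OF eventually_at_right_less])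
    hence "(F \<longlongrightarrow> 0 powr (a + 1) / (a + 1)) (at_right 0)"
      unfolding F_def using assms by (intro tendsto_divide tendsto_const) auto
    thus ?thesis by (simp add: ereal_tendsto_simps1 zero_ereal_def)
  qed
  have L2: "((F \<circ> real_of_ereal) \<longlongrightarrow> 1 / (a + 1)) (at_left 1)"
  proof -
    have "(F \<longlongrightarrow> F 1) (at_left 1)"
      unfolding F_def using assms by (intro tendsto_intros) auto
    thus ?thesis by (simp add: ereal_tendsto_simps1 one_ereal_def F_def)
  qed
  have ei: "einterval 0 1 = {0::real<..<1}" by (auto simp: einterval_def)
  note FTC = interval_integral_FTC_nonneg[of 0 1 F "\<lambda>z. z powr a", OF _ D C _ L1 L2, unfolded ei]
  show "set_integrable lborel {0<..<1} (\<lambda>z. z powr a)" by (rule FTC(1)) auto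
  have "(LBINT z=0..1. z powr a) = 1 / (a + 1) - 0" by (rule FTC(2)) auto
  thus "(LBINT z:{0<..<1}. z powr a) = 1 / (a + 1)"
    by (simp add: interval_lebesgue_integral_def ei)
qed

text \<open>The logarithm is absorbed by raising the exponent by e = \<tau> - \<sigma> > 0, through
  ln y \<le> y^e / e.\<close>

lemma legendre_growth_powr:
  assumes "\<tau> > max (Re \<nu>) (-1 - Re \<nu>)"
  obtains K where "K > 0" "\<And>y. y \<ge> 1 \<Longrightarrow> norm (legendre_P \<nu> y) \<le> K * y powr \<tau>"
    "\<And>y. y \<ge> 1 \<Longrightarrow> norm (legendre_P' \<nu> y) \<le> K * y powr (\<tau> - 1)"
proof -
  define \<sigma> where "\<sigma> = max (Re \<nu>) (-1 - Re \<nu>)"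
  define e where "e = \<tau> - \<sigma>"
  have e: "e > 0" using assms by (simp add: e_def \<sigma>_def)
  obtain K where K: "K > 0" "\<And>y. y \<ge> 1 \<Longrightarrow> norm (legendre_P \<nu> y) \<le> K * y powr \<sigma> * (1 + ln y)"
    "\<And>y. y \<ge> 1 \<Longrightarrow> norm (legendre_P' \<nu> y) \<le> K * y powr (\<sigma> - 1) * (1 + ln y)"
    using legendre_growth[of \<nu>] unfolding \<sigma>_def by blast
  have ln: "1 + ln y \<le> (1 + 1 / e) * y powr e" if "y \<ge> 1" for y :: real
  proof -
    have "ln y \<le> y powr e / e" using that e by (intro ln_powr_bound)
    moreover have "1 \<le> y powr e" using that e by (intro ge_one_powr_ge_zero) auto
    ultimately show ?thesis by (simp add: algebra_simps)
  qed
  have *: "K * y powr r * (1 + ln y) \<le> (K * (1 + 1 / e)) * y powr (r + e)" if "y \<ge> 1" for y r :: real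
  proof -
    have "K * y powr r * (1 + ln y) \<le> K * y powr r * ((1 + 1 / e) * y powr e)"
      using K(1) by (intro mult_left_mono ln that) auto
    thus ?thesis by (simp add: powr_add mult_ac)
  qed
  have eq: "\<sigma> + e = \<tau>" "\<sigma> - 1 + e = \<tau> - 1" by (simp_all add: e_def)
  have "norm (legendre_P \<nu> y) \<le> (K * (1 + 1 / e)) * y powr \<tau>"
    "norm (legendre_P' \<nu> y) \<le> (K * (1 + 1 / e)) * y powr (\<tau> - 1)" if "y \<ge> 1" for y
    using order_trans[OF K(2)[OF that] *[OF that]] order_trans[OF K(3)[OF that] *[OF that]]
    unfolding eq by blast+
  thus ?thesis using K(1) e by (intro that[of "K * (1 + 1 / e)"] mult_pos_pos) (auto intro: add_pos_pos)
qed

lemma has_vector_derivative_of_real_powr: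
  assumes "x > 0"
  shows "((\<lambda>x. complex_of_real x powr a) has_vector_derivative a * of_real x powr (a - 1)) (at x)"
proof -
  have 1: "(complex_of_real has_vector_derivative 1) (at x)"
    by (auto intro!: derivative_eq_intros)
  have "complex_of_real x \<notin> \<real>\<^sub>\<le>\<^sub>0" using assms by (auto simp: complex_nonpos_Reals_iff)
  from field_vector_diff_chain_at[OF 1 has_field_derivative_powr[OF this]] show ?thesis
    by (simp add: o_def)
qed

lemma continuous_on_of_real_powr: "continuous_on {0<..} (\<lambda>x. complex_of_real x powr a)"
  by (rule continuous_on_vector_derivative)
     (auto intro: has_vector_derivative_at_within has_vector_derivative_of_real_powr)

definition legendre_kernel :: "complex \<Rightarrow> complex \<Rightarrow> real \<Rightarrow> complex" where
  "legendre_kernel \<nu> s z = of_real z powr (s - 1) * legendre_P' \<nu> z"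

lemma continuous_on_legendre_kernel: "continuous_on {0<..} (legendre_kernel \<nu> s)"
  unfolding legendre_kernel_def
  by (intro continuous_on_mult continuous_on_of_real_powr continuous_on_legendre_P')

lemma set_borel_measurable_pos:
  fixes f :: "real \<Rightarrow> complex"
  assumes "continuous_on {0<..} f" "A \<subseteq> {0<..}" "A \<in> sets borel"
  shows "set_borel_measurable lborel A f"
  using assms unfolding set_borel_measurable_def
  by (auto intro!: borel_measurable_continuous_on_indicator continuous_on_subset[OF assms(1)])

lemma norm_set_lebesgue_integral_le:
  fixes f :: "real \<Rightarrow> complex" and g :: "real \<Rightarrow> real"
  assumes g: "set_integrable lborel A g" and f: "set_borel_measurable lborel A f" and A: "A \<in> sets borel"
    and le: "\<And>x. x \<in> A \<Longrightarrow> norm (f x) \<le> g x"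
  shows "set_integrable lborel A f" "norm (LBINT x:A. f x) \<le> (LBINT x:A. g x)"
proof -
  show i: "set_integrable lborel A f"
    by (rule set_integrable_bound[OF g f]) (auto intro!: AE_I2 intro: order_trans[OF le abs_ge_self])
  show "norm (LBINT x:A. f x) \<le> (LBINT x:A. g x)"
    unfolding set_lebesgue_integral_def
    by (rule Bochner_Integration.integral_norm_bound_integral)
       (use i g le in \<open>auto simp: set_integrable_def indicator_def\<close>)
qed

text \<open>The constant K does not depend on s. Hence the integrals tend to 0 along s - 2 k, which
  normalises the solution of the recurrence.\<close>

lemma legendre_kernel_at_infinity:
  assumes "\<tau> > max (Re \<nu>) (-1 - Re \<nu>)"
  obtains K where "K > 0"
    "\<And>s. Re s < 1 - \<tau> \<Longrightarrow> set_integrable lborel {1<..} (legendre_kernel \<nu> s)"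
    "\<And>s. Re s < 1 - \<tau> \<Longrightarrow> norm (LBINT z:{1<..}. legendre_kernel \<nu> s z) \<le> K / (1 - \<tau> - Re s)"
proof -
  obtain K where K': "K > 0" "\<And>y. y \<ge> 1 \<Longrightarrow> norm (legendre_P \<nu> y) \<le> K * y powr \<tau>"
    "\<And>y. y \<ge> 1 \<Longrightarrow> norm (legendre_P' \<nu> y) \<le> K * y powr (\<tau> - 1)"
    using legendre_growth_powr[OF assms] by blast
  note K = K'(1,3)
  have "set_integrable lborel {1<..} (legendre_kernel \<nu> s) \<and>
     norm (LBINT z:{1<..}. legendre_kernel \<nu> s z) \<le> K / (1 - \<tau> - Re s)" if s: "Re s < 1 - \<tau>" for s
  proof -
    define a where "a = Re s - 1 + (\<tau> - 1)"
    have a: "a < -1" using s by (simp add: a_def)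
    have 1: "set_integrable lborel {1<..} (\<lambda>z. K * z powr a)"
      using powr_integral_at_infinity(1)[OF a] by simp
    have 2: "norm (legendre_kernel \<nu> s z) \<le> K * z powr a" if "z \<in> {1<..}" for z
    proof -
      have "norm (legendre_kernel \<nu> s z) = z powr (Re s - 1) * norm (legendre_P' \<nu> z)"
        using that by (simp add: legendre_kernel_def norm_mult norm_powr_real_powr)
      also have "\<dots> \<le> z powr (Re s - 1) * (K * z powr (\<tau> - 1))"
        using that by (intro mult_left_mono K) auto
      also have "\<dots> = K * z powr a" by (simp only: a_def powr_add mult_ac)
      finally show ?thesis .
    qed
    have M: "set_borel_measurable lborel {1<..} (legendre_kernel \<nu> s)"
      by (rule set_borel_measurable_pos[OF continuous_on_legendre_kernel]) auto
    note N = norm_set_lebesgue_integral_le[OF 1 M _ 2]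
    have "(LBINT z:{1<..}. K * z powr a) = K / (1 - \<tau> - Re s)"
    proof -
      have "- 1 / (a + 1) = 1 / (- (a + 1))" by (metis minus_divide_left minus_divide_right)
      also have "- (a + 1) = 1 - \<tau> - Re s" by (simp add: a_def)
      finally show ?thesis using powr_integral_at_infinity(2)[OF a] by simp
    qed
    with N show ?thesis by simp
  qed
  thus ?thesis using K(1) by (intro that[of K]) auto
qed

text \<open>Boundedness of the derivative near 0 leaves only the integral of z^(Re s - 1). Again K
  is independent of s, so the integrals tend to 0 along s + 2 k.\<close>

lemma legendre_kernel_at_zero:
  obtains K where "K > 0"
    "\<And>s. Re s > 0 \<Longrightarrow> set_integrable lborel {0<..<1} (legendre_kernel \<nu> s)"
    "\<And>s. Re s > 0 \<Longrightarrow> norm (LBINT z:{0<..<1}. legendre_kernel \<nu> s z) \<le> K / Re s"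
proof -
  obtain K where K': "K > 0" "\<And>y. y \<in> {0<..1} \<Longrightarrow> norm (legendre_P \<nu> y) \<le> K"
    "\<And>y. y \<in> {0<..1} \<Longrightarrow> norm (legendre_P' \<nu> y) \<le> K"
    using legendre_bounded_near_0[of \<nu>] by blast
  note K = K'(1,3)
  have "set_integrable lborel {0<..<1} (legendre_kernel \<nu> s) \<and>
     norm (LBINT z:{0<..<1}. legendre_kernel \<nu> s z) \<le> K / Re s" if s: "Re s > 0" for s
  proof -
    define a where "a = Re s - 1"
    have a: "a > -1" using s by (simp add: a_def)
    have 1: "set_integrable lborel {0<..<1} (\<lambda>z. K * z powr a)"
      using powr_integral_at_zero(1)[OF a] by simp
    have 2: "norm (legendre_kernel \<nu> s z) \<le> K * z powr a" if "z \<in> {0<..<1}" for z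
    proof -
      have "norm (legendre_kernel \<nu> s z) = z powr (Re s - 1) * norm (legendre_P' \<nu> z)"
        using that by (simp add: legendre_kernel_def norm_mult norm_powr_real_powr)
      also have "\<dots> \<le> z powr (Re s - 1) * K"
        using that by (intro mult_left_mono K) auto
      also have "\<dots> = K * z powr a" by (simp only: a_def mult_ac)
      finally show ?thesis .
    qed
    have M: "set_borel_measurable lborel {0<..<1} (legendre_kernel \<nu> s)"
      by (rule set_borel_measurable_pos[OF continuous_on_legendre_kernel]) auto
    note N = norm_set_lebesgue_integral_le[OF 1 M _ 2]
    have "(LBINT z:{0<..<1}. K * z powr a) = K / Re s"
      using powr_integral_at_zero(2)[OF a] by (simp add: a_def)
    with N show ?thesis by simp
  qed
  thus ?thesis using K(1) by (intro that[of K]) auto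
qed

lemma set_integrable_legendre_kernel_infinity:
  assumes s: "Re s < 1 - max (Re \<nu>) (-1 - Re \<nu>)"
  shows "set_integrable lborel {1<..} (legendre_kernel \<nu> s)"
proof -
  have "max (Re \<nu>) (-1 - Re \<nu>) < 1 - Re s" using s by linarith
  from dense[OF this] obtain \<tau> where \<tau>: "max (Re \<nu>) (-1 - Re \<nu>) < \<tau>" "\<tau> < 1 - Re s" by blast
  have "Re s < 1 - \<tau>" using \<tau>(2) by linarith
  thus ?thesis by (rule_tac legendre_kernel_at_infinity[OF \<tau>(1)]) blast
qed

lemma set_integrable_legendre_kernel_zero:
  assumes "Re s > 0" shows "set_integrable lborel {0<..<1} (legendre_kernel \<nu> s)"
  by (rule legendre_kernel_at_zero[of \<nu>]) (use assms in blast)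

text \<open>
  Legendre's equation makes the derivative of this function a combination of the kernels at \<open>s - 2\<close>
  and \<open>s\<close>; integrating it gives the recurrences.
\<close>
definition legendre_primitive :: "complex \<Rightarrow> complex \<Rightarrow> real \<Rightarrow> complex" where
  "legendre_primitive \<nu> s z = (s - 1) * (of_real z powr (s - 2) * ((1 - of_real z ^ 2) * legendre_P' \<nu> z))
     + \<nu> * (\<nu> + 1) * (of_real z powr (s - 1) * legendre_P \<nu> z)"

text \<open>The second summand of the primitive is chosen to cancel the terms with
  \<open>legendre_P\<close>. The remaining coefficient factors as (s - 1) (s - 2) - \<nu> (\<nu> +
  1) = (s - 2 - \<nu>) (s - 1 + \<nu>).\<close>

lemma legendre_primitive_deriv:
  assumes "z > 0"
  shows "(legendre_primitive \<nu> s has_vector_derivative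
     ((s - 1) * (s - 2) * legendre_kernel \<nu> (s - 2) z - (s - 2 - \<nu>) * (s - 1 + \<nu>) * legendre_kernel \<nu> s z)) (at z)"
proof -
  define Y where "Y = complex_of_real z"
  define X where "X = Y powr (s - 3)"
  have Y: "Y \<noteq> 0" using assms by (simp add: Y_def)
  have X: "Y powr (s - 2) = Y * X" "Y powr (s - 1) = Y\<^sup>2 * X"
  proof -
    have "Y powr (s - 2) = Y powr (1 + (s - 3))" by simp
    also have "\<dots> = Y * X" using Y by (subst powr_add) (simp add: X_def)
    finally show 1: "Y powr (s - 2) = Y * X" .
    have "Y powr (s - 1) = Y powr (1 + (s - 2))" by simp
    also have "\<dots> = Y * (Y * X)" using Y 1 by (subst powr_add) simp
    finally show "Y powr (s - 1) = Y\<^sup>2 * X" by (simp add: power2_eq_square)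
  qed
  have D: "(legendre_primitive \<nu> s has_vector_derivative
     (s - 1) * (of_real z powr (s - 2) * (- (\<nu> * (\<nu> + 1)) * legendre_P \<nu> z) + (s - 2) * of_real z powr (s - 2 - 1) * ((1 - of_real z ^ 2) * legendre_P' \<nu> z))
      + \<nu> * (\<nu> + 1) * (of_real z powr (s - 1) * legendre_P' \<nu> z + (s - 1) * of_real z powr (s - 1 - 1) * legendre_P \<nu> z)) (at z)"
    unfolding legendre_primitive_def
    by (intro has_vector_derivative_add has_vector_derivative_mult_right has_vector_derivative_mult
        has_vector_derivative_of_real_powr legendre_ode has_vector_derivative_legendre_P assms)
  have "s - 2 - 1 = s - 3" "s - 1 - 1 = s - 2" by simp_all
  thus ?thesis
    by (intro has_vector_derivative_eq_rhs[OF D])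
       (simp add: legendre_kernel_def X flip: X_def Y_def, simp add: algebra_simps power2_eq_square)
qed

lemma legendre_primitive_one: "legendre_primitive \<nu> s 1 = \<nu> * (\<nu> + 1)"
  by (simp add: legendre_primitive_def)

lemma legendre_primitive_continuous: "z > 0 \<Longrightarrow> isCont (legendre_primitive \<nu> s) z"
  using legendre_primitive_deriv by (rule has_vector_derivative_continuous)

text \<open>Only the endpoint 1 contributes: there 1 - z^2 vanishes and the primitive equals \<nu>
  (\<nu> + 1), while at infinity it is O(z^(\<tau> + Re s - 1)) with a negative exponent.\<close>

lemma legendre_kernel_recurrence_infinity:
  assumes s: "Re s < 1 - max (Re \<nu>) (-1 - Re \<nu>)"
  shows "(s - 1) * (s - 2) * (LBINT z:{1<..}. legendre_kernel \<nu> (s - 2) z)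
     - (s - 2 - \<nu>) * (s - 1 + \<nu>) * (LBINT z:{1<..}. legendre_kernel \<nu> s z) = - (\<nu> * (\<nu> + 1))"
proof -
  obtain \<tau> where \<tau>: "\<tau> > max (Re \<nu>) (-1 - Re \<nu>)" "Re s < 1 - \<tau>"
  proof -
    have "max (Re \<nu>) (-1 - Re \<nu>) < 1 - Re s" using s by linarith
    from dense[OF this] obtain \<tau> where "max (Re \<nu>) (-1 - Re \<nu>) < \<tau>" "\<tau> < 1 - Re s" by blast
    thus ?thesis by (intro that[of \<tau>]) auto
  qed
  obtain K where K: "K > 0" "\<And>y. y \<ge> 1 \<Longrightarrow> norm (legendre_P \<nu> y) \<le> K * y powr \<tau>"
    "\<And>y. y \<ge> 1 \<Longrightarrow> norm (legendre_P' \<nu> y) \<le> K * y powr (\<tau> - 1)"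
    using legendre_growth_powr[OF \<tau>(1)] by blast
  have int: "set_integrable lborel {1<..} (legendre_kernel \<nu> s)"
    "set_integrable lborel {1<..} (legendre_kernel \<nu> (s - 2))"
    using s by (auto intro!: set_integrable_legendre_kernel_infinity)
  define f where "f = (\<lambda>z. (s - 1) * (s - 2) * legendre_kernel \<nu> (s - 2) z - (s - 2 - \<nu>) * (s - 1 + \<nu>) * legendre_kernel \<nu> s z)"
  have ei: "einterval 1 \<infinity> = {1::real<..}" by (auto simp: einterval_def)
  have fint: "set_integrable lborel {1<..} f"
    unfolding f_def by (intro set_integral_diff set_integrable_mult_right int)
  have cont: "isCont f z" if "z > 0" for z
  proof -
    have "continuous_on {0<..} f"
      unfolding f_def by (intro continuous_intros continuous_on_legendre_kernel)
    thus ?thesis using that by (simp add: continuous_on_eq_continuous_at)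
  qed
  have lim: "(legendre_primitive \<nu> s \<longlongrightarrow> 0) at_top"
  proof (rule Lim_null_comparison)
    define C where "C = norm (s - 1) * K + norm (\<nu> * (\<nu> + 1)) * K"
    show "\<forall>\<^sub>F z in at_top. norm (legendre_primitive \<nu> s z) \<le> C * z powr (\<tau> + Re s - 1)"
      using eventually_ge_at_top[of 1]
    proof eventually_elim
      case (elim z)
      have n: "norm (1 - complex_of_real z ^ 2) \<le> z powr 2"
      proof -
        have "norm (1 - complex_of_real z ^ 2) = \<bar>1 - z\<^sup>2\<bar>" by (metis norm_of_real of_real_1 of_real_diff of_real_power)
        also have "\<dots> \<le> z\<^sup>2" using one_le_power[OF elim, of 2] by linarith
        finally show ?thesis using elim by (simp add: powr_numeral)
      qed
      have "norm (legendre_primitive \<nu> s z) \<le>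
          norm (s - 1) * (z powr (Re s - 2) * (norm (1 - complex_of_real z ^ 2) * norm (legendre_P' \<nu> z))) +
          norm (\<nu> * (\<nu> + 1)) * (z powr (Re s - 1) * norm (legendre_P \<nu> z))"
        unfolding legendre_primitive_def using elim
        by (intro order_trans[OF norm_triangle_ineq]) (simp add: norm_mult norm_powr_real_powr)
      also have "\<dots> \<le> norm (s - 1) * (z powr (Re s - 2) * (z powr 2 * (K * z powr (\<tau> - 1)))) +
          norm (\<nu> * (\<nu> + 1)) * (z powr (Re s - 1) * (K * z powr \<tau>))"
        by (intro add_mono mult_left_mono mult_mono n K elim) auto
      also have "z powr (Re s - 2) * (z powr 2 * (K * z powr (\<tau> - 1))) = K * z powr ((Re s - 2) + (2 + (\<tau> - 1)))"
        by (simp only: powr_add mult_ac)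
      also have "z powr (Re s - 1) * (K * z powr \<tau>) = K * z powr (Re s - 1 + \<tau>)"
        by (simp only: powr_add mult_ac)
      also have "norm (s - 1) * (K * z powr ((Re s - 2) + (2 + (\<tau> - 1)))) + norm (\<nu> * (\<nu> + 1)) * (K * z powr (Re s - 1 + \<tau>))
         = C * z powr (\<tau> + Re s - 1)"
        by (simp add: C_def algebra_simps)
      finally show ?case .
    qed
    have "((\<lambda>z. z powr (\<tau> + Re s - 1)) \<longlongrightarrow> 0) at_top"
      using \<tau> by (intro tendsto_neg_powr filterlim_ident) auto
    from tendsto_mult_right_zero[OF this] show "((\<lambda>z. C * z powr (\<tau> + Re s - 1)) \<longlongrightarrow> 0) at_top" .
  qed
  have "(LBINT z=1..\<infinity>. f z) = 0 - \<nu> * (\<nu> + 1)"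
  proof (rule interval_integral_FTC_integrable[where F = "legendre_primitive \<nu> s"])
    show "((legendre_primitive \<nu> s \<circ> real_of_ereal) \<longlongrightarrow> \<nu> * (\<nu> + 1)) (at_right 1)"
    proof -
      have "(legendre_primitive \<nu> s \<longlongrightarrow> legendre_primitive \<nu> s 1) (at_right 1)"
        using legendre_primitive_continuous[of 1 \<nu> s] unfolding isCont_def
        by (auto intro: tendsto_mono[OF at_le])
      thus ?thesis by (simp add: ereal_tendsto_simps1 one_ereal_def legendre_primitive_one)
    qed
    show "((legendre_primitive \<nu> s \<circ> real_of_ereal) \<longlongrightarrow> 0) (at_left \<infinity>)"
      using lim by (simp add: ereal_tendsto_simps1)
  qed (use fint cont legendre_primitive_deriv in \<open>auto simp: ei f_def\<close>)
  hence "(LBINT z:{1<..}. f z) = - (\<nu> * (\<nu> + 1))"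
    by (simp add: interval_lebesgue_integral_def ei)
  moreover have "(LBINT z:{1<..}. f z) = (s - 1) * (s - 2) * (LBINT z:{1<..}. legendre_kernel \<nu> (s - 2) z)
     - (s - 2 - \<nu>) * (s - 1 + \<nu>) * (LBINT z:{1<..}. legendre_kernel \<nu> s z)"
    unfolding f_def using int by (subst set_integral_diff(2)) (auto intro: set_integrable_mult_right)
  ultimately show ?thesis by simp
qed

lemma legendre_kernel_recurrence_zero:
  assumes s: "Re s > 0"
  shows "(s + 1) * s * (LBINT z:{0<..<1}. legendre_kernel \<nu> s z)
     - (s - \<nu>) * (s + 1 + \<nu>) * (LBINT z:{0<..<1}. legendre_kernel \<nu> (s + 2) z) = \<nu> * (\<nu> + 1)"
proof -
  \<comment> \<open>The primitive is taken at s + 2: the two kernels then have parameters s and s +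
    2, both with positive real part, and the primitive vanishes at 0 because Re t > 2.\<close>
  define t where "t = s + 2"
  have t: "Re t > 2" using s by (simp add: t_def)
  obtain K where K: "K > 0" "\<And>y. y \<in> {0<..1} \<Longrightarrow> norm (legendre_P \<nu> y) \<le> K"
    "\<And>y. y \<in> {0<..1} \<Longrightarrow> norm (legendre_P' \<nu> y) \<le> K"
    using legendre_bounded_near_0[of \<nu>] by blast
  have int: "set_integrable lborel {0<..<1} (legendre_kernel \<nu> t)"
    "set_integrable lborel {0<..<1} (legendre_kernel \<nu> (t - 2))"
    using t by (auto intro!: set_integrable_legendre_kernel_zero)
  define f where "f = (\<lambda>z. (t - 1) * (t - 2) * legendre_kernel \<nu> (t - 2) z - (t - 2 - \<nu>) * (t - 1 + \<nu>) * legendre_kernel \<nu> t z)"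
  have ei: "einterval 0 1 = {0::real<..<1}" by (auto simp: einterval_def)
  have fint: "set_integrable lborel {0<..<1} f"
    unfolding f_def by (intro set_integral_diff set_integrable_mult_right int)
  have cont: "isCont f z" if "z > 0" for z
  proof -
    have "continuous_on {0<..} f"
      unfolding f_def by (intro continuous_intros continuous_on_legendre_kernel)
    thus ?thesis using that by (simp add: continuous_on_eq_continuous_at)
  qed
  have lim: "(legendre_primitive \<nu> t \<longlongrightarrow> 0) (at_right 0)"
  proof (rule Lim_null_comparison)
    define C where "C = norm (t - 1) * K + norm (\<nu> * (\<nu> + 1)) * K"
    show "\<forall>\<^sub>F z in at_right 0. norm (legendre_primitive \<nu> t z) \<le> C * z powr (Re t - 2)"
      unfolding eventually_at_right_field
    proof (intro exI[of _ 1] conjI allI impI)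
      fix z :: real assume z: "0 < z" "z < 1"
      have n: "norm (1 - complex_of_real z ^ 2) \<le> 1"
      proof -
        have "norm (1 - complex_of_real z ^ 2) = \<bar>1 - z\<^sup>2\<bar>" by (metis norm_of_real of_real_1 of_real_diff of_real_power)
        also have "\<dots> \<le> 1" using z power_le_one[of z 2] by (simp add: abs_if)
        finally show ?thesis .
      qed
      have "norm (legendre_primitive \<nu> t z) \<le>
          norm (t - 1) * (z powr (Re t - 2) * (norm (1 - complex_of_real z ^ 2) * norm (legendre_P' \<nu> z))) +
          norm (\<nu> * (\<nu> + 1)) * (z powr (Re t - 1) * norm (legendre_P \<nu> z))"
        unfolding legendre_primitive_def using z
        by (intro order_trans[OF norm_triangle_ineq]) (simp add: norm_mult norm_powr_real_powr)
      also have "\<dots> \<le> norm (t - 1) * (z powr (Re t - 2) * (1 * K)) +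
          norm (\<nu> * (\<nu> + 1)) * (z powr (Re t - 2) * K)"
        using z by (intro add_mono mult_left_mono mult_mono n K powr_mono') auto
      also have "\<dots> = C * z powr (Re t - 2)"
        by (simp add: C_def algebra_simps)
      finally show "norm (legendre_primitive \<nu> t z) \<le> C * z powr (Re t - 2)" .
    qed simp
    have "((\<lambda>z. z powr (Re t - 2)) \<longlongrightarrow> 0 powr (Re t - 2)) (at_right 0)"
      using t by (intro tendsto_powr' tendsto_const tendsto_ident_at) (auto intro: eventually_mono[OF eventually_at_right_less])
    hence "((\<lambda>z. z powr (Re t - 2)) \<longlongrightarrow> 0) (at_right 0)" by simp
    from tendsto_mult_right_zero[OF this] show "((\<lambda>z. C * z powr (Re t - 2)) \<longlongrightarrow> 0) (at_right 0)" .
  qed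
  have "(LBINT z=0..1. f z) = \<nu> * (\<nu> + 1) - 0"
  proof (rule interval_integral_FTC_integrable[where F = "legendre_primitive \<nu> t"])
    show "((legendre_primitive \<nu> t \<circ> real_of_ereal) \<longlongrightarrow> \<nu> * (\<nu> + 1)) (at_left 1)"
    proof -
      have "(legendre_primitive \<nu> t \<longlongrightarrow> legendre_primitive \<nu> t 1) (at_left 1)"
        using legendre_primitive_continuous[of 1 \<nu> t] unfolding isCont_def
        by (auto intro: tendsto_mono[OF at_le])
      thus ?thesis by (simp add: ereal_tendsto_simps1 one_ereal_def legendre_primitive_one)
    qed
    show "((legendre_primitive \<nu> t \<circ> real_of_ereal) \<longlongrightarrow> 0) (at_right 0)"
      using lim by (simp add: ereal_tendsto_simps1 zero_ereal_def)
  qed (use fint cont legendre_primitive_deriv in \<open>auto simp: ei f_def\<close>)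
  hence "(LBINT z:{0<..<1}. f z) = \<nu> * (\<nu> + 1)"
    by (simp add: interval_lebesgue_integral_def ei)
  moreover have "(LBINT z:{0<..<1}. f z) = (t - 1) * (t - 2) * (LBINT z:{0<..<1}. legendre_kernel \<nu> (t - 2) z)
     - (t - 2 - \<nu>) * (t - 1 + \<nu>) * (LBINT z:{0<..<1}. legendre_kernel \<nu> t z)"
    unfolding f_def using int by (subst set_integral_diff(2)) (auto intro: set_integrable_mult_right)
  ultimately show ?thesis by (simp add: t_def add.commute)
qed

text \<open>Iteration expresses \<open>h n\<close> by a quotient of Pochhammer products. Divided by
  (n!)^2 n^(a + b), these become Euler approximations; a + b = c + d makes the power of n the same
  on both sides. The form with the entire function \<open>rGamma\<close> also covers the poles of
  Gamma.\<close>

lemma rGamma_quotient_limit: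
  fixes h :: "nat \<Rightarrow> complex"
  assumes rec: "\<And>k. (c + of_nat k) * (d + of_nat k) * h (Suc k) = (a + of_nat k) * (b + of_nat k) * h k"
    and lim: "h \<longlonglongrightarrow> 1" and sum: "a + b = c + d"
  shows "rGamma c * rGamma d = h 0 * (rGamma a * rGamma b)"
proof -
  have poch: "pochhammer c n * pochhammer d n * h n = pochhammer a n * pochhammer b n * h 0" for n
  proof (induction n)
    case (Suc n)
    have "pochhammer c (Suc n) * pochhammer d (Suc n) * h (Suc n) =
       (pochhammer c n * pochhammer d n) * ((c + of_nat n) * (d + of_nat n) * h (Suc n))"
      by (simp only: pochhammer_Suc mult_ac)
    also have "\<dots> = (pochhammer c n * pochhammer d n) * ((a + of_nat n) * (b + of_nat n) * h n)"
      by (simp only: rec)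
    also have "\<dots> = (pochhammer c n * pochhammer d n * h n) * ((a + of_nat n) * (b + of_nat n))"
      by (simp only: mult_ac)
    also have "\<dots> = (pochhammer a n * pochhammer b n * h 0) * ((a + of_nat n) * (b + of_nat n))"
      by (simp only: Suc)
    also have "\<dots> = pochhammer a (Suc n) * pochhammer b (Suc n) * h 0"
      by (simp only: pochhammer_Suc mult_ac)
    finally show ?case .
  qed simp
  have series: "rGamma_series c n * rGamma_series d n * h (Suc n) = rGamma_series a n * rGamma_series b n * h 0" for n
  proof -
    define L where "L = complex_of_real (ln (of_nat n))"
    have e: "exp (c * L) * exp (d * L) = exp (a * L) * exp (b * L)"
      by (simp add: sum flip: exp_add distrib_right)
    have "rGamma_series c n * rGamma_series d n * h (Suc n) =
        (pochhammer c (Suc n) * pochhammer d (Suc n) * h (Suc n)) / ((fact n)\<^sup>2 * (exp (c * L) * exp (d * L)))"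
      by (simp add: rGamma_series_def L_def power2_eq_square mult_ac del: pochhammer_Suc)
    also have "\<dots> = rGamma_series a n * rGamma_series b n * h 0"
      unfolding poch e by (simp add: rGamma_series_def L_def power2_eq_square mult_ac del: pochhammer_Suc)
    finally show ?thesis .
  qed
  have "(\<lambda>n. rGamma_series c n * rGamma_series d n * h (Suc n)) \<longlonglongrightarrow> rGamma c * rGamma d * 1"
    by (intro tendsto_mult rGamma_series_LIMSEQ LIMSEQ_Suc lim)
  moreover have "(\<lambda>n. rGamma_series c n * rGamma_series d n * h (Suc n)) \<longlonglongrightarrow> rGamma a * rGamma b * h 0"
    unfolding series by (intro tendsto_mult rGamma_series_LIMSEQ tendsto_const)
  ultimately have "rGamma c * rGamma d * 1 = rGamma a * rGamma b * h 0"
    by (rule LIMSEQ_unique)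
  thus ?thesis by (simp add: mult_ac)
qed

lemma rGamma_nonzero: "Re z > 0 \<Longrightarrow> rGamma z \<noteq> (0::complex)"
  by (auto simp: rGamma_eq_zero_iff elim!: nonpos_Ints_cases)

lemma const_over_shifted_nat_tendsto_0:
  fixes C r :: real assumes "r > 0"
  shows "(\<lambda>n. C / (r + 2 * real n)) \<longlonglongrightarrow> 0"
  by (intro tendsto_divide_0[OF tendsto_const] filterlim_at_top_imp_at_infinity
      filterlim_tendsto_add_at_top[OF tendsto_const] filterlim_tendsto_pos_mult_at_top[OF tendsto_const] filterlim_real_sequentially) auto

text \<open>Adding 1 makes the recurrence homogeneous, since (t - 1) (t - 2) - (t - 2 - \<nu>) (t -
  1 + \<nu>) = \<nu> (\<nu> + 1). Along t = s - 2 k the function tends to 1, so the Gamma quotient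
  is the only solution.\<close>

lemma legendre_kernel_mellin_infinity:
  assumes s: "Re s < 1 - max (Re \<nu>) (-1 - Re \<nu>)"
  shows "1 + (LBINT z:{1<..}. legendre_kernel \<nu> s z) = symbol_S0plus \<nu> s"
proof -
  obtain \<tau> where \<tau>: "\<tau> > max (Re \<nu>) (-1 - Re \<nu>)" "Re s < 1 - \<tau>"
  proof -
    have "max (Re \<nu>) (-1 - Re \<nu>) < 1 - Re s" using s by linarith
    from dense[OF this] obtain \<tau> where "max (Re \<nu>) (-1 - Re \<nu>) < \<tau>" "\<tau> < 1 - Re s" by blast
    thus ?thesis by (intro that[of \<tau>]) auto
  qed
  obtain K where K': "K > 0" "\<And>s. Re s < 1 - \<tau> \<Longrightarrow> set_integrable lborel {1<..} (legendre_kernel \<nu> s)"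
    "\<And>s. Re s < 1 - \<tau> \<Longrightarrow> norm (LBINT z:{1<..}. legendre_kernel \<nu> s z) \<le> K / (1 - \<tau> - Re s)"
    using legendre_kernel_at_infinity[OF \<tau>(1)] by blast
  note K = K'(1,3)
  define h where "h = (\<lambda>k::nat. 1 + (LBINT z:{1<..}. legendre_kernel \<nu> (s - 2 * of_nat k) z))"
  define a b c d where "a = - s / 2 + \<nu> / 2 + 1" and "b = - s / 2 - \<nu> / 2 + 1 / 2" and "c = 1 / 2 - s / 2" and "d = 1 - s / 2"
  have "rGamma c * rGamma d = h 0 * (rGamma a * rGamma b)"
  proof (rule rGamma_quotient_limit)
    fix k :: nat
    define t where "t = s - 2 * of_nat k"
    have t: "Re t < 1 - max (Re \<nu>) (-1 - Re \<nu>)" using s by (simp add: t_def)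
    define X Y where "X = (LBINT z:{1<..}. legendre_kernel \<nu> (t - 2) z)" and "Y = (LBINT z:{1<..}. legendre_kernel \<nu> t z)"
    have XY: "(t - 1) * (t - 2) * X - (t - 2 - \<nu>) * (t - 1 + \<nu>) * Y = - (\<nu> * (\<nu> + 1))"
      unfolding X_def Y_def by (rule legendre_kernel_recurrence_infinity[OF t])
    have h: "h k = 1 + Y" "h (Suc k) = 1 + X" by (simp_all add: h_def X_def Y_def t_def algebra_simps)
    have ab: "a + of_nat k = - (t - 2 - \<nu>) / 2" "b + of_nat k = - (t - 1 + \<nu>) / 2"
      "c + of_nat k = - (t - 1) / 2" "d + of_nat k = - (t - 2) / 2"
      by (simp_all add: a_def b_def c_def d_def t_def field_simps)
    have "(c + of_nat k) * (d + of_nat k) * h (Suc k) - (a + of_nat k) * (b + of_nat k) * h k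
       = ((t - 1) * (t - 2) * X - (t - 2 - \<nu>) * (t - 1 + \<nu>) * Y + \<nu> * (\<nu> + 1)) / 4"
      unfolding ab h by (simp add: field_simps)
    thus "(c + of_nat k) * (d + of_nat k) * h (Suc k) = (a + of_nat k) * (b + of_nat k) * h k"
      unfolding XY by simp
  next
    have "(\<lambda>k. LBINT z:{1<..}. legendre_kernel \<nu> (s - 2 * of_nat k) z) \<longlonglongrightarrow> 0"
    proof (rule Lim_null_comparison[OF always_eventually])
      show "\<forall>k. norm (LBINT z:{1<..}. legendre_kernel \<nu> (s - 2 * of_nat k) z) \<le> K / ((1 - \<tau> - Re s) + 2 * real k)"
      proof
        fix k
        have "norm (LBINT z:{1<..}. legendre_kernel \<nu> (s - 2 * of_nat k) z) \<le> K / (1 - \<tau> - Re (s - 2 * of_nat k))"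
          using \<tau> by (intro K) auto
        thus "norm (LBINT z:{1<..}. legendre_kernel \<nu> (s - 2 * of_nat k) z) \<le> K / ((1 - \<tau> - Re s) + 2 * real k)"
          by (simp add: algebra_simps)
      qed
    qed (use \<tau> in \<open>auto intro!: const_over_shifted_nat_tendsto_0\<close>)
    from tendsto_add[OF tendsto_const[of 1] this] show "h \<longlonglongrightarrow> 1" by (simp add: h_def)
  qed (simp add: a_def b_def c_def d_def field_simps)
  \<comment> \<open>The half-plane for s is exactly the one on which a and b have positive real
    part.\<close>
  moreover have "rGamma a \<noteq> 0" "rGamma b \<noteq> 0"
    using s by (auto intro!: rGamma_nonzero simp: a_def b_def)
  ultimately have "h 0 = Gamma a * Gamma b / (Gamma c * Gamma d)"
    by (simp add: Gamma_def field_simps)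
  thus ?thesis by (simp add: h_def symbol_S0plus_def a_def b_def c_def d_def)
qed

text \<open>Here subtraction from 1 removes the inhomogeneity, by (t + 1) t - (t - \<nu>) (t + 1 +
  \<nu>) = \<nu> (\<nu> + 1), and the limit is taken along t = s + 2 k. The Gamma factors in the
  numerator have arguments s / 2 and s / 2 + 1 / 2, whence the half-plane Re s > 0 for every
  \<nu>.\<close>

lemma legendre_kernel_mellin_zero:
  assumes s: "Re s > 0"
  shows "1 - (LBINT z:{0<..<1}. legendre_kernel \<nu> s z) = symbol_Sminus \<nu> s"
proof -
  obtain K where K': "K > 0" "\<And>s. Re s > 0 \<Longrightarrow> set_integrable lborel {0<..<1} (legendre_kernel \<nu> s)"
    "\<And>s. Re s > 0 \<Longrightarrow> norm (LBINT z:{0<..<1}. legendre_kernel \<nu> s z) \<le> K / Re s"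
    using legendre_kernel_at_zero[of \<nu>] by blast
  note K = K'(1,3)
  define h where "h = (\<lambda>k::nat. 1 - (LBINT z:{0<..<1}. legendre_kernel \<nu> (s + 2 * of_nat k) z))"
  define a b c d where "a = s / 2" and "b = s / 2 + 1 / 2" and "c = s / 2 + \<nu> / 2 + 1 / 2" and "d = s / 2 - \<nu> / 2"
  have "rGamma c * rGamma d = h 0 * (rGamma a * rGamma b)"
  proof (rule rGamma_quotient_limit)
    fix k :: nat
    define t where "t = s + 2 * of_nat k"
    have t: "Re t > 0" using s by (simp add: t_def)
    define X Y where "X = (LBINT z:{0<..<1}. legendre_kernel \<nu> (t + 2) z)" and "Y = (LBINT z:{0<..<1}. legendre_kernel \<nu> t z)"
    have XY: "(t + 1) * t * Y - (t - \<nu>) * (t + 1 + \<nu>) * X = \<nu> * (\<nu> + 1)"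
      unfolding X_def Y_def by (rule legendre_kernel_recurrence_zero[OF t])
    have h: "h k = 1 - Y" "h (Suc k) = 1 - X" by (simp_all add: h_def X_def Y_def t_def algebra_simps)
    have ab: "a + of_nat k = t / 2" "b + of_nat k = (t + 1) / 2"
      "c + of_nat k = (t + 1 + \<nu>) / 2" "d + of_nat k = (t - \<nu>) / 2"
      by (simp_all add: a_def b_def c_def d_def t_def field_simps)
    have "(c + of_nat k) * (d + of_nat k) * h (Suc k) - (a + of_nat k) * (b + of_nat k) * h k
       = ((t + 1) * t * Y - (t - \<nu>) * (t + 1 + \<nu>) * X - \<nu> * (\<nu> + 1)) / 4"
      unfolding ab h by (simp add: field_simps)
    thus "(c + of_nat k) * (d + of_nat k) * h (Suc k) = (a + of_nat k) * (b + of_nat k) * h k"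
      unfolding XY by simp
  next
    have "(\<lambda>k. LBINT z:{0<..<1}. legendre_kernel \<nu> (s + 2 * of_nat k) z) \<longlonglongrightarrow> 0"
    proof (rule Lim_null_comparison[OF always_eventually])
      show "\<forall>k. norm (LBINT z:{0<..<1}. legendre_kernel \<nu> (s + 2 * of_nat k) z) \<le> K / (Re s + 2 * real k)"
      proof
        fix k
        have "norm (LBINT z:{0<..<1}. legendre_kernel \<nu> (s + 2 * of_nat k) z) \<le> K / Re (s + 2 * of_nat k)"
          using s by (intro K) auto
        thus "norm (LBINT z:{0<..<1}. legendre_kernel \<nu> (s + 2 * of_nat k) z) \<le> K / (Re s + 2 * real k)"
          by simp
      qed
    qed (use s in \<open>auto intro!: const_over_shifted_nat_tendsto_0\<close>)
    from tendsto_diff[OF tendsto_const[of 1] this] show "h \<longlonglongrightarrow> 1" by (simp add: h_def)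
  qed (simp add: a_def b_def c_def d_def field_simps)
  moreover have "rGamma a \<noteq> 0" "rGamma b \<noteq> 0"
    using s by (auto intro!: rGamma_nonzero simp: a_def b_def)
  ultimately have "h 0 = Gamma a * Gamma b / (Gamma c * Gamma d)"
    by (simp add: Gamma_def field_simps)
  thus ?thesis by (simp add: h_def symbol_Sminus_def a_def b_def c_def d_def)
qed

section \<open>Test functions and multiplicative convolutions\<close>

lemma set_borel_measurable_continuous:
  fixes f :: "real \<Rightarrow> 'a :: real_normed_vector"
  assumes "continuous_on A f" "A \<in> sets borel"
  shows "set_borel_measurable lborel A f"
  using assms unfolding set_borel_measurable_def
  by (auto intro!: borel_measurable_continuous_on_indicator)

text \<open>Absolute integrability refers to the completed measure, which makes no difference for
  Borel functions. This transfers the change of variables theorem to \<open>lborel\<close>.\<close>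

lemma set_integrable_lebesgue_iff:
  fixes f :: "real \<Rightarrow> 'a :: euclidean_space"
  assumes "set_borel_measurable lborel A f"
  shows "f absolutely_integrable_on A \<longleftrightarrow> set_integrable lborel A f"
  using assms unfolding set_integrable_def set_borel_measurable_def
  by (intro integrable_completion)

lemma set_integral_substitution_real:
  fixes f g g' :: "real \<Rightarrow> real"
  assumes S: "S \<in> sets borel" "g ` S \<in> sets borel"
    and der: "\<And>x. x \<in> S \<Longrightarrow> (g has_field_derivative g' x) (at x within S)" and inj: "inj_on g S"
    and cont: "continuous_on S g'" "continuous_on (g ` S) f"
    and int: "set_integrable lborel (g ` S) f"
  shows "set_integrable lborel S (\<lambda>x. \<bar>g' x\<bar> * f (g x))"
    "(LBINT x:S. \<bar>g' x\<bar> * f (g x)) = (LBINT y:g ` S. f y)"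
proof -
  have contg: "continuous_on S g"
    using der by (intro DERIV_continuous_on)
  have "continuous_on S (\<lambda>x. \<bar>g' x\<bar> * f (g x))"
    by (intro continuous_intros cont continuous_on_compose2[OF cont(2) contg]) auto
  hence m1: "set_borel_measurable lborel S (\<lambda>x. \<bar>g' x\<bar> * f (g x))"
    using S by (intro set_borel_measurable_continuous)
  have m2: "set_borel_measurable lborel (g ` S) f"
    using S cont by (intro set_borel_measurable_continuous)
  have S': "S \<in> sets lebesgue" using S by simp
  have "f absolutely_integrable_on g ` S \<and> integral (g ` S) f = integral (g ` S) f"
    using int set_integrable_lebesgue_iff[OF m2] by simp
  hence *: "(\<lambda>x. \<bar>g' x\<bar> * f (g x)) absolutely_integrable_on S \<and> integral S (\<lambda>x. \<bar>g' x\<bar> * f (g x)) = integral (g ` S) f"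
    using has_absolute_integral_change_of_variables_1'[OF S' der inj] by blast
  thus 1: "set_integrable lborel S (\<lambda>x. \<bar>g' x\<bar> * f (g x))"
    using set_integrable_lebesgue_iff[OF m1] by simp
  show "(LBINT x:S. \<bar>g' x\<bar> * f (g x)) = (LBINT y:g ` S. f y)"
    using * set_borel_integral_eq_integral(2)[OF 1] set_borel_integral_eq_integral(2)[OF int] by simp
qed

lemma set_integrable_Re_Im_iff:
  fixes f :: "real \<Rightarrow> complex"
  shows "set_integrable M A f \<longleftrightarrow> set_integrable M A (\<lambda>x. Re (f x)) \<and> set_integrable M A (\<lambda>x. Im (f x))"
proof
  assume "set_integrable M A f"
  thus "set_integrable M A (\<lambda>x. Re (f x)) \<and> set_integrable M A (\<lambda>x. Im (f x))"
    unfolding set_integrable_def using integrable_Re[of M "\<lambda>x. indicator A x *\<^sub>R f x"]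
      integrable_Im[of M "\<lambda>x. indicator A x *\<^sub>R f x"] by simp
next
  assume "set_integrable M A (\<lambda>x. Re (f x)) \<and> set_integrable M A (\<lambda>x. Im (f x))"
  hence "integrable M (\<lambda>x. complex_of_real (indicator A x *\<^sub>R Re (f x)) + \<i> * complex_of_real (indicator A x *\<^sub>R Im (f x)))"
    unfolding set_integrable_def by (intro Bochner_Integration.integrable_add integrable_mult_right integrable_of_real) auto
  also have "(\<lambda>x. complex_of_real (indicator A x *\<^sub>R Re (f x)) + \<i> * complex_of_real (indicator A x *\<^sub>R Im (f x))) =
    (\<lambda>x. indicator A x *\<^sub>R f x)"
    by (rule ext) (simp add: complex_eq_iff)
  finally show "set_integrable M A f" by (simp add: set_integrable_def)
qed

lemma set_integral_complex_eq:
  fixes f :: "real \<Rightarrow> complex"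
  assumes "set_integrable M A f"
  shows "(LINT x:A|M. f x) = Complex (LINT x:A|M. Re (f x)) (LINT x:A|M. Im (f x))"
proof -
  have i: "integrable M (\<lambda>x. indicat_real A x *\<^sub>R f x)" using assms by (simp add: set_integrable_def)
  show ?thesis
    unfolding set_lebesgue_integral_def complex_eq_iff
    using integral_Re[OF i] integral_Im[OF i] by simp
qed

lemma set_integral_substitution:
  fixes f :: "real \<Rightarrow> complex" and g g' :: "real \<Rightarrow> real"
  assumes S: "S \<in> sets borel" "g ` S \<in> sets borel"
    and der: "\<And>x. x \<in> S \<Longrightarrow> (g has_field_derivative g' x) (at x within S)" and inj: "inj_on g S"
    and cont: "continuous_on S g'" "continuous_on (g ` S) f"
    and int: "set_integrable lborel (g ` S) f"
  shows "set_integrable lborel S (\<lambda>x. of_real \<bar>g' x\<bar> * f (g x))"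
    "(LBINT x:S. of_real \<bar>g' x\<bar> * f (g x)) = (LBINT y:g ` S. f y)"
proof -
  note sub = set_integral_substitution_real[OF S der inj cont(1)]
  have c: "continuous_on (g ` S) (\<lambda>x. Re (f x))" "continuous_on (g ` S) (\<lambda>x. Im (f x))"
    using cont(2) by (auto intro: continuous_intros)
  have i: "set_integrable lborel (g ` S) (\<lambda>x. Re (f x))" "set_integrable lborel (g ` S) (\<lambda>x. Im (f x))"
    using int set_integrable_Re_Im_iff by blast+
  show 1: "set_integrable lborel S (\<lambda>x. of_real \<bar>g' x\<bar> * f (g x))"
    using sub(1)[OF _ c(1) i(1)] sub(1)[OF _ c(2) i(2)] by (subst set_integrable_Re_Im_iff) simp
  show "(LBINT x:S. of_real \<bar>g' x\<bar> * f (g x)) = (LBINT y:g ` S. f y)"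
    unfolding set_integral_complex_eq[OF 1] set_integral_complex_eq[OF int]
    using sub(2)[OF _ c(1) i(1)] sub(2)[OF _ c(2) i(2)] by simp
qed

text \<open>The part of the definition that integration by parts relies on: one continuous
  derivative, vanishing outside the same compact interval because the complement of that interval is
  open.\<close>

lemma test_fun_derivative:
  assumes "f \<in> test_funs"
  shows "\<exists>f' a b. 0 < a \<and> a < b \<and> (\<forall>x. (f has_vector_derivative f' x) (at x)) \<and>
    continuous_on UNIV f' \<and> (\<forall>x. x \<notin> {a..b} \<longrightarrow> f x = 0 \<and> f' x = 0)"
proof -
  from assms obtain D a b where D: "D 0 = f" "\<forall>n x. (D n has_vector_derivative D (Suc n) x) (at x)"
    and ab: "0 < a" "a < b" "\<forall>x. x \<notin> {a..b} \<longrightarrow> f x = 0"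
    unfolding test_funs_def by blast
  have d: "(f has_vector_derivative D 1 x) (at x)" for x using D by (metis One_nat_def)
  have c: "continuous_on UNIV (D 1)"
    by (rule continuous_on_vector_derivative[where f' = "D 2"])
      (use D(2) in \<open>auto intro: has_vector_derivative_at_within simp: numeral_2_eq_2\<close>)
  have "D 1 x = 0" if x: "x \<notin> {a..b}" for x
  proof -
    have "((\<lambda>_. 0) has_vector_derivative D 1 x) (at x)"
      by (rule has_vector_derivative_transform_within_open[OF d, of "- {a..b}"])
         (use x ab in \<open>auto simp: open_Compl\<close>)
    thus ?thesis using vector_derivative_unique_at[OF _ has_vector_derivative_const] by metis
  qed
  thus ?thesis using ab d c by blast
qed

lemma continuous_on_test_fun:
  assumes "f \<in> test_funs" shows "continuous_on UNIV f"
proof -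
  obtain f' where "\<forall>x. (f has_vector_derivative f' x) (at x)"
    using test_fun_derivative[OF assms] by blast
  thus ?thesis
    by (intro continuous_on_vector_derivative[where f' = f']) (auto intro: has_vector_derivative_at_within)
qed

text \<open>An integrand that vanishes near 0 has a proper integral over a compact interval, where
  the fundamental theorem and the Leibniz rule apply; the endpoint 1 is a null set.\<close>

lemma set_integral_cutoff_unit:
  fixes k :: "real \<Rightarrow> complex"
  assumes k: "continuous_on {0<..} k" and m: "0 < m" "m < 1" and 0: "\<And>v. 0 < v \<Longrightarrow> v < m \<Longrightarrow> k v = 0"
  shows "set_integrable lborel {0<..<1} k" "(LBINT v:{0<..<1}. k v) = integral {m..1} k"
proof -
  have c: "continuous_on {m..1} k" using m by (intro continuous_on_subset[OF k]) auto
  have i: "set_integrable lborel {m..1} k" using c by (rule borel_integrable_atLeastAtMost')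
  have ms: "set_borel_measurable lborel {0<..<1} k"
    by (intro set_borel_measurable_continuous continuous_on_subset[OF k]) auto
  have AE: "AE v in lborel. indicator {m..1} v *\<^sub>R k v = indicator {0<..<1} v *\<^sub>R k v"
    using AE_lborel_singleton[of 1]
  proof eventually_elim
    case (elim v)
    thus ?case by (cases "v < m") (use m 0 in \<open>auto simp: indicator_def\<close>)
  qed
  show "set_integrable lborel {0<..<1} k"
    using i ms AE unfolding set_integrable_def set_borel_measurable_def
    by (subst integrable_cong_AE[symmetric]) (auto dest: borel_measurable_integrable)
  have "(LBINT v:{m..1}. k v) = (LBINT v:{0<..<1}. k v)"
    using i ms AE unfolding set_integrable_def set_borel_measurable_def set_lebesgue_integral_def
    by (intro integral_cong_AE) (auto dest: borel_measurable_integrable)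
  thus "(LBINT v:{0<..<1}. k v) = integral {m..1} k"
    using set_borel_integral_eq_integral(2)[OF i] by simp
qed

lemma set_integral_cutoff_infinity:
  fixes k :: "real \<Rightarrow> complex"
  assumes k: "continuous_on {0<..} k" and m: "1 < R" and 0: "\<And>v. R < v \<Longrightarrow> k v = 0"
  shows "set_integrable lborel {1<..} k" "(LBINT v:{1<..}. k v) = integral {1..R} k"
proof -
  have c: "continuous_on {1..R} k" using m by (intro continuous_on_subset[OF k]) auto
  have i: "set_integrable lborel {1..R} k" using c by (rule borel_integrable_atLeastAtMost')
  have ms: "set_borel_measurable lborel {1<..} k"
    by (intro set_borel_measurable_continuous continuous_on_subset[OF k]) auto
  have AE: "AE v in lborel. indicator {1..R} v *\<^sub>R k v = indicator {1<..} v *\<^sub>R k v"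
    using AE_lborel_singleton[of 1]
  proof eventually_elim
    case (elim v)
    thus ?case by (cases "R < v") (use m 0 in \<open>auto simp: indicator_def\<close>)
  qed
  show "set_integrable lborel {1<..} k"
    using i ms AE unfolding set_integrable_def set_borel_measurable_def
    by (subst integrable_cong_AE[symmetric]) (auto dest: borel_measurable_integrable)
  have "(LBINT v:{1..R}. k v) = (LBINT v:{1<..}. k v)"
    using i ms AE unfolding set_integrable_def set_borel_measurable_def set_lebesgue_integral_def
    by (intro integral_cong_AE) (auto dest: borel_measurable_integrable)
  thus "(LBINT v:{1<..}. k v) = integral {1..R} k"
    using set_borel_integral_eq_integral(2)[OF i] by simp
qed

section \<open>Integration by parts against compactly supported functions\<close>

lemma has_vector_derivative_scaled:
  fixes f :: "real \<Rightarrow> complex"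
  assumes "\<And>x. (f has_vector_derivative f' x) (at x)"
  shows "((\<lambda>v. f (x * v)) has_vector_derivative of_real x * f' (x * v)) (at v)"
proof -
  have "((\<lambda>v. x * v) has_vector_derivative x) (at v)"
    by (auto intro!: derivative_eq_intros)
  from vector_diff_chain_at[OF this assms] show ?thesis by (simp add: o_def scaleR_conv_of_real)
qed

text \<open>The factor \<phi> vanishes below \<alpha>, so the boundary term at the lower limit
  disappears whatever the behaviour of Q at 0, and the one at 1 remains.\<close>

lemma integration_by_parts_unit:
  fixes Q Q' \<phi> \<phi>' :: "real \<Rightarrow> complex"
  assumes Q: "\<And>v. v > 0 \<Longrightarrow> (Q has_vector_derivative Q' v) (at v)" "continuous_on {0<..} Q'"
    and \<phi>: "\<And>v. (\<phi> has_vector_derivative \<phi>' v) (at v)" "continuous_on UNIV \<phi>'"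
    and \<alpha>: "\<alpha> > 0" "\<And>v. v < \<alpha> \<Longrightarrow> \<phi> v = 0" "\<And>v. v < \<alpha> \<Longrightarrow> \<phi>' v = 0"
  shows "(LBINT v:{0<..<1}. Q v * \<phi>' v) = Q 1 * \<phi> 1 - (LBINT v:{0<..<1}. Q' v * \<phi> v)"
proof -
  have cQ: "continuous_on {0<..} Q"
    by (rule continuous_on_vector_derivative) (auto intro: has_vector_derivative_at_within Q)
  have c\<phi>: "continuous_on UNIV \<phi>"
    by (rule continuous_on_vector_derivative) (auto intro: has_vector_derivative_at_within \<phi>)
  define m where "m = min (\<alpha> / 2) (1 / 2)"
  have m: "0 < m" "m < 1" "m < \<alpha>" using \<alpha> by (auto simp: m_def)
  have c1: "continuous_on {0<..} (\<lambda>v. Q v * \<phi>' v)" and c2: "continuous_on {0<..} (\<lambda>v. Q' v * \<phi> v)"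
    by (auto intro!: continuous_intros cQ Q continuous_on_subset[OF c\<phi>] continuous_on_subset[OF \<phi>(2)])
  have z: "Q v * \<phi>' v = 0" "Q' v * \<phi> v = 0" if "v < m" for v using that m \<alpha> by auto
  have "((\<lambda>v. Q v * \<phi>' v + Q' v * \<phi> v) has_integral (Q 1 * \<phi> 1 - Q m * \<phi> m)) {m..1}"
  proof (rule fundamental_theorem_of_calculus)
    fix v assume "v \<in> {m..1}"
    hence "v > 0" using m by auto
    thus "((\<lambda>v. Q v * \<phi> v) has_vector_derivative Q v * \<phi>' v + Q' v * \<phi> v) (at v within {m..1})"
      by (intro has_vector_derivative_at_within[OF has_vector_derivative_mult] Q \<phi>)
  qed (use m in auto)
  moreover have "\<phi> m = 0" using m \<alpha> by auto
  moreover have "integral {m..1} (\<lambda>v. Q v * \<phi>' v + Q' v * \<phi> v) = integral {m..1} (\<lambda>v. Q v * \<phi>' v) + integral {m..1} (\<lambda>v. Q' v * \<phi> v)"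
    using m by (intro integral_add integrable_continuous_interval continuous_on_subset[OF c1] continuous_on_subset[OF c2]) auto
  ultimately have "integral {m..1} (\<lambda>v. Q v * \<phi>' v) = Q 1 * \<phi> 1 - integral {m..1} (\<lambda>v. Q' v * \<phi> v)"
    by (simp add: has_integral_iff algebra_simps)
  thus ?thesis
    using set_integral_cutoff_unit(2)[OF c1 m(1,2)] set_integral_cutoff_unit(2)[OF c2 m(1,2)] z by simp
qed

lemma integration_by_parts_infinity:
  fixes Q Q' \<phi> \<phi>' :: "real \<Rightarrow> complex"
  assumes Q: "\<And>v. v > 0 \<Longrightarrow> (Q has_vector_derivative Q' v) (at v)" "continuous_on {0<..} Q'"
    and \<phi>: "\<And>v. (\<phi> has_vector_derivative \<phi>' v) (at v)" "continuous_on UNIV \<phi>'"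
    and \<beta>: "\<And>v. v > \<beta> \<Longrightarrow> \<phi> v = 0" "\<And>v. v > \<beta> \<Longrightarrow> \<phi>' v = 0"
  shows "(LBINT v:{1<..}. Q v * \<phi>' v) = - Q 1 * \<phi> 1 - (LBINT v:{1<..}. Q' v * \<phi> v)"
proof -
  have cQ: "continuous_on {0<..} Q"
    by (rule continuous_on_vector_derivative) (auto intro: has_vector_derivative_at_within Q)
  have c\<phi>: "continuous_on UNIV \<phi>"
    by (rule continuous_on_vector_derivative) (auto intro: has_vector_derivative_at_within \<phi>)
  define m where "m = max (\<beta> + 1) 2"
  have m: "1 < m" "m > \<beta>" by (auto simp: m_def)
  have c1: "continuous_on {0<..} (\<lambda>v. Q v * \<phi>' v)" and c2: "continuous_on {0<..} (\<lambda>v. Q' v * \<phi> v)"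
    by (auto intro!: continuous_intros cQ Q continuous_on_subset[OF c\<phi>] continuous_on_subset[OF \<phi>(2)])
  have z: "Q v * \<phi>' v = 0" "Q' v * \<phi> v = 0" if "v > m" for v using that m \<beta> by auto
  have "((\<lambda>v. Q v * \<phi>' v + Q' v * \<phi> v) has_integral (Q m * \<phi> m - Q 1 * \<phi> 1)) {1..m}"
  proof (rule fundamental_theorem_of_calculus)
    fix v assume "v \<in> {1..m}"
    hence "v > 0" using m by auto
    thus "((\<lambda>v. Q v * \<phi> v) has_vector_derivative Q v * \<phi>' v + Q' v * \<phi> v) (at v within {1..m})"
      by (intro has_vector_derivative_at_within[OF has_vector_derivative_mult] Q \<phi>)
  qed (use m in auto)
  moreover have "\<phi> m = 0" using m \<beta> by auto
  moreover have "integral {1..m} (\<lambda>v. Q v * \<phi>' v + Q' v * \<phi> v) = integral {1..m} (\<lambda>v. Q v * \<phi>' v) + integral {1..m} (\<lambda>v. Q' v * \<phi> v)"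
    using m by (intro integral_add integrable_continuous_interval continuous_on_subset[OF c1] continuous_on_subset[OF c2]) auto
  ultimately have "integral {1..m} (\<lambda>v. Q v * \<phi>' v) = - Q 1 * \<phi> 1 - integral {1..m} (\<lambda>v. Q' v * \<phi> v)"
    by (simp add: has_integral_iff algebra_simps)
  thus ?thesis
    using set_integral_cutoff_infinity(2)[OF c1 m(1)] set_integral_cutoff_infinity(2)[OF c2 m(1)] z by simp
qed

lemma LBINT_scale:
  fixes k :: "real \<Rightarrow> complex"
  assumes "y > 0"
  shows "(LBINT t:{0<..<y}. k t) = (LBINT v:{0<..<1}. of_real y * k (y * v))"
    "(LBINT t:{y<..}. k t) = (LBINT v:{1<..}. of_real y * k (y * v))"
proof -
  have *: "(LBINT t:S. k t) = (LBINT v:T. of_real y * k (y * v))" if "\<And>v. y * v \<in> S \<longleftrightarrow> v \<in> T" for S T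
  proof -
    have ind: "indicator S (y * v) = (indicator T v :: real)" for v using that by (simp add: indicator_def)
    have "(LBINT t:S. k t) = y *\<^sub>R (LBINT v. indicator S (0 + y * v) *\<^sub>R k (0 + y * v))"
      unfolding set_lebesgue_integral_def
      using assms lborel_integral_real_affine[of y "\<lambda>t. indicator S t *\<^sub>R k t" 0] by simp
    also have "\<dots> = of_real y * (LBINT v:T. k (y * v))"
      by (simp add: ind set_lebesgue_integral_def scaleR_conv_of_real)
    finally show ?thesis by simp
  qed
  show "(LBINT t:{0<..<y}. k t) = (LBINT v:{0<..<1}. of_real y * k (y * v))"
    by (rule *) (use assms in \<open>auto simp: zero_less_mult_iff\<close>)
  show "(LBINT t:{y<..}. k t) = (LBINT v:{1<..}. of_real y * k (y * v))"
    by (rule *) (use assms in auto)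
qed

section \<open>Mellin transforms of dilations and of multiplicative convolutions\<close>

lemma mellin_integrable_test_fun:
  assumes "f \<in> test_funs" shows "mellin_integrable f s"
proof -
  obtain a b where f: "0 < a" "a < b" "\<forall>x. x \<notin> {a..b} \<longrightarrow> f x = 0"
    using test_fun_derivative[OF assms] by blast
  have "continuous_on {a..b} (\<lambda>x. complex_of_real x powr (s - 1) * f x)"
    using f(1) by (intro continuous_intros continuous_on_subset[OF continuous_on_test_fun[OF assms]])
      (auto simp: complex_nonpos_Reals_iff)
  hence "set_integrable lborel {a..b} (\<lambda>x. complex_of_real x powr (s - 1) * f x)"
    by (rule borel_integrable_atLeastAtMost')
  also have "?this \<longleftrightarrow> mellin_integrable f s"
    unfolding mellin_integrable_def set_integrable_def
    by (intro Bochner_Integration.integrable_cong) (use f in \<open>auto simp: indicator_def\<close>)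
  finally show ?thesis .
qed

lemma powr_scale:
  assumes "x > 0" "v > 0"
  shows "complex_of_real (x * v) powr z = of_real x powr z * of_real v powr z"
  using assms by (simp add: powr_times_real)

text \<open>The substitution x = y / v produces the factor v^(-s). The version for the integral of
  the modulus is what Fubini's theorem for convolutions asks for.\<close>

lemma mellin_scale:
  fixes f :: "real \<Rightarrow> complex"
  assumes v: "v > 0" and f: "mellin_integrable f s"
  shows "mellin_integrable (\<lambda>x. f (x * v)) s"
    "mellin (\<lambda>x. f (x * v)) s = of_real v powr (- s) * mellin f s"
    "(LBINT x. norm (indicator {0<..} x *\<^sub>R (complex_of_real x powr (s - 1) * f (x * v)))) =
       v powr (- Re s) * (LBINT x. norm (indicator {0<..} x *\<^sub>R (complex_of_real x powr (s - 1) * f x)))"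
proof -
  let ?F = "\<lambda>x. indicator {0<..} x *\<^sub>R (complex_of_real x powr (s - 1) * f x)"
  let ?G = "\<lambda>x. indicator {0<..} x *\<^sub>R (complex_of_real x powr (s - 1) * f (x * v))"
  have G: "?G x = of_real v powr (1 - s) * ?F (0 + v * x)" for x
  proof (cases "x > 0")
    case True
    have "complex_of_real (v * x) powr (s - 1) = of_real v powr (s - 1) * of_real x powr (s - 1)"
      using True v by (intro powr_scale) auto
    moreover have "complex_of_real v powr (1 - s) * of_real v powr (s - 1) = 1"
      using v by (simp flip: powr_add)
    ultimately show ?thesis using True v
      by (simp add: indicator_def zero_less_mult_iff mult_ac)
  next
    case False
    thus ?thesis using v by (auto simp: indicator_def zero_less_mult_iff)
  qed
  have iF: "integrable lborel ?F" using f by (simp add: mellin_integrable_def set_integrable_def)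
  show "mellin_integrable (\<lambda>x. f (x * v)) s"
    unfolding mellin_integrable_def set_integrable_def G
    using v iF lborel_integrable_real_affine_iff[of v ?F 0] by (intro integrable_mult_right) auto
  have vv: "complex_of_real v powr (1 - s) = of_real v * of_real v powr (- s)"
    using v powr_add[of "complex_of_real v" 1 "- s"] by simp
  have "mellin (\<lambda>x. f (x * v)) s = of_real v powr (1 - s) * (LBINT x. ?F (0 + v * x))"
    unfolding mellin_def set_lebesgue_integral_def G by (rule integral_mult_right_zero)
  also have "\<dots> = of_real v powr (- s) * (v *\<^sub>R (LBINT x. ?F (0 + v * x)))"
    by (simp add: vv scaleR_conv_of_real)
  also have "v *\<^sub>R (LBINT x. ?F (0 + v * x)) = (LBINT x. ?F x)"
    using v by (subst (2) lborel_integral_real_affine[where c = v and t = 0]) auto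
  finally show "mellin (\<lambda>x. f (x * v)) s = of_real v powr (- s) * mellin f s"
    by (simp add: mellin_def set_lebesgue_integral_def)
  have "(LBINT x. norm (?G x)) = v powr (1 - Re s) * (LBINT x. norm (?F (0 + v * x)))"
    unfolding G norm_mult[of "complex_of_real v powr (1 - s)"] integral_mult_right_zero
    using v by (simp add: norm_powr_real_powr)
  also have "\<dots> = v powr (- Re s) * (v * (LBINT x. norm (?F (0 + v * x))))"
    using v powr_add[of v 1 "- Re s"] by simp
  also have "v * (LBINT x. norm (?F (0 + v * x))) = (LBINT x. norm (?F x))"
    using v by (subst (2) lborel_integral_real_affine[where c = v and t = 0]) auto
  finally show "(LBINT x. norm (?G x)) = v powr (- Re s) * (LBINT x. norm (?F x))" .
qed

text \<open>For fixed v the transform of x \<mapsto> f (x v) is v^(-s) times that of f, so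
  exchanging the integrals factors the transform of the convolution. Integrability of q v v^(-s)
  over I is exactly the condition for the exchange.\<close>

lemma mellin_convolution:
  fixes f q :: "real \<Rightarrow> complex"
  assumes f: "f \<in> test_funs" and I: "I \<in> sets borel" "I \<subseteq> {0<..}"
    and q: "set_integrable lborel I (\<lambda>v. q v * of_real v powr (- s))" "continuous_on I q"
    and A: "\<And>x. x > 0 \<Longrightarrow> A x = f x + (LBINT v:I. q v * f (x * v))"
  shows "mellin_integrable A s" "mellin A s = (1 + (LBINT v:I. q v * of_real v powr (- s))) * mellin f s"
proof -
  have cf: "continuous_on UNIV f"
    by (rule continuous_on_test_fun[OF f])
  have [measurable]: "f \<in> borel_measurable borel"
    using cf by (rule borel_measurable_continuous_onI)
  have [measurable]: "(\<lambda>v. indicator I v *\<^sub>R q v) \<in> borel_measurable borel"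
    using q(2) I by (intro borel_measurable_continuous_on_indicator)
  note mf = mellin_integrable_test_fun[OF f, of s]
  let ?w = "\<lambda>x. indicator {0<..} x *\<^sub>R (complex_of_real x powr (s - 1))"
  have [measurable]: "?w \<in> borel_measurable borel"
    by (intro borel_measurable_continuous_on_indicator continuous_intros) (auto simp: complex_nonpos_Reals_iff)
  \<comment> \<open>With both indicators inside, the integrand is Borel measurable on the whole
    plane, although q is continuous only on I and the power only for x > 0.\<close>
  define F where "F = (\<lambda>v x. (indicator I v *\<^sub>R q v) * (?w x * f (x * v)))"
  have F_inner: "F v x = (indicator I v *\<^sub>R q v) * (indicator {0<..} x *\<^sub>R (complex_of_real x powr (s - 1) * f (x * v)))" for v x
    by (simp add: F_def)
  have inner_int: "integrable lborel (F v)" for v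
  proof (cases "v \<in> I")
    case True
    hence "v > 0" using I by auto
    from mellin_scale(1)[OF this mf] show ?thesis
      unfolding F_inner mellin_integrable_def set_integrable_def by (rule integrable_mult_right)
  qed (simp add: F_def)
  define N where "N = (LBINT x. norm (indicator {0<..} x *\<^sub>R (complex_of_real x powr (s - 1) * f x)))"
  have inner_norm: "(LBINT x. norm (F v x)) = norm (indicator I v *\<^sub>R (q v * of_real v powr (- s))) * N" for v
  proof (cases "v \<in> I")
    case True
    hence v: "v > 0" using I by auto
    have "(LBINT x. norm (F v x)) = norm (q v) * (LBINT x. norm (indicator {0<..} x *\<^sub>R (complex_of_real x powr (s - 1) * f (x * v))))"
      unfolding F_inner norm_mult[of "indicator I v *\<^sub>R q v"] integral_mult_right_zero using True by simp
    also have "\<dots> = norm (q v) * (v powr (- Re s) * N)"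
      unfolding N_def mellin_scale(3)[OF v mf] ..
    finally show ?thesis using True v by (simp add: norm_mult norm_powr_real_powr)
  qed (simp add: F_def)
  have inner_eq: "(LBINT x. F v x) = (indicator I v *\<^sub>R (q v * of_real v powr (- s))) * mellin f s" for v
  proof (cases "v \<in> I")
    case True
    hence v: "v > 0" using I by auto
    have "(LBINT x. F v x) = q v * mellin (\<lambda>x. f (x * v)) s"
      unfolding F_inner integral_mult_right_zero using True by (simp add: mellin_def set_lebesgue_integral_def)
    also have "\<dots> = q v * (of_real v powr (- s) * mellin f s)"
      unfolding mellin_scale(2)[OF v mf] ..
    finally show ?thesis using True by simp
  qed (simp add: F_def)
  have qi: "integrable lborel (\<lambda>v. indicator I v *\<^sub>R (q v * of_real v powr (- s)))"
    using q(1) by (simp add: set_integrable_def)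
  have int: "integrable (lborel \<Otimes>\<^sub>M lborel) (case_prod F)"
  proof (rule lborel_pair.Fubini_integrable)
    show "case_prod F \<in> borel_measurable (lborel \<Otimes>\<^sub>M lborel)"
      unfolding F_def by measurable
    show "integrable lborel (\<lambda>v. LBINT x. norm (case_prod F (v, x)))"
      unfolding prod.case inner_norm using qi by (intro integrable_mult_left integrable_norm)
    show "AE v in lborel. integrable lborel (\<lambda>x. case_prod F (v, x))"
      unfolding prod.case using inner_int by simp
  qed
  have out: "indicator {0<..} x *\<^sub>R (complex_of_real x powr (s - 1) * A x) =
      indicator {0<..} x *\<^sub>R (complex_of_real x powr (s - 1) * f x) + (LBINT v. F v x)" for x
  proof (cases "x > 0")
    case True
    have "(LBINT v. F v x) = complex_of_real x powr (s - 1) * (LBINT v:I. q v * f (x * v))"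
      unfolding F_def set_lebesgue_integral_def using True
      by (simp add: mult_ac flip: integral_mult_right_zero)
    thus ?thesis using True by (simp add: A algebra_simps)
  qed (simp add: F_def)
  have fi: "integrable lborel (\<lambda>x. indicator {0<..} x *\<^sub>R (complex_of_real x powr (s - 1) * f x))"
    using mf by (simp add: mellin_integrable_def set_integrable_def)
  note Fi = lborel_pair.integrable_snd[OF int]
  show "mellin_integrable A s"
    unfolding mellin_integrable_def set_integrable_def out
    by (intro Bochner_Integration.integrable_add fi Fi)
  have "mellin A s = mellin f s + (LBINT x. LBINT v. F v x)"
    unfolding mellin_def set_lebesgue_integral_def out
    by (intro Bochner_Integration.integral_add fi Fi)
  also have "(LBINT x. LBINT v. F v x) = (LBINT v. LBINT x. F v x)"
    by (rule lborel_pair.Fubini_integral[OF int])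
  also have "\<dots> = (LBINT v:I. q v * of_real v powr (- s)) * mellin f s"
    unfolding inner_eq set_lebesgue_integral_def by (rule integral_mult_left_zero)
  finally show "mellin A s = (1 + (LBINT v:I. q v * of_real v powr (- s))) * mellin f s"
    by (simp add: algebra_simps)
qed

section \<open>The operators as Mellin multipliers\<close>

lemma continuous_on_legendre_P_inverse: "continuous_on {0<..} (\<lambda>v. legendre_P \<nu> (1 / v))"
  by (rule continuous_on_compose2[OF continuous_on_legendre_P]) (auto intro!: continuous_intros)

lemma continuous_on_legendre_P'_inverse: "continuous_on {0<..} (\<lambda>v. legendre_P' \<nu> (1 / v))"
  by (rule continuous_on_compose2[OF continuous_on_legendre_P']) (auto intro!: continuous_intros)

lemma continuous_on_scaled:
  fixes f :: "real \<Rightarrow> complex"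
  assumes "continuous_on UNIV f" shows "continuous_on A (\<lambda>v. f (x * v))"
  by (rule continuous_on_compose2[OF assms]) (auto intro!: continuous_intros)

text \<open>The parameter y enters only through the smooth factor y f (y v), so continuity of R in v
  suffices for differentiation under the integral.\<close>

lemma leibniz_scaled:
  fixes R f f' :: "real \<Rightarrow> complex"
  assumes R: "continuous_on {m..n} R" and f: "\<forall>x. (f has_vector_derivative f' x) (at x)" "continuous_on UNIV f" "continuous_on UNIV f'"
    and U: "x \<in> {x1<..<x2}"
  shows "((\<lambda>y. integral {m..n} (\<lambda>v. R v * (of_real y * f (y * v)))) has_vector_derivative
     integral {m..n} (\<lambda>v. R v * (f (x * v) + of_real x * (of_real v * f' (x * v))))) (at x)"
proof -
  have "((\<lambda>y. integral (cbox m n) (\<lambda>v. R v * (of_real y * f (y * v)))) has_vector_derivative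
     integral (cbox m n) (\<lambda>v. R v * (f (x * v) + of_real x * (of_real v * f' (x * v))))) (at x within {x1<..<x2})"
  proof (rule leibniz_rule_vector_derivative[OF _ _ _ U])
    fix y v :: real
    have 1: "((\<lambda>y. f (y * v)) has_vector_derivative of_real v * f' (y * v)) (at y)"
      using has_vector_derivative_scaled[of f f' v y] f(1) by (simp add: mult.commute)
    have 2: "(complex_of_real has_vector_derivative 1) (at y)" by (auto intro!: derivative_eq_intros)
    have "((\<lambda>y. of_real y * f (y * v)) has_vector_derivative (of_real y * (of_real v * f' (y * v)) + 1 * f (y * v))) (at y)"
      by (rule has_vector_derivative_mult[OF 2 1])
    from has_vector_derivative_mult_right[OF this, of "R v"]
    have "((\<lambda>y. R v * (of_real y * f (y * v))) has_vector_derivative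
       R v * (f (y * v) + of_real y * (of_real v * f' (y * v)))) (at y)"
      by (simp add: add.commute)
    thus "((\<lambda>y. R v * (of_real y * f (y * v))) has_vector_derivative
       R v * (f (y * v) + of_real y * (of_real v * f' (y * v)))) (at y within {x1<..<x2})"
      by (rule has_vector_derivative_at_within)
  next
    fix y show "(\<lambda>v. R v * (of_real y * f (y * v))) integrable_on cbox m n"
      unfolding cbox_interval
      by (intro integrable_continuous_interval continuous_intros R continuous_on_scaled f(2))
  next
    have p: "continuous_on ({x1<..<x2} \<times> cbox m n) (\<lambda>z. F (fst z * snd z))" if "continuous_on UNIV F" for F :: "real \<Rightarrow> complex"
      by (rule continuous_on_compose2[OF that]) (auto intro!: continuous_intros)
    have "continuous_on ({x1<..<x2} \<times> cbox m n) (\<lambda>z. R (snd z))"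
      by (rule continuous_on_compose2[OF R]) (auto intro!: continuous_intros)
    thus "continuous_on ({x1<..<x2} \<times> cbox m n) (\<lambda>(y, v). R v * (f (y * v) + of_real y * (of_real v * f' (y * v))))"
      unfolding case_prod_beta by (intro continuous_intros p f)
  qed auto
  thus ?thesis using U by (simp add: at_within_open[of x "{x1<..<x2}"])
qed

text \<open>Differentiating f (y v) in y produces a factor v. The integration by parts that removes
  f' therefore acts on v P_\<nu>(1 / v), not on P_\<nu>(1 / v).\<close>

lemma reciprocal_argument_deriv:
  assumes "v > 0"
  shows "((\<lambda>v. of_real v * legendre_P \<nu> (1 / v)) has_vector_derivative
    legendre_P \<nu> (1 / v) - legendre_P' \<nu> (1 / v) / of_real v) (at v)"
proof -
  have 1: "((\<lambda>v::real. 1 / v) has_vector_derivative - (1 / v\<^sup>2)) (at v)"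
    using assms by (auto intro!: derivative_eq_intros simp: has_real_derivative_iff_has_vector_derivative[symmetric] power2_eq_square)
  have "((\<lambda>v. legendre_P \<nu> (1 / v)) has_vector_derivative - (1 / v\<^sup>2) *\<^sub>R legendre_P' \<nu> (1 / v)) (at v)"
    using vector_diff_chain_at[OF 1 has_vector_derivative_legendre_P[of "1 / v" \<nu>]] assms by (simp add: o_def)
  moreover have "(complex_of_real has_vector_derivative 1) (at v)" by (auto intro!: derivative_eq_intros)
  ultimately have "((\<lambda>v. of_real v * legendre_P \<nu> (1 / v)) has_vector_derivative
     of_real v * (- (1 / v\<^sup>2) *\<^sub>R legendre_P' \<nu> (1 / v)) + 1 * legendre_P \<nu> (1 / v)) (at v)"
    by (intro has_vector_derivative_mult)
  thus ?thesis
    by (rule has_vector_derivative_eq_rhs) (use assms in \<open>simp add: scaleR_conv_of_real power2_eq_square\<close>)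
qed

lemma continuous_on_reciprocal_kernel:
  "continuous_on {0<..} (\<lambda>v. legendre_P' \<nu> (1 / v) / of_real v)"
  by (intro continuous_intros continuous_on_legendre_P'_inverse) auto

text \<open>After t = x v the derivative of f is moved onto the Legendre function; the boundary term
  at v = 1 is f x because P_\<nu>(1) = 1.\<close>

lemma BE_P0plus_eq:
  assumes f: "f \<in> test_funs" and x: "x > 0"
  shows "BE_P0plus \<nu> f x = f x + (LBINT v:{0<..<1}. - legendre_P' \<nu> v * f (x * v))"
proof -
  obtain f' a b where ab: "0 < a" "a < b" and d: "\<forall>x. (f has_vector_derivative f' x) (at x)"
    and c: "continuous_on UNIV f'" and z: "\<forall>x. x \<notin> {a..b} \<longrightarrow> f x = 0 \<and> f' x = 0"
    using test_fun_derivative[OF f] by blast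
  have vd: "vector_derivative f (at t) = f' t" for t using d vector_derivative_at by blast
  have "BE_P0plus \<nu> f x = (LBINT v:{0<..<1}. of_real x * (legendre_P \<nu> (x * v / x) * f' (x * v)))"
    unfolding BE_P0plus_def vd by (rule LBINT_scale(1)[OF x])
  also have "\<dots> = (LBINT v:{0<..<1}. legendre_P \<nu> v * (of_real x * f' (x * v)))"
    using x by (simp add: mult_ac)
  also have "\<dots> = legendre_P \<nu> 1 * f (x * 1) - (LBINT v:{0<..<1}. legendre_P' \<nu> v * f (x * v))"
  proof (rule integration_by_parts_unit)
    show "((\<lambda>v. f (x * v)) has_vector_derivative of_real x * f' (x * v)) (at v)" for v
      using d by (intro has_vector_derivative_scaled) auto
    show "a / x > 0" using ab x by simp
    show "continuous_on UNIV (\<lambda>v. of_real x * f' (x * v))"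
      by (intro continuous_intros continuous_on_scaled c)
  qed (use z ab x in \<open>auto simp: has_vector_derivative_legendre_P continuous_on_legendre_P' field_simps\<close>)
  finally show ?thesis by (simp add: set_lebesgue_integral_def)
qed

lemma BE_Pminus_eq:
  assumes f: "f \<in> test_funs" and x: "x > 0"
  shows "BE_Pminus \<nu> f x = f x + (LBINT v:{1<..}. legendre_P' \<nu> v * f (x * v))"
proof -
  obtain f' a b where ab: "0 < a" "a < b" and d: "\<forall>x. (f has_vector_derivative f' x) (at x)"
    and c: "continuous_on UNIV f'" and z: "\<forall>x. x \<notin> {a..b} \<longrightarrow> f x = 0 \<and> f' x = 0"
    using test_fun_derivative[OF f] by blast
  have vd: "vector_derivative f (at t) = f' t" for t using d vector_derivative_at by blast
  have "BE_Pminus \<nu> f x = - (LBINT v:{1<..}. of_real x * (legendre_P \<nu> (x * v / x) * f' (x * v)))"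
    unfolding BE_Pminus_def vd LBINT_scale(2)[OF x] ..
  also have "\<dots> = - (LBINT v:{1<..}. legendre_P \<nu> v * (of_real x * f' (x * v)))"
    using x by (simp add: mult_ac)
  also have "(LBINT v:{1<..}. legendre_P \<nu> v * (of_real x * f' (x * v))) =
      - legendre_P \<nu> 1 * f (x * 1) - (LBINT v:{1<..}. legendre_P' \<nu> v * f (x * v))"
  proof (rule integration_by_parts_infinity)
    show "((\<lambda>v. f (x * v)) has_vector_derivative of_real x * f' (x * v)) (at v)" for v
      using d by (intro has_vector_derivative_scaled) auto
    show "continuous_on UNIV (\<lambda>v. of_real x * f' (x * v))"
      by (intro continuous_intros continuous_on_scaled c)
    fix v assume "v > b / x"
    thus "f (x * v) = 0" "of_real x * f' (x * v) = 0" using z x by (auto simp: field_simps)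
  qed (auto simp: has_vector_derivative_legendre_P continuous_on_legendre_P')
  finally show ?thesis by simp
qed

text \<open>The substitution t = y v moves y out of the limit and out of the Legendre function into
  f, so the derivative can be taken under the integral. Integrating the term with f' by parts gives
  the boundary value f x and cancels both integrals that contain P_\<nu>(1 / v).\<close>

lemma BE_S0plus_eq:
  assumes f: "f \<in> test_funs" and x: "x > 0"
  shows "BE_S0plus \<nu> f x = f x + (LBINT v:{0<..<1}. legendre_P' \<nu> (1 / v) / of_real v * f (x * v))"
proof -
  obtain f' a b where ab: "0 < a" "a < b" and d: "\<forall>x. (f has_vector_derivative f' x) (at x)"
    and c: "continuous_on UNIV f'" and z: "\<forall>x. x \<notin> {a..b} \<longrightarrow> f x = 0 \<and> f' x = 0"
    using test_fun_derivative[OF f] by blast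
  note cf = continuous_on_test_fun[OF f]
  note [continuous_intros] = continuous_on_scaled[OF c] continuous_on_scaled[OF cf] continuous_on_legendre_P_inverse continuous_on_reciprocal_kernel
  let ?R = "\<lambda>v. legendre_P \<nu> (1 / v)"
  \<comment> \<open>One cutoff serves all y < 2 x, a neighbourhood of x: for v < m the product y v
    stays below a, where f vanishes.\<close>
  define m where "m = min (a / (4 * x)) (1 / 2)"
  have m: "0 < m" "m < 1" using ab x by (auto simp: m_def)
  have small: "f (y * v) = 0" "f' (y * v) = 0" if "0 < y" "y < 2 * x" "0 < v" "v < m" for y v
  proof -
    have "y * v < 2 * x * (a / (4 * x))" using that x by (intro mult_strict_mono) (auto simp: m_def)
    also have "\<dots> \<le> a" using x ab by simp
    finally show "f (y * v) = 0" "f' (y * v) = 0" using z by auto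
  qed
  have g: "(LBINT t:{0<..<y}. legendre_P \<nu> (y / t) * f t) = integral {m..1} (\<lambda>v. ?R v * (of_real y * f (y * v)))"
    if y: "y \<in> {0<..<2 * x}" for y
  proof -
    have "(LBINT t:{0<..<y}. legendre_P \<nu> (y / t) * f t) = (LBINT v:{0<..<1}. of_real y * (legendre_P \<nu> (y / (y * v)) * f (y * v)))"
      using y by (intro LBINT_scale(1)) auto
    also have "\<dots> = (LBINT v:{0<..<1}. ?R v * (of_real y * f (y * v)))"
      using y by (simp add: mult_ac)
    also have "\<dots> = integral {m..1} (\<lambda>v. ?R v * (of_real y * f (y * v)))"
      using y by (intro set_integral_cutoff_unit(2) m continuous_intros) (auto simp: small)
    finally show ?thesis .
  qed
  have "((\<lambda>y. LBINT t:{0<..<y}. legendre_P \<nu> (y / t) * f t) has_vector_derivative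
     integral {m..1} (\<lambda>v. ?R v * (f (x * v) + of_real x * (of_real v * f' (x * v))))) (at x)"
  proof (rule has_vector_derivative_transform_within_open[OF leibniz_scaled])
    show "continuous_on {m..1} ?R"
      using m by (intro continuous_on_subset[OF continuous_on_legendre_P_inverse]) auto
    show "x \<in> {0<..<2 * x}" "x \<in> {0<..<2 * x}" "open {0<..<2 * x}" using x by auto
  qed (use g d c cf in auto)
  hence "BE_S0plus \<nu> f x = integral {m..1} (\<lambda>v. ?R v * (f (x * v) + of_real x * (of_real v * f' (x * v))))"
    unfolding BE_S0plus_def by (rule vector_derivative_at)
  also have "\<dots> = (LBINT v:{0<..<1}. ?R v * (f (x * v) + of_real x * (of_real v * f' (x * v))))"
    using x by (intro set_integral_cutoff_unit(2)[symmetric] m continuous_intros) (auto simp: small)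
  also have "\<dots> = (LBINT v:{0<..<1}. ?R v * f (x * v) + (of_real v * ?R v) * (of_real x * f' (x * v)))"
    by (simp add: algebra_simps)
  also have "\<dots> = (LBINT v:{0<..<1}. ?R v * f (x * v)) + (LBINT v:{0<..<1}. (of_real v * ?R v) * (of_real x * f' (x * v)))"
    using x by (intro set_integral_add(2) set_integral_cutoff_unit(1)[of _ m] m continuous_intros) (auto simp: small)
  also have "(LBINT v:{0<..<1}. (of_real v * ?R v) * (of_real x * f' (x * v))) =
     of_real 1 * ?R 1 * f (x * 1) - (LBINT v:{0<..<1}. (?R v - legendre_P' \<nu> (1 / v) / of_real v) * f (x * v))"
  proof (rule integration_by_parts_unit)
    show "((\<lambda>v. f (x * v)) has_vector_derivative of_real x * f' (x * v)) (at v)" for v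
      using d by (intro has_vector_derivative_scaled) auto
    show "a / x > 0" using ab x by simp
    show "continuous_on UNIV (\<lambda>v. of_real x * f' (x * v))" by (intro continuous_intros)
    show "continuous_on {0<..} (\<lambda>v. ?R v - legendre_P' \<nu> (1 / v) / of_real v)"
      by (intro continuous_on_diff continuous_on_legendre_P_inverse continuous_on_reciprocal_kernel)
    show "((\<lambda>v. of_real v * ?R v) has_vector_derivative ?R v - legendre_P' \<nu> (1 / v) / of_real v) (at v)" if "v > 0" for v
      using that by (rule reciprocal_argument_deriv)
  qed (use z ab x in \<open>auto simp: field_simps\<close>)
  also have "(LBINT v:{0<..<1}. (?R v - legendre_P' \<nu> (1 / v) / of_real v) * f (x * v)) =
     (LBINT v:{0<..<1}. ?R v * f (x * v) - legendre_P' \<nu> (1 / v) / of_real v * f (x * v))"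
    by (simp add: algebra_simps)
  also have "\<dots> = (LBINT v:{0<..<1}. ?R v * f (x * v)) - (LBINT v:{0<..<1}. legendre_P' \<nu> (1 / v) / of_real v * f (x * v))"
    using x by (intro set_integral_diff(2) set_integral_cutoff_unit(1)[of _ m] m continuous_on_mult continuous_on_reciprocal_kernel continuous_on_legendre_P_inverse continuous_on_scaled cf) (auto simp: small)
  finally show ?thesis by simp
qed

lemma BE_Sminus_eq:
  assumes f: "f \<in> test_funs" and x: "x > 0"
  shows "BE_Sminus \<nu> f x = f x + (LBINT v:{1<..}. - (legendre_P' \<nu> (1 / v) / of_real v) * f (x * v))"
proof -
  obtain f' a b where ab: "0 < a" "a < b" and d: "\<forall>x. (f has_vector_derivative f' x) (at x)"
    and c: "continuous_on UNIV f'" and z: "\<forall>x. x \<notin> {a..b} \<longrightarrow> f x = 0 \<and> f' x = 0"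
    using test_fun_derivative[OF f] by blast
  note cf = continuous_on_test_fun[OF f]
  note [continuous_intros] = continuous_on_scaled[OF c] continuous_on_scaled[OF cf] continuous_on_legendre_P_inverse continuous_on_reciprocal_kernel
  let ?R = "\<lambda>v. legendre_P \<nu> (1 / v)"
  \<comment> \<open>For y > x / 2 and v > m the product y v exceeds b, so the cutoff is uniform for
    y near x.\<close>
  define m where "m = max (2 * b / x) 2"
  have m: "1 < m" by (auto simp: m_def)
  have large: "f (y * v) = 0" "f' (y * v) = 0" if "x / 2 < y" "v > m" for y v
  proof -
    have "b = x / 2 * (2 * b / x)" using x by simp
    also have "\<dots> < y * v" using that x ab by (intro mult_strict_mono) (auto simp: m_def)
    finally show "f (y * v) = 0" "f' (y * v) = 0" using z by auto
  qed
  have g: "(LBINT t:{y<..}. legendre_P \<nu> (y / t) * f t) = integral {1..m} (\<lambda>v. ?R v * (of_real y * f (y * v)))"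
    if y: "y \<in> {x / 2<..<2 * x}" for y
  proof -
    have y0: "y > 0" using y x by auto
    have "(LBINT t:{y<..}. legendre_P \<nu> (y / t) * f t) = (LBINT v:{1<..}. of_real y * (legendre_P \<nu> (y / (y * v)) * f (y * v)))"
      using y0 by (intro LBINT_scale(2)) auto
    also have "\<dots> = (LBINT v:{1<..}. ?R v * (of_real y * f (y * v)))"
      using y0 by (simp add: mult_ac)
    also have "\<dots> = integral {1..m} (\<lambda>v. ?R v * (of_real y * f (y * v)))"
      using y by (intro set_integral_cutoff_infinity(2) m continuous_intros) (auto simp: large)
    finally show ?thesis .
  qed
  have "((\<lambda>y. LBINT t:{y<..}. legendre_P \<nu> (y / t) * f t) has_vector_derivative
     integral {1..m} (\<lambda>v. ?R v * (f (x * v) + of_real x * (of_real v * f' (x * v))))) (at x)"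
  proof (rule has_vector_derivative_transform_within_open[OF leibniz_scaled])
    show "continuous_on {1..m} ?R"
      using m by (intro continuous_on_subset[OF continuous_on_legendre_P_inverse]) auto
    show "x \<in> {x / 2<..<2 * x}" "x \<in> {x / 2<..<2 * x}" "open {x / 2<..<2 * x}" using x by auto
  qed (use g d c cf in auto)
  hence "BE_Sminus \<nu> f x = - integral {1..m} (\<lambda>v. ?R v * (f (x * v) + of_real x * (of_real v * f' (x * v))))"
    unfolding BE_Sminus_def by (simp add: vector_derivative_at)
  also have "integral {1..m} (\<lambda>v. ?R v * (f (x * v) + of_real x * (of_real v * f' (x * v))))
     = (LBINT v:{1<..}. ?R v * (f (x * v) + of_real x * (of_real v * f' (x * v))))"
    using x by (intro set_integral_cutoff_infinity(2)[symmetric] m continuous_intros) (auto simp: large)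
  also have "\<dots> = (LBINT v:{1<..}. ?R v * f (x * v) + (of_real v * ?R v) * (of_real x * f' (x * v)))"
    by (simp add: algebra_simps)
  also have "\<dots> = (LBINT v:{1<..}. ?R v * f (x * v)) + (LBINT v:{1<..}. (of_real v * ?R v) * (of_real x * f' (x * v)))"
    using x by (intro set_integral_add(2) set_integral_cutoff_infinity(1)[of _ m] m continuous_intros) (auto simp: large)
  also have "(LBINT v:{1<..}. (of_real v * ?R v) * (of_real x * f' (x * v))) =
     - (of_real 1 * ?R 1) * f (x * 1) - (LBINT v:{1<..}. (?R v - legendre_P' \<nu> (1 / v) / of_real v) * f (x * v))"
  proof (rule integration_by_parts_infinity)
    show "((\<lambda>v. f (x * v)) has_vector_derivative of_real x * f' (x * v)) (at v)" for v
      using d by (intro has_vector_derivative_scaled) auto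
    show "continuous_on UNIV (\<lambda>v. of_real x * f' (x * v))" by (intro continuous_intros)
    show "continuous_on {0<..} (\<lambda>v. ?R v - legendre_P' \<nu> (1 / v) / of_real v)"
      by (intro continuous_on_diff continuous_on_legendre_P_inverse continuous_on_reciprocal_kernel)
    fix v assume "v > b / x"
    thus "f (x * v) = 0" "of_real x * f' (x * v) = 0" using z x by (auto simp: field_simps)
  qed (auto simp: reciprocal_argument_deriv)
  also have "(LBINT v:{1<..}. (?R v - legendre_P' \<nu> (1 / v) / of_real v) * f (x * v)) =
     (LBINT v:{1<..}. ?R v * f (x * v) - legendre_P' \<nu> (1 / v) / of_real v * f (x * v))"
    by (simp add: algebra_simps)
  also have "\<dots> = (LBINT v:{1<..}. ?R v * f (x * v)) - (LBINT v:{1<..}. legendre_P' \<nu> (1 / v) / of_real v * f (x * v))"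
    using x by (intro set_integral_diff(2) set_integral_cutoff_infinity(1)[of _ m] m continuous_on_mult continuous_on_reciprocal_kernel continuous_on_legendre_P_inverse continuous_on_scaled cf) (auto simp: large)
  finally show ?thesis by (simp add: set_lebesgue_integral_def)
qed

section \<open>Reciprocal substitution and the multiplier identities\<close>

lemma inverse_image_unit: "(\<lambda>v::real. 1 / v) ` {0<..<1} = {1<..}" "(\<lambda>v::real. 1 / v) ` {1<..} = {0<..<1}"
proof -
  have "x \<in> (\<lambda>v::real. 1 / v) ` {0<..<1}" if "x > 1" for x using that by (intro image_eqI[of _ _ "1 / x"]) auto
  thus "(\<lambda>v::real. 1 / v) ` {0<..<1} = {1<..}" by auto
  have "x \<in> (\<lambda>v::real. 1 / v) ` {1<..}" if "0 < x" "x < 1" for x using that by (intro image_eqI[of _ _ "1 / x"]) auto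
  thus "(\<lambda>v::real. 1 / v) ` {1<..} = {0<..<1}" by auto
qed

text \<open>Under z = 1 / v the measure contributes 1 / v^2 and the power z^(s - 1) becomes v^(1 -
  s); together they give v^(-s) / v.\<close>

lemma reciprocal_kernel_substitution:
  assumes S: "S \<in> sets borel" "(\<lambda>v::real. 1 / v) ` S \<in> sets borel" "S \<subseteq> {0<..}"
    and int: "set_integrable lborel ((\<lambda>v. 1 / v) ` S) (legendre_kernel \<nu> s)"
  shows "set_integrable lborel S (\<lambda>v. legendre_P' \<nu> (1 / v) / of_real v * of_real v powr (- s))"
    "(LBINT v:S. legendre_P' \<nu> (1 / v) / of_real v * of_real v powr (- s)) = (LBINT z:(\<lambda>v. 1 / v) ` S. legendre_kernel \<nu> s z)"
proof -
  have eq: "of_real \<bar>- (1 / v\<^sup>2)\<bar> * legendre_kernel \<nu> s (1 / v) = legendre_P' \<nu> (1 / v) / of_real v * of_real v powr (- s)"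
    if "v \<in> S" for v
  proof -
    have v: "v > 0" using that S by auto
    have "complex_of_real (1 / v) powr (s - 1) = of_real v powr (1 - s)"
    proof -
      have "complex_of_real (1 / v) powr (s - 1) = exp ((s - 1) * of_real (ln (1 / v)))"
        using v by (simp add: powr_def Ln_of_real del: of_real_divide)
      also have "\<dots> = exp ((1 - s) * of_real (ln v))" using v by (simp add: ln_div algebra_simps)
      also have "\<dots> = of_real v powr (1 - s)" using v by (simp add: powr_def Ln_of_real)
      finally show ?thesis .
    qed
    also have "\<dots> = of_real v * of_real v powr (- s)"
      using v powr_add[of "complex_of_real v" 1 "- s"] by simp
    finally show ?thesis using v by (simp add: legendre_kernel_def power2_eq_square del: of_real_divide) (simp add: field_simps)
  qed
  have der: "((\<lambda>v. 1 / v) has_field_derivative - (1 / v\<^sup>2)) (at v within S)" if "v \<in> S" for v :: real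
    using that S by (auto intro!: derivative_eq_intros simp: power2_eq_square)
  have c1: "continuous_on S (\<lambda>v::real. - (1 / v\<^sup>2))" using S by (auto intro!: continuous_intros)
  have c2: "continuous_on ((\<lambda>v. 1 / v) ` S) (legendre_kernel \<nu> s)"
    using S by (intro continuous_on_subset[OF continuous_on_legendre_kernel]) auto
  have inj: "inj_on (\<lambda>v::real. 1 / v) S" by (auto simp: inj_on_def)
  note sub = set_integral_substitution[OF S(1,2) der inj c1 c2 int]
  show "set_integrable lborel S (\<lambda>v. legendre_P' \<nu> (1 / v) / of_real v * of_real v powr (- s))"
  proof -
    have "set_integrable lborel S (\<lambda>v. of_real \<bar>- (1 / v\<^sup>2)\<bar> * legendre_kernel \<nu> s (1 / v)) \<longleftrightarrow>
      set_integrable lborel S (\<lambda>v. legendre_P' \<nu> (1 / v) / of_real v * of_real v powr (- s))"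
      by (intro set_integrable_cong refl) (rule eq)
    thus ?thesis using sub(1) by blast
  qed
  have "(LBINT v:S. of_real \<bar>- (1 / v\<^sup>2)\<bar> * legendre_kernel \<nu> s (1 / v)) =
      (LBINT v:S. legendre_P' \<nu> (1 / v) / of_real v * of_real v powr (- s))"
  proof (rule set_lebesgue_integral_cong)
    show "S \<in> sets lborel" using S by simp
  qed (use eq in blast)
  thus "(LBINT v:S. legendre_P' \<nu> (1 / v) / of_real v * of_real v powr (- s)) = (LBINT z:(\<lambda>v. 1 / v) ` S. legendre_kernel \<nu> s z)"
    using sub(2) by simp
qed

lemma mellin_multiplier_S0plus:
  "mellin_multiplier (BE_S0plus \<nu>) (symbol_S0plus \<nu>) {s. Re s < min (2 + Re \<nu>) (1 - Re \<nu>)}"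
  unfolding mellin_multiplier_def
proof (intro ballI)
  fix f s assume f: "f \<in> test_funs" and "s \<in> {s. Re s < min (2 + Re \<nu>) (1 - Re \<nu>)}"
  \<comment> \<open>The two forms of the half-plane agree: min (2 + r) (1 - r) = 1 - max r (-1 - r)
    for r = Re \<nu>.\<close>
  hence s: "Re s < 1 - max (Re \<nu>) (-1 - Re \<nu>)" by auto
  note int = set_integrable_legendre_kernel_infinity[OF s]
  note sub = reciprocal_kernel_substitution[of "{0<..<1}" \<nu> s, unfolded inverse_image_unit, OF _ _ _ int]
  have q: "continuous_on {0<..<1} (\<lambda>v. legendre_P' \<nu> (1 / v) / of_real v)"
    by (rule continuous_on_subset[OF continuous_on_reciprocal_kernel]) auto
  have i: "set_integrable lborel {0<..<1} (\<lambda>v. legendre_P' \<nu> (1 / v) / of_real v * of_real v powr (- s))"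
    by (rule sub(1)) auto
  have "(LBINT v:{0<..<1}. legendre_P' \<nu> (1 / v) / of_real v * of_real v powr (- s)) = (LBINT z:{1<..}. legendre_kernel \<nu> s z)"
    by (rule sub(2)) auto
  hence sym: "1 + (LBINT v:{0<..<1}. legendre_P' \<nu> (1 / v) / of_real v * of_real v powr (- s)) = symbol_S0plus \<nu> s"
    using legendre_kernel_mellin_infinity[OF s] by simp
  have I: "{0<..<1::real} \<in> sets borel" "{0<..<1::real} \<subseteq> {0<..}" by auto
  note conv = mellin_convolution[OF f I i q BE_S0plus_eq[OF f]]
  show "mellin_integrable (BE_S0plus \<nu> f) s \<and> mellin (BE_S0plus \<nu> f) s = symbol_S0plus \<nu> s * mellin f s"
    using conv unfolding sym by blast
qed

lemma mellin_multiplier_Sminus: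
  "mellin_multiplier (BE_Sminus \<nu>) (symbol_Sminus \<nu>) {s. Re s > 0}"
  unfolding mellin_multiplier_def
proof (intro ballI)
  fix f s assume f: "f \<in> test_funs" and "s \<in> {s. Re s > 0}"
  hence s: "Re s > 0" by auto
  note int = set_integrable_legendre_kernel_zero[OF s, of \<nu>]
  note sub = reciprocal_kernel_substitution[of "{1<..}" \<nu> s, unfolded inverse_image_unit, OF _ _ _ int]
  have q: "continuous_on {1<..} (\<lambda>v. - (legendre_P' \<nu> (1 / v) / of_real v))"
    by (rule continuous_on_minus[OF continuous_on_subset[OF continuous_on_reciprocal_kernel]]) auto
  have i: "set_integrable lborel {1<..} (\<lambda>v. legendre_P' \<nu> (1 / v) / of_real v * of_real v powr (- s))"
    by (rule sub(1)) auto
  have i': "set_integrable lborel {1<..} (\<lambda>v. - (legendre_P' \<nu> (1 / v) / of_real v) * of_real v powr (- s))"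
    using i by (simp add: set_integrable_def)
  have "(LBINT v:{1<..}. legendre_P' \<nu> (1 / v) / of_real v * of_real v powr (- s)) = (LBINT z:{0<..<1}. legendre_kernel \<nu> s z)"
    by (rule sub(2)) auto
  hence sym: "1 + (LBINT v:{1<..}. - (legendre_P' \<nu> (1 / v) / of_real v) * of_real v powr (- s)) = symbol_Sminus \<nu> s"
    using legendre_kernel_mellin_zero[OF s, of \<nu>] by (simp add: set_lebesgue_integral_def)
  have I: "{1::real<..} \<in> sets borel" "{1::real<..} \<subseteq> {0<..}" by auto
  note conv = mellin_convolution[OF f I i' q BE_Sminus_eq[OF f]]
  show "mellin_integrable (BE_Sminus \<nu> f) s \<and> mellin (BE_Sminus \<nu> f) s = symbol_Sminus \<nu> s * mellin f s"
    using conv unfolding sym by blast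
qed

text \<open>The Gamma arguments coincide termwise. This yields the symbols of both P operators from
  the two Mellin transforms already computed.\<close>

lemma symbol_reflection:
  "symbol_Pminus \<nu> s = symbol_S0plus \<nu> (1 - s)" "symbol_P0plus \<nu> s = symbol_Sminus \<nu> (1 - s)"
proof -
  have e: "- (1 - s) / 2 + \<nu> / 2 + 1 = s / 2 + \<nu> / 2 + 1 / 2" "- (1 - s) / 2 - \<nu> / 2 + 1 / 2 = s / 2 - \<nu> / 2"
    "1 / 2 - (1 - s) / 2 = s / 2" "1 - (1 - s) / 2 = s / 2 + 1 / 2"
    "(1 - s) / 2 = 1 / 2 - s / 2" "1 / 2 - s / 2 + 1 / 2 = 1 - s / 2"
    "1 / 2 - s / 2 + \<nu> / 2 + 1 / 2 = - s / 2 + \<nu> / 2 + 1" "1 / 2 - s / 2 - \<nu> / 2 = - s / 2 - \<nu> / 2 + 1 / 2"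
    by (simp_all add: field_simps)
  show "symbol_Pminus \<nu> s = symbol_S0plus \<nu> (1 - s)"
    unfolding symbol_Pminus_def symbol_S0plus_def e(1-4) ..
  show "symbol_P0plus \<nu> s = symbol_Sminus \<nu> (1 - s)"
    unfolding symbol_P0plus_def symbol_Sminus_def e(5-8) ..
qed

lemma mellin_multiplier_P0plus:
  "mellin_multiplier (BE_P0plus \<nu>) (symbol_P0plus \<nu>) {s. Re s < 1}"
  unfolding mellin_multiplier_def
proof (intro ballI)
  fix f s assume f: "f \<in> test_funs" and "s \<in> {s. Re s < 1}"
  hence s: "Re (1 - s) > 0" by auto
  \<comment> \<open>Here the Legendre kernel is not inverted, and the dilation factor v^(-s) equals
    v^((1 - s) - 1); this is the source of the argument 1 - s.\<close>
  have ker: "legendre_kernel \<nu> (1 - s) = (\<lambda>v. legendre_P' \<nu> v * of_real v powr (- s))"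
    by (rule ext) (simp add: legendre_kernel_def)
  note int = set_integrable_legendre_kernel_zero[OF s, of \<nu>]
  have q: "continuous_on {0<..<1} (\<lambda>v. - legendre_P' \<nu> v)"
    by (rule continuous_on_minus[OF continuous_on_subset[OF continuous_on_legendre_P']]) auto
  have i': "set_integrable lborel {0<..<1} (\<lambda>v. - legendre_P' \<nu> v * of_real v powr (- s))"
    using int unfolding ker by (simp add: set_integrable_def)
  have sym: "1 + (LBINT v:{0<..<1}. - legendre_P' \<nu> v * of_real v powr (- s)) = symbol_P0plus \<nu> s"
    using legendre_kernel_mellin_zero[OF s, of \<nu>] unfolding ker symbol_reflection by (simp add: set_lebesgue_integral_def)
  have I: "{0<..<1::real} \<in> sets borel" "{0<..<1::real} \<subseteq> {0<..}" by auto
  note conv = mellin_convolution[OF f I i' q BE_P0plus_eq[OF f]]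
  show "mellin_integrable (BE_P0plus \<nu> f) s \<and> mellin (BE_P0plus \<nu> f) s = symbol_P0plus \<nu> s * mellin f s"
    using conv unfolding sym by blast
qed

lemma mellin_multiplier_Pminus:
  "mellin_multiplier (BE_Pminus \<nu>) (symbol_Pminus \<nu>) {s. Re s > max (Re \<nu>) (- 1 - Re \<nu>)}"
  unfolding mellin_multiplier_def
proof (intro ballI)
  fix f s assume f: "f \<in> test_funs" and "s \<in> {s. Re s > max (Re \<nu>) (- 1 - Re \<nu>)}"
  hence s: "Re (1 - s) < 1 - max (Re \<nu>) (-1 - Re \<nu>)" by auto
  have ker: "legendre_kernel \<nu> (1 - s) = (\<lambda>v. legendre_P' \<nu> v * of_real v powr (- s))"
    by (rule ext) (simp add: legendre_kernel_def)
  note int = set_integrable_legendre_kernel_infinity[OF s]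
  have q: "continuous_on {1<..} (legendre_P' \<nu>)"
    by (rule continuous_on_subset[OF continuous_on_legendre_P']) auto
  have sym: "1 + (LBINT v:{1<..}. legendre_P' \<nu> v * of_real v powr (- s)) = symbol_Pminus \<nu> s"
    using legendre_kernel_mellin_infinity[OF s] unfolding ker symbol_reflection by simp
  have I: "{1::real<..} \<in> sets borel" "{1::real<..} \<subseteq> {0<..}" by auto
  note conv = mellin_convolution[OF f I int[unfolded ker] q BE_Pminus_eq[OF f]]
  show "mellin_integrable (BE_Pminus \<nu> f) s \<and> mellin (BE_Pminus \<nu> f) s = symbol_Pminus \<nu> s * mellin f s"
    using conv unfolding sym by blast
qed

text \<open>An integral over v < 1 sees f only to the left of x, one over v > 1 only to the right.
  Vanishing near 0, or near infinity, therefore passes from f to its image.\<close>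

lemma convolution_vanishes:
  assumes f: "f \<in> test_funs"
  shows "(\<And>x. x > 0 \<Longrightarrow> A x = f x + (LBINT v:{0<..<1}. q v * f (x * v))) \<Longrightarrow> \<exists>a>0. \<forall>x. 0 < x \<and> x < a \<longrightarrow> A x = 0"
    "(\<And>x. x > 0 \<Longrightarrow> A x = f x + (LBINT v:{1<..}. q v * f (x * v))) \<Longrightarrow> \<exists>b>0. \<forall>x. x > b \<longrightarrow> A x = 0"
proof -
  obtain a b where ab: "0 < a" "a < b" and z: "\<forall>x. x \<notin> {a..b} \<longrightarrow> f x = 0"
    using test_fun_derivative[OF f] by blast
  {
    assume A: "\<And>x. x > 0 \<Longrightarrow> A x = f x + (LBINT v:{0<..<1}. q v * f (x * v))"
    have "A x = 0" if "0 < x" "x < a" for x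
    proof -
      have "f (x * v) = 0" if "v \<in> {0<..<1}" for v
      proof -
        have "x * v < x * 1" using that \<open>0 < x\<close> by (intro mult_strict_left_mono) auto
        thus ?thesis using \<open>x < a\<close> z by auto
      qed
      hence "(LBINT v:{0<..<1}. q v * f (x * v)) = (LBINT v:{0<..<1::real}. 0)"
        by (intro set_lebesgue_integral_cong) auto
      thus ?thesis using A[OF that(1)] z that by (simp add: set_lebesgue_integral_def)
    qed
    thus "\<exists>a>0. \<forall>x. 0 < x \<and> x < a \<longrightarrow> A x = 0" using ab by blast
  }
  {
    assume A: "\<And>x. x > 0 \<Longrightarrow> A x = f x + (LBINT v:{1<..}. q v * f (x * v))"
    have "A x = 0" if "x > b" for x
    proof -
      have x: "x > 0" using that ab by auto
      have "f (x * v) = 0" if "v \<in> {1<..}" for v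
      proof -
        have "x * 1 < x * v" using that x by (intro mult_strict_left_mono) auto
        thus ?thesis using \<open>x > b\<close> z by auto
      qed
      hence "(LBINT v:{1<..}. q v * f (x * v)) = (LBINT v:{1::real<..}. 0)"
        by (intro set_lebesgue_integral_cong) auto
      thus ?thesis using A[OF x] z that by (simp add: set_lebesgue_integral_def)
    qed
    thus "\<exists>b>0. \<forall>x. x > b \<longrightarrow> A x = 0" using ab by (meson order_less_trans)
  }
qed

section \<open>Uniqueness of the symbol\<close>

text \<open>Differentiation under the integral by dominated convergence. Inside the strip the
  integrand is dominated by \<open>w\<close>, the sum of its moduli at the edges, and the logarithm
  coming from the difference quotient is paid for by moving d to either side of Re s.\<close>

lemma mellin_differentiable:
  assumes r1: "mellin_integrable g (of_real r1)" and r2: "mellin_integrable g (of_real r2)"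
    and s: "r1 < Re s" "Re s < r2"
  shows "mellin g field_differentiable at s"
proof -
  define d where "d = min (Re s - r1) (r2 - Re s)"
  \<comment> \<open>Half of d bounds the increment h and half absorbs the logarithm L = ln x: the
    difference quotient of exp (h L) at h = 0 is at most exp (\<delta> |L|) |L|, hence at most exp
    (2 \<delta> |L|) / \<delta>.\<close>
  define \<delta> where "\<delta> = d / 2"
  have d: "d > 0" "r1 \<le> Re s - d" "Re s + d \<le> r2" using s by (auto simp: d_def)
  have \<delta>: "\<delta> > 0" "2 * \<delta> = d" using d by (auto simp: \<delta>_def)
  define \<phi> where "\<phi> = (\<lambda>s x. indicator {0<..} x *\<^sub>R (complex_of_real x powr (s - 1) * g x))"
  define w where "w = (\<lambda>x. norm (\<phi> (of_real r1) x) + norm (\<phi> (of_real r2) x))"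
  have i12: "integrable lborel (\<phi> (of_real r1))" "integrable lborel (\<phi> (of_real r2))"
    using r1 r2 by (simp_all add: \<phi>_def mellin_integrable_def set_integrable_def)
  have wi: "integrable lborel w" unfolding w_def using i12 by (intro Bochner_Integration.integrable_add integrable_norm)
  \<comment> \<open>Measurability is available only at the edges, as part of integrability; a factor
    that is a power of x carries it to every z.\<close>
  have shift: "\<phi> z x = indicator {0<..} x *\<^sub>R complex_of_real x powr (z - of_real r1) * \<phi> (of_real r1) x" for z x
    by (auto simp: \<phi>_def indicator_def powr_add[symmetric] mult.assoc[symmetric])
  have m0: "(\<lambda>x. indicator {0<..} x *\<^sub>R complex_of_real x powr c) \<in> borel_measurable lborel" for c
    by (auto intro!: borel_measurable_continuous_on_indicator continuous_intros simp: complex_nonpos_Reals_iff)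
  have meas: "\<phi> z \<in> borel_measurable lborel" for z
    unfolding shift[of z] using m0 i12(1) by (intro borel_measurable_times) auto
  have w_bound: "norm (\<phi> z x) \<le> w x" if "r1 \<le> Re z" "Re z \<le> r2" for z x
  proof (cases "x > 0")
    case True
    have "x powr (Re z - 1) \<le> x powr (r1 - 1) + x powr (r2 - 1)"
    proof (cases "x \<le> 1")
      case True
      hence "x powr (Re z - 1) \<le> x powr (r1 - 1)" using that \<open>x > 0\<close> by (intro powr_mono') auto
      thus ?thesis by (intro order_trans[OF _ add_increasing2[OF _ order_refl]]) auto
    next
      case False
      hence "x powr (Re z - 1) \<le> x powr (r2 - 1)" using that by (intro powr_mono) auto
      thus ?thesis by (intro order_trans[OF _ add_increasing[OF _ order_refl]]) auto
    qed
    hence "x powr (Re z - 1) * norm (g x) \<le> (x powr (r1 - 1) + x powr (r2 - 1)) * norm (g x)"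
      by (rule mult_right_mono) simp
    thus ?thesis using True by (simp add: \<phi>_def w_def norm_mult norm_powr_real_powr distrib_right)
  qed (simp add: \<phi>_def w_def)
  have int: "integrable lborel (\<phi> z)" if "r1 \<le> Re z" "Re z \<le> r2" for z
    by (rule Bochner_Integration.integrable_bound[OF wi meas]) (auto intro!: AE_I2 intro: order_trans[OF w_bound[OF that] abs_ge_self])
  have mel: "mellin g z = (LBINT x. \<phi> z x)" for z
    by (simp add: mellin_def set_lebesgue_integral_def \<phi>_def)
  define D where "D = (LBINT x. of_real (ln x) * \<phi> s x)"
  have "((\<lambda>h. (mellin g (s + h) - mellin g s) / h) \<longlongrightarrow> D) (at 0 within ball 0 \<delta>)"
    unfolding tendsto_at_iff_sequentially
  proof (intro allI impI)
    fix X assume X: "\<forall>i. X i \<in> ball 0 \<delta> - {0}" "X \<longlonglongrightarrow> (0::complex)"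
    have near: "r1 \<le> Re (s + X i)" "Re (s + X i) \<le> r2" for i
    proof -
      have "norm (X i) < \<delta>" using X(1) by auto
      hence "\<bar>Re (X i)\<bar> < \<delta>" using abs_Re_le_cmod[of "X i"] by linarith
      thus "r1 \<le> Re (s + X i)" "Re (s + X i) \<le> r2" using d \<delta> by auto
    qed
    have e: "\<phi> (s + h) x = exp (h * of_real (ln x)) * \<phi> s x" for h x
      by (cases "x > 0") (auto simp: \<phi>_def powr_def Ln_of_real exp_add[symmetric] algebra_simps)
    have "(\<lambda>i. LBINT x. (exp (X i * of_real (ln x)) - 1) / X i * \<phi> s x) \<longlonglongrightarrow> D"
      unfolding D_def
    proof (rule integral_dominated_convergence[where w = "\<lambda>x. 2 / \<delta> * w x"])
      show "(\<lambda>x. complex_of_real (ln x) * \<phi> s x) \<in> borel_measurable lborel"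
        using meas by measurable
      show "(\<lambda>x. (exp (X i * of_real (ln x)) - 1) / X i * \<phi> s x) \<in> borel_measurable lborel" for i
        using meas by measurable
      show "integrable lborel (\<lambda>x. 2 / \<delta> * w x)" using wi by simp
      show "AE x in lborel. (\<lambda>i. (exp (X i * of_real (ln x)) - 1) / X i * \<phi> s x) \<longlonglongrightarrow> of_real (ln x) * \<phi> s x"
      proof (intro AE_I2 tendsto_mult tendsto_const)
        fix x :: real
        have "((\<lambda>h. exp (h * of_real (ln x))) has_field_derivative (of_real (ln x) * exp (0 * of_real (ln x)))) (at 0)"
          by (auto intro!: derivative_eq_intros)
        hence "((\<lambda>h. (exp (h * of_real (ln x)) - 1) / h) \<longlongrightarrow> of_real (ln x)) (at (0::complex))"
          by (simp add: DERIV_def)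
        thus "(\<lambda>i. (exp (X i * of_real (ln x)) - 1) / X i) \<longlonglongrightarrow> of_real (ln x)"
          using X unfolding tendsto_at_iff_sequentially by (auto simp: o_def)
      qed
      show "AE x in lborel. norm ((exp (X i * of_real (ln x)) - 1) / X i * \<phi> s x) \<le> 2 / \<delta> * w x" for i
      proof (rule AE_I2)
        fix x :: real
        show "norm ((exp (X i * of_real (ln x)) - 1) / X i * \<phi> s x) \<le> 2 / \<delta> * w x"
        proof (cases "x > 0")
          case True
          define L where "L = ln x"
          have Xi: "X i \<noteq> 0" "norm (X i) < \<delta>" using X(1) by auto
          have "norm (exp (X i * of_real L) - 1) \<le> exp \<bar>Re (X i * of_real L)\<bar> * norm (X i * of_real L)"
            using Taylor_exp[of "X i * of_real L" 0] by simp
          also have "\<dots> \<le> exp (\<delta> * \<bar>L\<bar>) * (norm (X i) * \<bar>L\<bar>)"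
          proof (intro mult_mono)
            have "\<bar>Re (X i)\<bar> * \<bar>L\<bar> \<le> \<delta> * \<bar>L\<bar>"
              using Xi abs_Re_le_cmod[of "X i"] by (intro mult_right_mono) auto
            thus "exp \<bar>Re (X i * of_real L)\<bar> \<le> exp (\<delta> * \<bar>L\<bar>)" by (simp add: abs_mult)
          qed (auto simp: norm_mult)
          finally have "norm ((exp (X i * of_real L) - 1) / X i) \<le> exp (\<delta> * \<bar>L\<bar>) * \<bar>L\<bar>"
            using Xi by (simp add: norm_divide divide_le_eq mult_ac)
          also have "\<dots> \<le> exp (\<delta> * \<bar>L\<bar>) * (exp (\<delta> * \<bar>L\<bar>) / \<delta>)"
          proof (intro mult_left_mono)
            have "\<delta> * \<bar>L\<bar> \<le> exp (\<delta> * \<bar>L\<bar>)" using exp_ge_add_one_self[of "\<delta> * \<bar>L\<bar>"] by linarith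
            thus "\<bar>L\<bar> \<le> exp (\<delta> * \<bar>L\<bar>) / \<delta>" using \<delta> by (simp add: pos_le_divide_eq mult.commute)
          qed auto
          also have "\<dots> = exp (d * \<bar>L\<bar>) / \<delta>" by (simp add: \<delta>(2)[symmetric] exp_add[symmetric])
          also have "\<dots> \<le> (exp (d * L) + exp (- d * L)) / \<delta>"
            using \<delta> by (intro divide_right_mono) (auto simp: abs_if)
          finally have "norm ((exp (X i * of_real L) - 1) / X i * \<phi> s x) \<le> (exp (d * L) + exp (- d * L)) / \<delta> * norm (\<phi> s x)"
            unfolding norm_mult by (rule mult_right_mono) simp
          also have "\<dots> = (norm (\<phi> (s + of_real d) x) + norm (\<phi> (s + of_real (- d)) x)) / \<delta>"
            unfolding e norm_mult L_def by (simp add: norm_exp_eq_Re algebra_simps add_divide_distrib)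
          also have "\<dots> \<le> (w x + w x) / \<delta>"
            using d s \<delta> by (intro divide_right_mono add_mono w_bound) auto
          finally show ?thesis unfolding L_def by simp
        qed (use \<delta> in \<open>simp add: \<phi>_def w_def\<close>)
      qed
    qed
    moreover have "(LBINT x. (exp (X i * of_real (ln x)) - 1) / X i * \<phi> s x) = (mellin g (s + X i) - mellin g s) / X i" for i
    proof -
      have "(mellin g (s + X i) - mellin g s) / X i = (LBINT x. \<phi> (s + X i) x - \<phi> s x) / X i"
        unfolding mel using near[of i] s by (subst Bochner_Integration.integral_diff) (auto intro!: int)
      also have "\<dots> = (LBINT x. (\<phi> (s + X i) x - \<phi> s x) / X i)" by simp
      also have "\<dots> = (LBINT x. (exp (X i * of_real (ln x)) - 1) / X i * \<phi> s x)"
        unfolding e by (intro Bochner_Integration.integral_cong refl) (simp add: algebra_simps diff_divide_distrib)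
      finally show ?thesis ..
    qed
    ultimately show "((\<lambda>h. (mellin g (s + h) - mellin g s) / h) \<circ> X) \<longlonglongrightarrow> D" by (simp only: o_def)
  qed
  hence "((\<lambda>h. (mellin g (s + h) - mellin g s) / h) \<longlongrightarrow> D) (at 0)"
    using \<delta> by (simp add: at_within_open[of 0 "ball 0 \<delta>"])
  thus ?thesis unfolding field_differentiable_def DERIV_def by blast
qed

text \<open>On a connected open set a meromorphic function is either zero off a sparse set or
  nonzero off a sparse set; vanishing on a punctured neighbourhood excludes the latter. Values on a
  sparse set are arbitrary, so no more can be concluded.\<close>

lemma meromorphic_eq_zero_cosparse:
  assumes "k meromorphic_on \<Omega>" "open \<Omega>" "connected \<Omega>" "z \<in> \<Omega>" "eventually (\<lambda>s. k s = 0) (at z)"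
  shows "eventually (\<lambda>s. k s = 0) (cosparse \<Omega>)"
  using meromorphic_imp_constant_or_avoid[OF assms(1-3), of 0]
proof
  assume "\<forall>\<^sub>\<approx>x\<in>\<Omega>. k x \<noteq> 0"
  hence "eventually (\<lambda>s. k s \<noteq> 0) (at z)"
    using assms(4) by (rule eventually_cosparse_imp_eventually_at)
  hence "eventually (\<lambda>s. False) (at z)" using assms(5) by eventually_elim simp
  thus ?thesis by simp
qed

lemma mellin_integrable_bounded_weight:
  assumes g: "mellin_integrable g s" and C: "\<And>x. x > 0 \<Longrightarrow> g x \<noteq> 0 \<Longrightarrow> x powr (Re t - Re s) \<le> C"
  shows "mellin_integrable g t"
proof -
  let ?I = "\<lambda>s x. indicator {0<..} x *\<^sub>R (complex_of_real x powr (s - 1) * g x)"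
  have i: "integrable lborel (?I s)"
    using g by (simp add: mellin_integrable_def set_integrable_def)
  have m0: "(\<lambda>x. indicator {0<..} x *\<^sub>R complex_of_real x powr (t - s)) \<in> borel_measurable lborel"
    by (auto intro!: borel_measurable_continuous_on_indicator continuous_intros simp: complex_nonpos_Reals_iff)
  have e: "?I t x = (indicator {0<..} x *\<^sub>R complex_of_real x powr (t - s)) * ?I s x" for x
    by (auto simp: indicator_def powr_add[symmetric] mult.assoc[symmetric])
  have "integrable lborel (?I t)"
  proof (rule Bochner_Integration.integrable_bound)
    show "integrable lborel (\<lambda>x. of_real C * ?I s x)"
      by (rule integrable_mult_right) (rule i)
    show "?I t \<in> borel_measurable lborel"
      unfolding e using m0 i by (intro borel_measurable_times) auto
    show "AE x in lborel. norm (?I t x) \<le> norm (of_real C * ?I s x)"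
    proof (rule AE_I2)
      fix x :: real
      show "norm (?I t x) \<le> norm (of_real C * ?I s x)"
      proof (cases "x > 0 \<and> g x \<noteq> 0")
        case True
        hence "x powr (Re t - Re s) \<le> C" using C by blast
        hence "norm (complex_of_real x powr (t - s)) \<le> \<bar>C\<bar>"
          using True by (simp add: norm_powr_real_powr)
        thus ?thesis unfolding e[of x] norm_mult using True by (intro mult_right_mono) auto
      qed auto
    qed
  qed
  thus ?thesis by (simp add: mellin_integrable_def set_integrable_def)
qed

lemma mellin_integrable_below:
  assumes g: "mellin_integrable g s" and v: "\<exists>a>0. \<forall>x. 0 < x \<and> x < a \<longrightarrow> g x = 0" and t: "Re t \<le> Re s"
  shows "mellin_integrable g t"
proof -
  obtain a where a: "a > 0" "\<forall>x. 0 < x \<and> x < a \<longrightarrow> g x = 0" using v by blast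
  show ?thesis
  proof (rule mellin_integrable_bounded_weight[OF g])
    fix x :: real assume "x > 0" "g x \<noteq> 0"
    hence "a \<le> x" using a by force
    thus "x powr (Re t - Re s) \<le> a powr (Re t - Re s)" using a t by (intro powr_mono2') auto
  qed
qed

lemma mellin_integrable_above:
  assumes g: "mellin_integrable g s" and v: "\<exists>b>0. \<forall>x. x > b \<longrightarrow> g x = 0" and t: "Re t \<ge> Re s"
  shows "mellin_integrable g t"
proof -
  obtain b where b: "b > 0" "\<forall>x. x > b \<longrightarrow> g x = 0" using v by blast
  show ?thesis
  proof (rule mellin_integrable_bounded_weight[OF g])
    fix x :: real assume "x > 0" "g x \<noteq> 0"
    moreover from this have "x \<le> b" using b by force
    ultimately show "x powr (Re t - Re s) \<le> b powr (Re t - Re s)" using t by (intro powr_mono2) auto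
  qed
qed

lemma mellin_test_fun_holomorphic:
  assumes "f \<in> test_funs" shows "mellin f holomorphic_on A"
  unfolding holomorphic_on_def
proof (rule ballI, rule field_differentiable_at_within)
  fix s :: complex
  show "mellin f field_differentiable at s"
    by (rule mellin_differentiable[of _ "Re s - 1" "Re s + 1"]) (auto intro: mellin_integrable_test_fun assms)
qed

text \<open>The two strips may be disjoint, so the symbols cannot be compared directly. On \<Omega>
  the transform G of the image is a single holomorphic function, and m1 F = G = m2 F holds there off
  a sparse set, where F is the transform of f. As F is entire and not identically zero, m1 and m2
  agree off a sparse set of the plane.\<close>

lemma symbol_unique:
  assumes f: "f \<in> test_funs" "mellin f z0 \<noteq> 0"
    and m: "m1 meromorphic_on UNIV" "m2 meromorphic_on UNIV"
    and mult: "mellin_multiplier A m1 {s. a1 < Re s \<and> Re s < b1}" "mellin_multiplier A m2 {s. a2 < Re s \<and> Re s < b2}"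
    and ab: "a1 < b1" "a2 < b2"
    and \<Omega>: "open \<Omega>" "connected \<Omega>" "{s. a1 < Re s \<and> Re s < b1} \<subseteq> \<Omega>" "{s. a2 < Re s \<and> Re s < b2} \<subseteq> \<Omega>"
    and int: "\<And>s. s \<in> \<Omega> \<Longrightarrow> mellin (A f) field_differentiable at s"
  shows "eventually (\<lambda>s. m1 s = m2 s) (cosparse UNIV)"
proof -
  define F where "F = mellin f"
  define G where "G = mellin (A f)"
  have Fm: "F meromorphic_on B" for B
    unfolding F_def using mellin_test_fun_holomorphic[OF f(1), of UNIV]
    by (intro analytic_on_imp_meromorphic_on analytic_on_subset[OF analytic_on_open[THEN iffD2, of UNIV]]) auto
  have "G holomorphic_on \<Omega>"
    unfolding holomorphic_on_def G_def by (rule ballI, rule field_differentiable_at_within, rule int)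
  hence Gm: "G meromorphic_on \<Omega>"
    using \<Omega>(1) by (intro analytic_on_imp_meromorphic_on) (simp add: analytic_on_open)
  have strip: "eventually (\<lambda>s. m s * F s - G s = 0) (cosparse \<Omega>)"
    if "m meromorphic_on UNIV" "mellin_multiplier A m {s. a < Re s \<and> Re s < b}" "a < b" "{s. a < Re s \<and> Re s < b} \<subseteq> \<Omega>" for m a b
  proof (rule meromorphic_eq_zero_cosparse[OF _ \<Omega>(1,2)])
    show "(\<lambda>s. m s * F s - G s) meromorphic_on \<Omega>"
      by (intro meromorphic_intros Fm Gm meromorphic_on_subset[OF that(1)]) auto
    let ?z = "complex_of_real ((a + b) / 2)"
    have z: "?z \<in> {s. a < Re s \<and> Re s < b}" using that(3) by (simp add: field_simps)
    show "?z \<in> \<Omega>" using z that(4) by blast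
    have "open {s. a < Re s \<and> Re s < b}"
      by (intro open_Collect_conj open_Collect_less continuous_intros)
    hence "eventually (\<lambda>s. s \<in> {s. a < Re s \<and> Re s < b}) (at ?z)"
      using z by (intro eventually_at_in_open') auto
    thus "eventually (\<lambda>s. m s * F s - G s = 0) (at ?z)"
    proof eventually_elim
      case (elim s)
      thus ?case using that(2) f(1) unfolding mellin_multiplier_def F_def G_def by auto
    qed
  qed
  let ?z = "complex_of_real ((a1 + b1) / 2)"
  have z: "?z \<in> \<Omega>" using \<Omega>(3) ab(1) by (auto simp: field_simps intro!: subsetD[OF \<Omega>(3)])
  have "eventually (\<lambda>s. m1 s * F s - G s = 0) (at ?z)" "eventually (\<lambda>s. m2 s * F s - G s = 0) (at ?z)"
    using strip[OF m(1) mult(1) ab(1) \<Omega>(3)] strip[OF m(2) mult(2) ab(2) \<Omega>(4)] z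
    by (auto intro: eventually_cosparse_imp_eventually_at)
  hence "eventually (\<lambda>s. (m1 s - m2 s) * F s = 0) (at ?z)"
    by eventually_elim (simp add: algebra_simps)
  hence 1: "eventually (\<lambda>s. (m1 s - m2 s) * F s = 0) (cosparse UNIV)"
    by (intro meromorphic_eq_zero_cosparse[of _ _ ?z] meromorphic_intros Fm m) auto
  have "eventually (\<lambda>s. F s \<noteq> 0) (cosparse UNIV)"
  proof -
    have "(\<forall>\<^sub>\<approx>x\<in>UNIV. F x = 0) \<or> (\<forall>\<^sub>\<approx>x\<in>UNIV. F x \<noteq> 0)"
      by (rule meromorphic_imp_constant_or_avoid) (auto intro: Fm)
    moreover have "\<not> (\<forall>\<^sub>\<approx>x\<in>UNIV. F x = 0)"
    proof
      assume "\<forall>\<^sub>\<approx>x\<in>UNIV. F x = 0"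
      hence "eventually (\<lambda>x. F x = 0) (at z0)" by (rule eventually_cosparse_imp_eventually_at) auto
      hence "(F \<longlongrightarrow> 0) (at z0)" by (rule tendsto_eventually)
      moreover have "isCont F z0"
        using mellin_test_fun_holomorphic[OF f(1), of UNIV] unfolding F_def
        by (auto dest!: holomorphic_on_imp_continuous_on simp: continuous_on_eq_continuous_at)
      ultimately have "F z0 = 0" unfolding isCont_def by (rule LIM_unique[rotated])
      thus False using f(2) by (simp add: F_def)
    qed
    ultimately show ?thesis by blast
  qed
  with 1 show ?thesis by eventually_elim simp
qed

text \<open>If the image vanishes near 0, integrability at one point spreads to everything on its
  left, so \<Omega> can be the half-plane to the left of the greater right edge of the two strips.
  If it vanishes near infinity, the mirror image is used.\<close>

lemma mellin_symbol_eq: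
  assumes f: "f \<in> test_funs" "mellin f z0 \<noteq> 0"
    and m: "m meromorphic_on UNIV" "mellin_multiplier A m {s. a < Re s \<and> Re s < b}" "a < b"
    and v: "(\<exists>c>0. \<forall>x. 0 < x \<and> x < c \<longrightarrow> A f x = 0) \<or> (\<exists>c>0. \<forall>x. x > c \<longrightarrow> A f x = 0)"
  shows "eventually (\<lambda>s. mellin_symbol A s = m s) (cosparse UNIV)"
proof -
  \<comment> \<open>The known symbol m witnesses that the choice in \<open>mellin_symbol\<close> is
    inhabited; afterwards only the defining property of the chosen function is used.\<close>
  have "mellin_symbol A meromorphic_on UNIV \<and> (\<exists>a b. a < b \<and> mellin_multiplier A (mellin_symbol A) {s. a < Re s \<and> Re s < b})"
    unfolding mellin_symbol_def by (rule someI[of _ m]) (use m in blast)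
  then obtain a' b' where m': "mellin_symbol A meromorphic_on UNIV" "a' < b'"
    "mellin_multiplier A (mellin_symbol A) {s. a' < Re s \<and> Re s < b'}" by blast
  have I: "mellin_integrable (A f) (of_real r)" if "a < r \<and> r < b \<or> a' < r \<and> r < b'" for r
    using that m(2) m'(3) f(1) unfolding mellin_multiplier_def by auto
  from v show ?thesis
  proof
    assume v: "\<exists>c>0. \<forall>x. 0 < x \<and> x < c \<longrightarrow> A f x = 0"
    have J: "mellin_integrable (A f) (of_real r)" if r: "r < max b b'" for r
    proof -
      obtain q where q: "r \<le> q" "a < q \<and> q < b \<or> a' < q \<and> q < b'"
      proof (cases "r < b")
        case True
        obtain q where "max a r < q" "q < b" using dense[of "max a r" b] True m(3) by auto
        thus ?thesis by (intro that[of q]) auto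
      next
        case False
        hence "r < b'" using r by auto
        obtain q where "max a' r < q" "q < b'" using dense[of "max a' r" b'] \<open>r < b'\<close> m'(2) by auto
        thus ?thesis by (intro that[of q]) auto
      qed
      show ?thesis by (rule mellin_integrable_below[OF I[OF q(2)] v]) (use q in auto)
    qed
    show ?thesis
    proof (rule symbol_unique[OF f m'(1) m(1) m'(3) m(2) m'(2) m(3)])
      show "open {s. Re s < max b b'}" "connected {s. Re s < max b b'}"
        by (auto intro: open_halfspace_Re_lt convex_connected convex_halfspace_Re_lt)
      fix s assume "s \<in> {s. Re s < max b b'}"
      hence s: "Re s < max b b'" by simp
      obtain r where "Re s < r" "r < max b b'" using dense[OF s] by blast
      thus "mellin (A f) field_differentiable at s"
        by (intro mellin_differentiable[of _ "Re s - 1" r] J) auto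
    qed auto
  next
    assume v: "\<exists>c>0. \<forall>x. x > c \<longrightarrow> A f x = 0"
    have J: "mellin_integrable (A f) (of_real r)" if r: "r > min a a'" for r
    proof -
      obtain q where q: "q \<le> r" "a < q \<and> q < b \<or> a' < q \<and> q < b'"
      proof (cases "r > a")
        case True
        obtain q where "a < q" "q < min b r" using dense[of a "min b r"] True m(3) by auto
        thus ?thesis by (intro that[of q]) auto
      next
        case False
        hence "r > a'" using r by auto
        obtain q where "a' < q" "q < min b' r" using dense[of a' "min b' r"] \<open>r > a'\<close> m'(2) by auto
        thus ?thesis by (intro that[of q]) auto
      qed
      show ?thesis by (rule mellin_integrable_above[OF I[OF q(2)] v]) (use q in auto)
    qed
    show ?thesis
    proof (rule symbol_unique[OF f m'(1) m(1) m'(3) m(2) m'(2) m(3)])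
      show "open {s. Re s > min a a'}" "connected {s. Re s > min a a'}"
        by (auto intro: open_halfspace_Re_gt convex_connected convex_halfspace_Re_gt)
      fix s assume "s \<in> {s. Re s > min a a'}"
      hence s: "min a a' < Re s" by simp
      obtain r where "min a a' < r" "r < Re s" using dense[OF s] by blast
      thus "mellin (A f) field_differentiable at s"
        by (intro mellin_differentiable[of _ r "Re s + 1"] J) auto
    qed auto
  qed
qed

text \<open>The exceptional set has no limit point, hence is countable, and so is its trace on the
  line.\<close>

lemma cosparse_imp_AE_line:
  assumes "eventually P (cosparse (UNIV :: complex set))"
  shows "AE \<xi> in lborel. P (Complex a \<xi>)"
proof -
  have "{s. \<not> P s} sparse_in UNIV" using assms by (simp add: eventually_cosparse)
  hence "\<not> x islimpt {s. \<not> P s}" for x by (simp add: sparse_in_open)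
  hence "countable {s. \<not> P s}" by (intro no_limpt_imp_countable)
  moreover have "{\<xi>. \<not> P (Complex a \<xi>)} \<subseteq> Im ` {s. \<not> P s}"
    by (auto intro: image_eqI[of _ _ "Complex a _"])
  ultimately have c: "countable {\<xi>. \<not> P (Complex a \<xi>)}"
    by (meson countable_image countable_subset)
  have "{\<xi>. \<not> P (Complex a \<xi>)} \<in> null_sets lborel"
    by (rule countable_imp_null_set_lborel[OF c])
  thus ?thesis by (intro AE_I') auto
qed

section \<open>Smooth bump functions\<close>

text \<open>A test function comes with the whole sequence of its derivatives. In a set closed under
  differentiation the sequence arises by iterating a choice of derivative.\<close>

lemma test_funs_coinduct:
  assumes f: "f \<in> S" and S: "\<And>g. g \<in> S \<Longrightarrow> \<exists>h\<in>S. \<forall>x. (g has_vector_derivative h x) (at x)"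
    and supp: "0 < a" "a < b" "\<And>x. x \<notin> {a..b} \<Longrightarrow> f x = 0"
  shows "f \<in> test_funs"
proof -
  obtain d where d: "\<forall>g\<in>S. d g \<in> S \<and> (\<forall>x. (g has_vector_derivative d g x) (at x))"
    using S by metis
  define D where "D = (\<lambda>n. (d ^^ n) f)"
  have mem: "D n \<in> S" for n by (induction n) (use f d in \<open>auto simp: D_def\<close>)
  have "(D n has_vector_derivative D (Suc n) x) (at x)" for n x
    using mem[of n] d by (simp add: D_def)
  moreover have "D 0 = f" by (simp add: D_def)
  ultimately show ?thesis unfolding test_funs_def using supp by blast
qed

text \<open>For j = 0 the classical function that is flat at 0; the negative powers of t are those
  produced by differentiating it.\<close>

definition flat_exp :: "nat \<Rightarrow> real \<Rightarrow> real" where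
  "flat_exp j t = (if t > 0 then exp (- 1 / t) / t ^ j else 0)"

lemma flat_exp_tendsto_0: "(flat_exp j \<longlongrightarrow> 0) (at 0)"
proof -
  have "((\<lambda>t::real. exp (- 1 / t) / t ^ j) \<longlongrightarrow> 0) (at_right 0)"
  proof -
    have "((\<lambda>u::real. u ^ j / exp u) \<longlongrightarrow> 0) at_top" by (rule tendsto_power_div_exp_0)
    hence "((\<lambda>t::real. inverse t ^ j / exp (inverse t)) \<longlongrightarrow> 0) (at_right 0)"
      by (rule filterlim_compose[OF _ filterlim_inverse_at_top_right])
    thus ?thesis by (simp add: exp_minus field_simps)
  qed
  hence "(flat_exp j \<longlongrightarrow> 0) (at_right 0)"
    by (rule Lim_transform_eventually) (auto simp: flat_exp_def eventually_at_right_field intro!: exI[of _ 1])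
  moreover have "(flat_exp j \<longlongrightarrow> 0) (at_left 0)"
    by (rule tendsto_eventually) (auto simp: flat_exp_def eventually_at_left_field intro!: exI[of _ "-1"])
  ultimately show ?thesis by (simp add: filterlim_split_at)
qed

lemma flat_exp_deriv:
  "(flat_exp j has_real_derivative (flat_exp (j + 2) t - real j * flat_exp (j + 1) t)) (at t)"
proof -
  consider "t > 0" | "t < 0" | "t = 0" by linarith
  thus ?thesis
  proof cases
    case 1
    have "((\<lambda>t. exp (- 1 / t) / t ^ j) has_real_derivative
       (exp (- 1 / t) * (1 / t\<^sup>2) * t ^ j - exp (- 1 / t) * (real j * t ^ (j - 1))) / (t ^ j * t ^ j)) (at t)"
      using 1 by (auto intro!: derivative_eq_intros simp: power2_eq_square)
    also have "(exp (- 1 / t) * (1 / t\<^sup>2) * t ^ j - exp (- 1 / t) * (real j * t ^ (j - 1))) / (t ^ j * t ^ j)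
       = flat_exp (j + 2) t - real j * flat_exp (j + 1) t"
      using 1 by (cases j) (auto simp: flat_exp_def divide_simps power_add power2_eq_square algebra_simps)
    finally have "((\<lambda>t. exp (- 1 / t) / t ^ j) has_real_derivative (flat_exp (j + 2) t - real j * flat_exp (j + 1) t)) (at t)" .
    thus ?thesis
      by (rule has_field_derivative_transform_within_open[where S = "{0<..}"]) (use 1 in \<open>auto simp: flat_exp_def\<close>)
  next
    case 2
    have "((\<lambda>_. 0) has_real_derivative (flat_exp (j + 2) t - real j * flat_exp (j + 1) t)) (at t)"
      using 2 by (simp add: flat_exp_def)
    thus ?thesis
      by (rule has_field_derivative_transform_within_open[where S = "{..<0}"]) (use 2 in \<open>auto simp: flat_exp_def\<close>)
  next
    case 3
    have "(flat_exp (j + 1) \<longlongrightarrow> 0) (at 0)" by (rule flat_exp_tendsto_0)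
    \<comment> \<open>At 0 the difference quotient is again a member of the family, so its limit is
      already known.\<close>
    moreover have "flat_exp (j + 1) = (\<lambda>h. (flat_exp j (0 + h) - flat_exp j 0) / h)"
      by (rule ext) (simp add: flat_exp_def)
    ultimately have "((\<lambda>h. (flat_exp j (0 + h) - flat_exp j 0) / h) \<longlongrightarrow> 0) (at 0)" by simp
    thus ?thesis using 3 by (simp add: DERIV_def flat_exp_def[of "j + 2"] flat_exp_def[of "j + 1"] flat_exp_def[of "Suc _"] flat_exp_def[of "Suc (Suc _)"])
  qed
qed

text \<open>
  \<open>x powr \<alpha> * \<psi> (ln x / n)\<close> for a bump \<open>\<psi>\<close> on \<open>[0, 1]\<close>. The indices \<open>j\<close>, \<open>k\<close> (both 0 for the functions that
  are needed) close the family under differentiation up to linear combinations.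
\<close>
definition log_bump :: "nat \<Rightarrow> complex \<Rightarrow> nat \<Rightarrow> nat \<Rightarrow> real \<Rightarrow> complex" where
  "log_bump n \<alpha> j k x = (if x > 0 then of_real x powr \<alpha> * of_real (flat_exp j (ln x / n) * flat_exp k (1 - ln x / n)) else 0)"

text \<open>The scale n is fixed, while \<alpha> varies within the span because each differentiation
  lowers it by one.\<close>

inductive_set log_bump_span :: "nat \<Rightarrow> (real \<Rightarrow> complex) set" for n where
  base: "log_bump n \<alpha> j k \<in> log_bump_span n"
| add: "g \<in> log_bump_span n \<Longrightarrow> h \<in> log_bump_span n \<Longrightarrow> (\<lambda>x. g x + h x) \<in> log_bump_span n"
| scale: "g \<in> log_bump_span n \<Longrightarrow> (\<lambda>x. c * g x) \<in> log_bump_span n"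

text \<open>The inner derivative of ln x / n is 1 / (n x). Its factor 1 / x lowers the exponent, and
  the remaining four terms come from the derivatives of the two flat factors.\<close>

lemma log_bump_deriv:
  assumes n: "n > 0"
  shows "(log_bump n \<alpha> j k has_vector_derivative
    (\<alpha> * log_bump n (\<alpha> - 1) j k x
      + ((1 / of_nat n) * log_bump n (\<alpha> - 1) (j + 2) k x
      + ((- of_nat j / of_nat n) * log_bump n (\<alpha> - 1) (j + 1) k x
      + ((- 1 / of_nat n) * log_bump n (\<alpha> - 1) j (k + 2) x
      + (of_nat k / of_nat n) * log_bump n (\<alpha> - 1) j (k + 1) x))))) (at x)"
proof (cases "x > 0")
  case True
  define u where "u = ln x / n"
  define B where "B = (\<lambda>x. flat_exp j (ln x / n) * flat_exp k (1 - ln x / n))"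
  define B' where "B' = (flat_exp (j + 2) u - real j * flat_exp (j + 1) u) * (1 / x / n) * flat_exp k (1 - u)
      + (flat_exp (k + 2) (1 - u) - real k * flat_exp (k + 1) (1 - u)) * (- (1 / x / n)) * flat_exp j u"
  have lnd: "((\<lambda>x. ln x / n) has_real_derivative 1 / x / n) (at x)"
    using True n by (auto intro!: derivative_eq_intros)
  have lnd': "((\<lambda>x. 1 - ln x / n) has_real_derivative - (1 / x / n)) (at x)"
    using True n by (auto intro!: derivative_eq_intros)
  have 1: "((\<lambda>x. flat_exp j (ln x / n)) has_real_derivative (flat_exp (j + 2) u - real j * flat_exp (j + 1) u) * (1 / x / n)) (at x)"
    unfolding u_def by (rule DERIV_chain2[where f = "flat_exp j" and g = "\<lambda>x. ln x / n", OF flat_exp_deriv lnd])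
  have 2: "((\<lambda>x. flat_exp k (1 - ln x / n)) has_real_derivative (flat_exp (k + 2) (1 - u) - real k * flat_exp (k + 1) (1 - u)) * (- (1 / x / n))) (at x)"
    unfolding u_def by (rule DERIV_chain2[where f = "flat_exp k" and g = "\<lambda>x. 1 - ln x / n", OF flat_exp_deriv lnd'])
  have "(B has_real_derivative B') (at x)"
    unfolding B_def B'_def u_def using DERIV_mult[OF 1 2] by (simp add: u_def)
  hence B: "((\<lambda>x. complex_of_real (B x)) has_vector_derivative of_real B') (at x)"
    by (simp add: has_vector_derivative_of_real has_real_derivative_iff_has_vector_derivative)
  have P: "((\<lambda>x. complex_of_real x powr \<alpha>) has_vector_derivative \<alpha> * of_real x powr (\<alpha> - 1)) (at x)"
    using True by (rule has_vector_derivative_of_real_powr)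
  have D: "((\<lambda>x. of_real x powr \<alpha> * of_real (B x)) has_vector_derivative
     (of_real x powr \<alpha> * of_real B' + \<alpha> * of_real x powr (\<alpha> - 1) * of_real (B x))) (at x)"
    by (rule has_vector_derivative_mult[OF P B])
  have pw: "complex_of_real x powr \<alpha> = of_real x * of_real x powr (\<alpha> - 1)"
    using True powr_add[of "complex_of_real x" 1 "\<alpha> - 1"] by simp
  have "of_real x powr \<alpha> * of_real B' + \<alpha> * of_real x powr (\<alpha> - 1) * of_real (B x) =
    (\<alpha> * log_bump n (\<alpha> - 1) j k x
      + ((1 / of_nat n) * log_bump n (\<alpha> - 1) (j + 2) k x
      + ((- of_nat j / of_nat n) * log_bump n (\<alpha> - 1) (j + 1) k x
      + ((- 1 / of_nat n) * log_bump n (\<alpha> - 1) j (k + 2) x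
      + (of_nat k / of_nat n) * log_bump n (\<alpha> - 1) j (k + 1) x))))"
  proof -
    define p where "p = complex_of_real x powr (\<alpha> - 1)"
    have lb: "log_bump n (\<alpha> - 1) i l x = p * of_real (flat_exp i u * flat_exp l (1 - u))" for i l
      using True by (simp add: log_bump_def p_def u_def)
    have Bx: "B x = flat_exp j u * flat_exp k (1 - u)" by (simp add: B_def u_def)
    have xB: "x * B' = (flat_exp (j + 2) u - real j * flat_exp (j + 1) u) * flat_exp k (1 - u) / n
       - (flat_exp (k + 2) (1 - u) - real k * flat_exp (k + 1) (1 - u)) * flat_exp j u / n"
      using True n unfolding B'_def by (simp add: field_simps)
    have "of_real x powr \<alpha> * of_real B' = p * complex_of_real (x * B')"
      by (simp add: pw p_def)
    thus ?thesis unfolding lb Bx xB p_def[symmetric] using n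
      by (simp add: add_divide_distrib diff_divide_distrib algebra_simps)
  qed
  with D have "((\<lambda>x. of_real x powr \<alpha> * of_real (B x)) has_vector_derivative
    (\<alpha> * log_bump n (\<alpha> - 1) j k x
      + ((1 / of_nat n) * log_bump n (\<alpha> - 1) (j + 2) k x
      + ((- of_nat j / of_nat n) * log_bump n (\<alpha> - 1) (j + 1) k x
      + ((- 1 / of_nat n) * log_bump n (\<alpha> - 1) j (k + 2) x
      + (of_nat k / of_nat n) * log_bump n (\<alpha> - 1) j (k + 1) x))))) (at x)" by simp
  thus ?thesis
    by (rule has_vector_derivative_transform_within_open[of _ _ _ "{0<..}"])
       (use True in \<open>auto simp: log_bump_def B_def\<close>)
next
  case False
  \<comment> \<open>The function vanishes for all y < 1, so every x \<le> 0 has a neighbourhood on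
    which it is zero.\<close>
  have z: "log_bump n \<beta> i l y = 0" if "y < 1" for \<beta> i l y
  proof (cases "y > 0")
    case True
    hence "ln y < 0" using that by simp
    hence "ln y / n < 0" using n by (simp add: divide_neg_pos)
    thus ?thesis by (simp add: log_bump_def flat_exp_def)
  qed (simp add: log_bump_def)
  have "((\<lambda>_. 0) has_vector_derivative 0) (at x)" by simp
  hence "(log_bump n \<alpha> j k has_vector_derivative 0) (at x)"
    by (rule has_vector_derivative_transform_within_open[of _ _ _ "{..<1}"]) (use False z in auto)
  thus ?thesis using z False by simp
qed

lemma log_bump_test_fun:
  assumes n: "n > 0" shows "log_bump n \<alpha> j k \<in> test_funs"
proof (rule test_funs_coinduct)
  show "log_bump n \<alpha> j k \<in> log_bump_span n" by (rule log_bump_span.base)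
  show "\<exists>h\<in>log_bump_span n. \<forall>x. (g has_vector_derivative h x) (at x)" if "g \<in> log_bump_span n" for g
    using that
  proof induction
    case (base \<alpha> j k)
    let ?h = "\<lambda>x. \<alpha> * log_bump n (\<alpha> - 1) j k x
      + ((1 / of_nat n) * log_bump n (\<alpha> - 1) (j + 2) k x
      + ((- of_nat j / of_nat n) * log_bump n (\<alpha> - 1) (j + 1) k x
      + ((- 1 / of_nat n) * log_bump n (\<alpha> - 1) j (k + 2) x
      + (of_nat k / of_nat n) * log_bump n (\<alpha> - 1) j (k + 1) x)))"
    have "?h \<in> log_bump_span n"
      by (rule log_bump_span.add log_bump_span.scale log_bump_span.base)+
    thus ?case using log_bump_deriv[OF n] by (intro bexI[of _ ?h]) blast+
  next
    case (add g h)
    then obtain g' h' where "g' \<in> log_bump_span n" "h' \<in> log_bump_span n"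
      "\<forall>x. (g has_vector_derivative g' x) (at x)" "\<forall>x. (h has_vector_derivative h' x) (at x)" by blast
    thus ?case by (intro bexI[of _ "\<lambda>x. g' x + h' x"]) (auto intro: log_bump_span.add has_vector_derivative_add)
  next
    case (scale g c)
    then obtain g' where "g' \<in> log_bump_span n" "\<forall>x. (g has_vector_derivative g' x) (at x)" by blast
    thus ?case by (intro bexI[of _ "\<lambda>x. c * g' x"]) (auto intro: log_bump_span.scale has_vector_derivative_mult_right)
  qed
  show "0 < (1 / 2 :: real)" "1 / 2 < exp (real n)" using order_less_le_trans[of "1 / 2" 1 "exp (real n)"] by auto
  fix x assume "x \<notin> {1 / 2..exp (real n)}"
  hence x: "x < 1 / 2 \<or> x > exp (real n)" by auto
  show "log_bump n \<alpha> j k x = 0"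
  proof (cases "x > 0")
    case True
    from x show ?thesis
    proof
      assume "x < 1 / 2"
      hence "ln x < 0" using True by simp
      hence "ln x / n < 0" using n by (simp add: divide_neg_pos)
      thus ?thesis by (simp add: log_bump_def flat_exp_def)
    next
      assume "x > exp (real n)"
      hence "ln x > n" using True by (metis exp_gt_zero ln_exp ln_less_cancel_iff)
      hence "ln x / n > 1" using n by simp
      thus ?thesis by (simp add: log_bump_def flat_exp_def)
    qed
  qed (simp add: log_bump_def)
qed

section \<open>Plancherel on the critical line\<close>

context
  fixes g :: "real \<Rightarrow> complex" and R :: real
  assumes cont: "continuous_on UNIV g" and supp: "\<And>t. t \<notin> {-R..R} \<Longrightarrow> g t = 0"
begin

definition fourier :: "real \<Rightarrow> complex" where
  "fourier \<xi> = (LBINT t. iexp (\<xi> * t) * g t)"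

text \<open>Its Fourier transform is the squared modulus of \<open>fourier\<close>, and its value at
  0 is the energy of g.\<close>

definition autocorrelation :: "real \<Rightarrow> complex" where
  "autocorrelation w = (LBINT u. g (u + w) * cnj (g u))"

private lemma meas [measurable]: "g \<in> borel_measurable borel"
  using cont by (rule borel_measurable_continuous_onI)

private lemma cnj_meas [measurable]: "cnj \<in> borel_measurable borel"
  by (intro borel_measurable_continuous_onI continuous_intros)

private lemma g_int: "integrable lborel g"
proof -
  have "set_integrable lborel {-R..R} g"
    by (rule borel_integrable_atLeastAtMost') (rule continuous_on_subset[OF cont], simp)
  moreover have "(\<lambda>t. indicator {-R..R} t *\<^sub>R g t) = g" using supp by (auto simp: indicator_def fun_eq_iff)
  ultimately show ?thesis by (simp add: set_integrable_def)
qed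

private lemma g_bounded: "\<exists>M. 0 \<le> M \<and> (\<forall>t. norm (g t) \<le> M)"
proof -
  have "bounded (g ` {-R..R})"
    by (intro compact_imp_bounded compact_continuous_image continuous_on_subset[OF cont]) auto
  then obtain M where "\<forall>t\<in>{-R..R}. norm (g t) \<le> M" by (auto simp: bounded_iff)
  hence "norm (g t) \<le> \<bar>M\<bar>" for t using supp[of t] by (cases "t \<in> {-R..R}") force+
  thus ?thesis by (intro exI[of _ "\<bar>M\<bar>"]) auto
qed

text \<open>By translation invariance the inner integral of the modulus is the L1 norm of g times |g
  u|. The case \<xi> = 0 yields integrability of the autocorrelation.\<close>

private lemma kernel_int: "integrable (lborel \<Otimes>\<^sub>M lborel) (\<lambda>(u, w). iexp (\<xi> * w) * (g (u + w) * cnj (g u)))"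
proof (rule lborel_pair.Fubini_integrable)
  have i: "integrable lborel (\<lambda>w. norm (g (u + w)))" for u
    using lborel_integrable_real_affine[OF integrable_norm[OF g_int], of 1 u] by simp
  have e: "(LBINT w. norm (g (u + w))) = (LBINT w. norm (g w))" for u
    using lborel_integral_real_affine[of 1 "\<lambda>w. norm (g w)" u] by simp
  show "(\<lambda>(u, w). iexp (\<xi> * w) * (g (u + w) * cnj (g u))) \<in> borel_measurable (lborel \<Otimes>\<^sub>M lborel)"
    by measurable
  have "(LBINT w. norm (case (u, w) of (u, w) \<Rightarrow> iexp (\<xi> * w) * (g (u + w) * cnj (g u)))) =
      (LBINT w. norm (g w)) * norm (g u)" for u
    by (simp add: norm_mult e)
  thus "integrable lborel (\<lambda>u. LBINT w. norm (case (u, w) of (u, w) \<Rightarrow> iexp (\<xi> * w) * (g (u + w) * cnj (g u))))"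
    using g_int by simp
  show "AE u in lborel. integrable lborel (\<lambda>w. case (u, w) of (u, w) \<Rightarrow> iexp (\<xi> * w) * (g (u + w) * cnj (g u)))"
  proof (rule AE_I2)
    fix u
    have "integrable lborel (\<lambda>w. norm (g (u + w)) * norm (g u))"
      using i[of u] by simp
    thus "integrable lborel (\<lambda>w. case (u, w) of (u, w) \<Rightarrow> iexp (\<xi> * w) * (g (u + w) * cnj (g u)))"
      by (rule Bochner_Integration.integrable_bound) (auto simp: norm_mult)
  qed
qed

private lemma autocorrelation_int: "integrable lborel autocorrelation"
  using lborel_pair.integrable_snd[OF kernel_int[of 0]] unfolding autocorrelation_def[abs_def] by simp

private lemma autocorrelation_meas [measurable]: "autocorrelation \<in> borel_measurable borel"
  using autocorrelation_int by (simp add: borel_measurable_integrable)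

private lemma fourier_meas [measurable]: "fourier \<in> borel_measurable borel"
  unfolding fourier_def[abs_def] by measurable

text \<open>After the exchange of integrals, the translation t = u + w splits the double integral
  into the transform and its conjugate.\<close>

private lemma fourier_autocorrelation:
  "fourier \<xi> * cnj (fourier \<xi>) = (LBINT w. iexp (\<xi> * w) * autocorrelation w)"
proof -
  have "(LBINT w. iexp (\<xi> * w) * autocorrelation w) = (LBINT w. LBINT u. iexp (\<xi> * w) * (g (u + w) * cnj (g u)))"
    unfolding autocorrelation_def by simp
  also have "\<dots> = (LBINT u. LBINT w. iexp (\<xi> * w) * (g (u + w) * cnj (g u)))"
    by (rule lborel_pair.Fubini_integral[OF kernel_int])
  also have "\<dots> = (LBINT u. fourier \<xi> * cnj (iexp (\<xi> * u) * g u))"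
  proof (intro Bochner_Integration.integral_cong refl)
    fix u
    have "fourier \<xi> = (LBINT w. iexp (\<xi> * (u + w)) * g (u + w))"
      unfolding fourier_def using lborel_integral_real_affine[of 1 "\<lambda>t. iexp (\<xi> * t) * g t" u] by simp
    also have "\<dots> = (LBINT w. iexp (\<xi> * u) * (iexp (\<xi> * w) * g (u + w)))"
      by (intro Bochner_Integration.integral_cong refl) (simp add: exp_add[symmetric] distrib_left mult.assoc[symmetric])
    also have "\<dots> = iexp (\<xi> * u) * (LBINT w. iexp (\<xi> * w) * g (u + w))"
      by (rule integral_mult_right_zero)
    finally have F: "fourier \<xi> = iexp (\<xi> * u) * (LBINT w. iexp (\<xi> * w) * g (u + w))" .
    have one: "iexp (\<xi> * u) * cnj (iexp (\<xi> * u)) = 1"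
      by (metis complex_norm_square norm_exp_i_times of_real_1 power_one)
    have "(LBINT w. iexp (\<xi> * w) * (g (u + w) * cnj (g u))) = (LBINT w. (iexp (\<xi> * w) * g (u + w)) * cnj (g u))"
      by (simp add: mult_ac)
    also have "\<dots> = (LBINT w. iexp (\<xi> * w) * g (u + w)) * cnj (g u)"
      by (rule integral_mult_left_zero)
    also have "\<dots> = (iexp (\<xi> * u) * cnj (iexp (\<xi> * u))) * ((LBINT w. iexp (\<xi> * w) * g (u + w)) * cnj (g u))"
      unfolding one by simp
    also have "\<dots> = fourier \<xi> * cnj (iexp (\<xi> * u) * g u)"
      unfolding F complex_cnj_mult by (simp only: mult_ac)
    finally show "(LBINT w. iexp (\<xi> * w) * (g (u + w) * cnj (g u))) = fourier \<xi> * cnj (iexp (\<xi> * u) * g u)" .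
  qed
  also have "\<dots> = fourier \<xi> * (LBINT u. cnj (iexp (\<xi> * u) * g u))"
    by (rule integral_mult_right_zero)
  also have "(LBINT u. cnj (iexp (\<xi> * u) * g u)) = cnj (fourier \<xi>)"
    unfolding fourier_def
    by (rule integral_bounded_linear[OF bounded_linear_cnj], rule Bochner_Integration.integrable_bound[OF g_int])
      (auto simp: norm_mult)
  finally show ?thesis ..
qed

private lemma fourier_bounded: "norm (fourier \<xi>) \<le> (LBINT t. norm (g t))"
  unfolding fourier_def using integral_norm_bound[of lborel "\<lambda>t. iexp (\<xi> * t) * g t"] by (simp add: norm_mult)

private lemma gaussian_int: "integrable lborel (\<lambda>v::real. exp (- v\<^sup>2 / 2))"
  "(LBINT v. exp (- v\<^sup>2 / 2)) = sqrt (2 * pi)"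
proof -
  have e: "exp (- v\<^sup>2 / 2) = sqrt (2 * pi) * std_normal_density v" for v :: real
    by (simp add: std_normal_density_def)
  show "integrable lborel (\<lambda>v::real. exp (- v\<^sup>2 / 2))" "(LBINT v. exp (- v\<^sup>2 / 2)) = sqrt (2 * pi)"
    unfolding e by simp_all
qed

text \<open>The Gaussian weight makes the integral over \<xi> converge before square integrability
  of the transform is known. The Fourier transform of the Gaussian is taken from the characteristic
  function of the standard normal distribution.\<close>

private lemma regularised_plancherel:
  assumes c: "c > 0"
  shows "(LBINT \<xi>. of_real (exp (- (\<xi> / c)\<^sup>2 / 2)) * (fourier \<xi> * cnj (fourier \<xi>))) =
    of_real (sqrt (2 * pi)) * (LBINT v. of_real (exp (- v\<^sup>2 / 2)) * autocorrelation (v / c))"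
proof -
  interpret N: prob_space std_normal_distribution
    by (rule prob_space_normal_density) simp
  interpret P: pair_sigma_finite std_normal_distribution lborel ..
  have dens: "(LINT v|std_normal_distribution. F v) = (LBINT v. of_real (std_normal_density v) * F v)"
    if "F \<in> borel_measurable borel" for F :: "real \<Rightarrow> complex"
    using that by (subst integral_density) (auto simp: scaleR_conv_of_real)
  have Nint: "integrable (std_normal_distribution \<Otimes>\<^sub>M lborel) (\<lambda>(v, w). iexp (c * v * w) * autocorrelation w)"
  proof (rule P.Fubini_integrable)
    show "(\<lambda>(v, w). iexp (c * v * w) * autocorrelation w) \<in> borel_measurable (std_normal_distribution \<Otimes>\<^sub>M lborel)"
      by measurable
    show "integrable std_normal_distribution (\<lambda>v. LBINT w. norm (case (v, w) of (v, w) \<Rightarrow> iexp (c * v * w) * autocorrelation w))"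
      by (simp add: norm_mult)
    show "AE v in std_normal_distribution. integrable lborel (\<lambda>w. case (v, w) of (v, w) \<Rightarrow> iexp (c * v * w) * autocorrelation w)"
      by (rule AE_I2, rule Bochner_Integration.integrable_bound[OF autocorrelation_int]) (auto simp: norm_mult)
  qed
  have "(LINT v|std_normal_distribution. fourier (c * v) * cnj (fourier (c * v))) =
     (LINT v|std_normal_distribution. (LBINT w. iexp (c * v * w) * autocorrelation w))"
    unfolding fourier_autocorrelation ..
  also have "\<dots> = (LBINT w. (LINT v|std_normal_distribution. iexp (c * v * w) * autocorrelation w))"
    by (rule P.Fubini_integral[OF Nint, symmetric])
  also have "\<dots> = (LBINT w. of_real (exp (- (c * w)\<^sup>2 / 2)) * autocorrelation w)"
  proof (intro Bochner_Integration.integral_cong refl)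
    fix w
    have "(LINT v|std_normal_distribution. iexp (c * v * w) * autocorrelation w) =
        (LINT v|std_normal_distribution. iexp (c * w * v)) * autocorrelation w"
      by (subst integral_mult_left_zero) (simp add: mult_ac)
    also have "(LINT v|std_normal_distribution. iexp (c * w * v)) = char std_normal_distribution (c * w)"
      by (simp add: char_def)
    also have "\<dots> = of_real (exp (- (c * w)\<^sup>2 / 2))"
      by (simp add: char_std_normal_distribution)
    finally show "(LINT v|std_normal_distribution. iexp (c * v * w) * autocorrelation w) = of_real (exp (- (c * w)\<^sup>2 / 2)) * autocorrelation w" .
  qed
  also have "\<dots> = of_real (1 / c) * (LBINT v. of_real (exp (- v\<^sup>2 / 2)) * autocorrelation (v / c))"
    using c lborel_integral_real_affine[of "1 / c" "\<lambda>w. of_real (exp (- (c * w)\<^sup>2 / 2)) * autocorrelation w" 0]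
    by (simp add: scaleR_conv_of_real)
  finally have A: "(LINT v|std_normal_distribution. fourier (c * v) * cnj (fourier (c * v))) =
     of_real (1 / c) * (LBINT v. of_real (exp (- v\<^sup>2 / 2)) * autocorrelation (v / c))" .
  have "(LBINT \<xi>. of_real (exp (- (\<xi> / c)\<^sup>2 / 2)) * (fourier \<xi> * cnj (fourier \<xi>))) =
     of_real c * (LBINT v. of_real (exp (- v\<^sup>2 / 2)) * (fourier (c * v) * cnj (fourier (c * v))))"
    using c lborel_integral_real_affine[of c "\<lambda>\<xi>. of_real (exp (- (\<xi> / c)\<^sup>2 / 2)) * (fourier \<xi> * cnj (fourier \<xi>))" 0]
    by (simp add: scaleR_conv_of_real)
  also have "(LBINT v. of_real (exp (- v\<^sup>2 / 2)) * (fourier (c * v) * cnj (fourier (c * v)))) =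
     (LBINT v. of_real (sqrt (2 * pi)) * (of_real (std_normal_density v) * (fourier (c * v) * cnj (fourier (c * v)))))"
    by (intro Bochner_Integration.integral_cong refl) (simp add: std_normal_density_def)
  also have "\<dots> = of_real (sqrt (2 * pi)) * (LINT v|std_normal_distribution. fourier (c * v) * cnj (fourier (c * v)))"
    by (subst dens) auto
  finally show ?thesis unfolding A using c by simp
qed

private lemma autocorrelation_bounded: "\<exists>B. \<forall>w. norm (autocorrelation w) \<le> B"
proof -
  obtain M where M: "0 \<le> M" "\<forall>t. norm (g t) \<le> M" using g_bounded by blast
  have "norm (autocorrelation w) \<le> (LBINT u. M * norm (g u))" for w
    unfolding autocorrelation_def
  proof (rule Bochner_Integration.integral_norm_bound_integral)
    show i: "integrable lborel (\<lambda>u. M * norm (g u))" using g_int by simp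
    show "integrable lborel (\<lambda>u. g (u + w) * cnj (g u))"
      by (rule Bochner_Integration.integrable_bound[OF i])
         (use M in \<open>auto intro!: AE_I2 mult_right_mono simp: norm_mult\<close>)
    show "norm (g (u + w) * cnj (g u)) \<le> M * norm (g u)" for u
      using M by (auto simp: norm_mult intro!: mult_right_mono)
  qed
  thus ?thesis by blast
qed

private lemma autocorrelation_tendsto:
  assumes "X \<longlonglongrightarrow> 0"
  shows "(\<lambda>n. autocorrelation (X n)) \<longlonglongrightarrow> autocorrelation 0"
proof -
  obtain M where M: "0 \<le> M" "\<forall>t. norm (g t) \<le> M" using g_bounded by blast
  show ?thesis unfolding autocorrelation_def
  proof (rule integral_dominated_convergence[where w = "\<lambda>u. M * norm (g u)"])
    show "integrable lborel (\<lambda>u. M * norm (g u))" using g_int by simp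
    show "AE u in lborel. norm (g (u + X n) * cnj (g u)) \<le> M * norm (g u)" for n
      using M by (auto simp: norm_mult intro!: mult_right_mono)
    show "AE u in lborel. (\<lambda>n. g (u + X n) * cnj (g u)) \<longlonglongrightarrow> g (u + 0) * cnj (g u)"
    proof (intro AE_I2 tendsto_mult tendsto_const)
      fix u
      have "isCont g (u + 0)" using cont by (simp add: continuous_on_eq_continuous_at)
      thus "(\<lambda>n. g (u + X n)) \<longlonglongrightarrow> g (u + 0)"
        by (rule isCont_tendsto_compose) (intro tendsto_add tendsto_const assms)
    qed
  qed measurable
qed

text \<open>The width n + 1 of the Gaussian tends to infinity. The regularised energies increase to
  the energy of the transform, and by dominated convergence they tend to 2 pi times the
  autocorrelation at 0; finiteness is part of the result.\<close>

lemma plancherel_compact_support: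
  "(\<integral>\<^sup>+\<xi>. ennreal ((cmod (LBINT t. iexp (\<xi> * t) * g t))\<^sup>2) \<partial>lborel) = ennreal (2 * pi * (LBINT t. (cmod (g t))\<^sup>2))"
proof -
  define G where "G = (\<lambda>n \<xi>. exp (- (\<xi> / real (Suc n))\<^sup>2 / 2) * (cmod (fourier \<xi>))\<^sup>2)"
  define N where "N = (LBINT t. norm (g t))"
  have G0: "G n \<xi> \<ge> 0" for n \<xi> by (simp add: G_def)
  have Gint: "integrable lborel (G n)" for n
  proof (rule Bochner_Integration.integrable_bound)
    have "integrable lborel (\<lambda>\<xi>. exp (- (0 + (1 / real (Suc n)) * \<xi>)\<^sup>2 / 2))"
      by (rule lborel_integrable_real_affine[OF gaussian_int(1)]) simp
    thus "integrable lborel (\<lambda>\<xi>. N\<^sup>2 * exp (- (\<xi> / real (Suc n))\<^sup>2 / 2))" by simp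
    show "G n \<in> borel_measurable lborel" unfolding G_def by measurable
    show "AE \<xi> in lborel. norm (G n \<xi>) \<le> norm (N\<^sup>2 * exp (- (\<xi> / real (Suc n))\<^sup>2 / 2))"
      unfolding G_def using fourier_bounded by (auto simp: N_def mult.commute abs_mult intro!: mult_left_mono power_mono)
  qed
  have eq: "complex_of_real (LBINT \<xi>. G n \<xi>) = of_real (sqrt (2 * pi)) * (LBINT v. of_real (exp (- v\<^sup>2 / 2)) * autocorrelation (v / real (Suc n)))" for n
  proof -
    have "complex_of_real (G n \<xi>) = of_real (exp (- (\<xi> / real (Suc n))\<^sup>2 / 2)) * (fourier \<xi> * cnj (fourier \<xi>))" for \<xi>
      unfolding G_def complex_norm_square[symmetric] of_real_mult ..
    hence "complex_of_real (LBINT \<xi>. G n \<xi>) = (LBINT \<xi>. of_real (exp (- (\<xi> / real (Suc n))\<^sup>2 / 2)) * (fourier \<xi> * cnj (fourier \<xi>)))"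
      by (simp only: integral_complex_of_real[symmetric])
    thus ?thesis using regularised_plancherel[of "real (Suc n)"] by simp
  qed
  obtain B where B: "\<forall>w. norm (autocorrelation w) \<le> B" using autocorrelation_bounded by blast
  have "(\<lambda>n. LBINT v. of_real (exp (- v\<^sup>2 / 2)) * autocorrelation (v / real (Suc n)))
     \<longlonglongrightarrow> (LBINT v. of_real (exp (- v\<^sup>2 / 2)) * autocorrelation 0)"
  proof (rule integral_dominated_convergence[where w = "\<lambda>v. exp (- v\<^sup>2 / 2) * B"])
    show "integrable lborel (\<lambda>v. exp (- v\<^sup>2 / 2) * B)" using gaussian_int(1) by simp
    show "AE v in lborel. (\<lambda>n. of_real (exp (- v\<^sup>2 / 2)) * autocorrelation (v / real (Suc n))) \<longlonglongrightarrow> of_real (exp (- v\<^sup>2 / 2)) * autocorrelation 0"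
    proof (intro AE_I2 tendsto_mult tendsto_const autocorrelation_tendsto)
      fix v :: real
      show "(\<lambda>n. v / real (Suc n)) \<longlonglongrightarrow> 0"
        using tendsto_mult[OF tendsto_const[of v] LIMSEQ_Suc[OF lim_inverse_n]] by (simp add: divide_inverse)
    qed
    show "AE v in lborel. norm (of_real (exp (- v\<^sup>2 / 2)) * autocorrelation (v / real (Suc n))) \<le> exp (- v\<^sup>2 / 2) * B" for n
      using B by (auto simp: norm_mult intro!: mult_left_mono)
  qed measurable
  also have "(LBINT v. of_real (exp (- v\<^sup>2 / 2)) * autocorrelation 0) = of_real (sqrt (2 * pi)) * autocorrelation 0"
    using gaussian_int(2) by (simp only: integral_mult_left_zero integral_complex_of_real)
  finally have "(\<lambda>n. complex_of_real (LBINT \<xi>. G n \<xi>)) \<longlonglongrightarrow> of_real (sqrt (2 * pi)) * (of_real (sqrt (2 * pi)) * autocorrelation 0)"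
    unfolding eq by (intro tendsto_mult tendsto_const)
  also have "autocorrelation 0 = of_real (LBINT t. (cmod (g t))\<^sup>2)"
    unfolding autocorrelation_def add_0_right complex_norm_square[symmetric] integral_complex_of_real ..
  also have "complex_of_real (sqrt (2 * pi)) * (of_real (sqrt (2 * pi)) * of_real (LBINT t. (cmod (g t))\<^sup>2)) = of_real (2 * pi * (LBINT t. (cmod (g t))\<^sup>2))"
    by (simp only: of_real_mult[symmetric] mult.assoc[symmetric] real_sqrt_mult_self) simp
  finally have lim: "(\<lambda>n. LBINT \<xi>. G n \<xi>) \<longlonglongrightarrow> 2 * pi * (LBINT t. (cmod (g t))\<^sup>2)"
    by (simp only: tendsto_of_real_iff)
  have nn: "(\<integral>\<^sup>+\<xi>. ennreal (G n \<xi>) \<partial>lborel) = ennreal (LBINT \<xi>. G n \<xi>)" for n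
    using Gint G0 by (intro nn_integral_eq_integral) auto
  have inc: "incseq (\<lambda>n \<xi>. ennreal (G n \<xi>))"
  proof (rule incseq_SucI, rule le_funI)
    fix n \<xi>
    have "(\<xi> / real (Suc (Suc n)))\<^sup>2 \<le> (\<xi> / real (Suc n))\<^sup>2"
      unfolding power_divide by (intro divide_left_mono power_mono) auto
    thus "ennreal (G n \<xi>) \<le> ennreal (G (Suc n) \<xi>)"
      unfolding G_def by (intro ennreal_leI mult_right_mono) auto
  qed
  have sup: "(SUP n. ennreal (G n \<xi>)) = ennreal ((cmod (fourier \<xi>))\<^sup>2)" for \<xi>
  proof (rule LIMSEQ_unique)
    show "(\<lambda>n. ennreal (G n \<xi>)) \<longlonglongrightarrow> (SUP n. ennreal (G n \<xi>))"
      using inc by (intro LIMSEQ_SUP) (auto simp: incseq_def le_fun_def)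
    have "(\<lambda>n. \<xi> / real (Suc n)) \<longlonglongrightarrow> 0"
      using tendsto_mult[OF tendsto_const[of \<xi>] LIMSEQ_Suc[OF lim_inverse_n]] by (simp add: divide_inverse)
    hence "(\<lambda>n. G n \<xi>) \<longlonglongrightarrow> exp (- 0\<^sup>2 / 2) * (cmod (fourier \<xi>))\<^sup>2"
      unfolding G_def by (intro tendsto_intros) auto
    thus "(\<lambda>n. ennreal (G n \<xi>)) \<longlonglongrightarrow> ennreal ((cmod (fourier \<xi>))\<^sup>2)"
      by (intro tendsto_ennrealI) simp
  qed
  have "(\<integral>\<^sup>+\<xi>. ennreal ((cmod (fourier \<xi>))\<^sup>2) \<partial>lborel) = (SUP n. \<integral>\<^sup>+\<xi>. ennreal (G n \<xi>) \<partial>lborel)"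
    unfolding sup[symmetric] by (rule nn_integral_monotone_convergence_SUP[OF inc]) (simp add: G_def)
  also have "\<dots> = ennreal (2 * pi * (LBINT t. (cmod (g t))\<^sup>2))"
  proof (rule LIMSEQ_unique)
    show "(\<lambda>n. \<integral>\<^sup>+\<xi>. ennreal (G n \<xi>) \<partial>lborel) \<longlonglongrightarrow> (SUP n. \<integral>\<^sup>+\<xi>. ennreal (G n \<xi>) \<partial>lborel)"
      using inc by (intro LIMSEQ_SUP) (auto simp: incseq_def le_fun_def intro!: nn_integral_mono)
    show "(\<lambda>n. \<integral>\<^sup>+\<xi>. ennreal (G n \<xi>) \<partial>lborel) \<longlonglongrightarrow> ennreal (2 * pi * (LBINT t. (cmod (g t))\<^sup>2))"
      unfolding nn by (intro tendsto_ennrealI lim)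
  qed
  finally show ?thesis unfolding fourier_def .
qed

end

section \<open>Transfer from the half-line to the line by x = exp t\<close>

lemma exp_image_UNIV: "exp ` (UNIV :: real set) = {0<..}"
proof -
  have "x \<in> range exp" if "x > 0" for x :: real using that exp_ln[of x] by (metis rangeI)
  thus ?thesis by auto
qed

text \<open>With x = exp t the weight x^(s - 1) dx becomes exp (i \<xi> t) exp (t / 2) dt. The
  factor exp (t / 2) is also the one that makes f \<mapsto> exp (t / 2) f (exp t) an isometry of L2
  spaces.\<close>

lemma mellin_critical_line:
  assumes f: "f \<in> test_funs"
  shows "mellin f (Complex (1 / 2) \<xi>) = (LBINT t. iexp (\<xi> * t) * (of_real (exp (t / 2)) * f (exp t)))"
proof -
  let ?s = "Complex (1 / 2) \<xi>"
  have int: "set_integrable lborel (range exp) (\<lambda>x. complex_of_real x powr (?s - 1) * f x)"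
    using mellin_integrable_test_fun[OF f, of ?s] unfolding mellin_integrable_def exp_image_UNIV .
  have c: "continuous_on (range exp) (\<lambda>x. complex_of_real x powr (?s - 1) * f x)"
    unfolding exp_image_UNIV
    by (intro continuous_intros continuous_on_subset[OF continuous_on_test_fun[OF f]]) (auto simp: complex_nonpos_Reals_iff)
  have der: "(exp has_field_derivative exp t) (at t within UNIV)" for t :: real by (rule DERIV_exp)
  have "mellin f ?s = (LBINT y:range exp. complex_of_real y powr (?s - 1) * f y)"
    unfolding mellin_def exp_image_UNIV ..
  also have "\<dots> = (LBINT t:UNIV. of_real \<bar>exp t\<bar> * (complex_of_real (exp t) powr (?s - 1) * f (exp t)))"
    by (rule set_integral_substitution(2)[symmetric, OF _ _ der _ _ c int])
       (auto simp: exp_image_UNIV inj_on_def intro!: continuous_intros)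
  also have "\<dots> = (LBINT t. iexp (\<xi> * t) * (of_real (exp (t / 2)) * f (exp t)))"
    unfolding set_lebesgue_integral_def
  proof (intro Bochner_Integration.integral_cong refl)
    fix t :: real
    have "complex_of_real (exp t) powr (?s - 1) = exp ((?s - 1) * of_real t)"
      by (simp add: powr_def Ln_of_real exp_of_real[symmetric])
    hence "complex_of_real \<bar>exp t\<bar> * complex_of_real (exp t) powr (?s - 1) = exp (of_real t + (?s - 1) * of_real t)"
      by (simp add: exp_add exp_of_real)
    also have "of_real t + (?s - 1) * of_real t = \<i> * of_real (\<xi> * t) + of_real (t / 2)"
      by (simp add: complex_eq_iff)
    also have "exp (\<i> * of_real (\<xi> * t) + of_real (t / 2)) = iexp (\<xi> * t) * of_real (exp (t / 2))"
      by (simp only: exp_add exp_of_real)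
    finally have "complex_of_real \<bar>exp t\<bar> * complex_of_real (exp t) powr (?s - 1) = iexp (\<xi> * t) * of_real (exp (t / 2))" .
    thus "indicator UNIV t *\<^sub>R (of_real \<bar>exp t\<bar> * (complex_of_real (exp t) powr (?s - 1) * f (exp t))) =
        iexp (\<xi> * t) * (of_real (exp (t / 2)) * f (exp t))"
      by (simp add: mult.assoc[symmetric] del: of_real_mult)
  qed
  finally show ?thesis .
qed

lemma plancherel_mellin:
  assumes f: "f \<in> test_funs"
  shows "(\<integral>\<^sup>+\<xi>. ennreal ((cmod (mellin f (Complex (1 / 2) \<xi>)))\<^sup>2) \<partial>lborel) =
    ennreal (2 * pi) * (\<integral>\<^sup>+x\<in>{0<..}. ennreal ((cmod (f x))\<^sup>2) \<partial>lborel)"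
proof -
  obtain a b where ab: "0 < a" "a < b" and z: "\<forall>x. x \<notin> {a..b} \<longrightarrow> f x = 0"
    using test_fun_derivative[OF f] by blast
  note cf = continuous_on_test_fun[OF f]
  define g where "g = (\<lambda>t. complex_of_real (exp (t / 2)) * f (exp t))"
  define R where "R = max \<bar>ln a\<bar> \<bar>ln b\<bar>"
  have cg: "continuous_on UNIV g"
    unfolding g_def by (intro continuous_intros continuous_on_compose2[OF cf]) auto
  have sg: "g t = 0" if "t \<notin> {-R..R}" for t
  proof -
    have "exp t \<notin> {a..b}"
    proof
      assume "exp t \<in> {a..b}"
      hence e: "a \<le> exp t" "exp t \<le> b" by auto
      have "ln a \<le> ln (exp t)" by (subst ln_le_cancel_iff) (use ab e in auto)
      moreover have "ln (exp t) \<le> ln b" by (subst ln_le_cancel_iff) (use ab e in auto)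
      ultimately show False using that by (auto simp: R_def)
    qed
    thus ?thesis using z by (simp add: g_def)
  qed
  have int: "integrable lborel (\<lambda>x. indicator {0<..} x *\<^sub>R (cmod (f x))\<^sup>2)"
  proof -
    have "set_integrable lborel {a..b} (\<lambda>x. (cmod (f x))\<^sup>2)"
      by (rule borel_integrable_atLeastAtMost') (intro continuous_intros continuous_on_subset[OF cf], auto)
    moreover have "indicator {a..b} x *\<^sub>R (cmod (f x))\<^sup>2 = indicator {0<..} x *\<^sub>R (cmod (f x))\<^sup>2" for x
      using z ab by (auto simp: indicator_def)
    ultimately show ?thesis by (simp only: set_integrable_def)
  qed
  have sub: "(LBINT t:UNIV. \<bar>exp t\<bar> * (cmod (f (exp t)))\<^sup>2) = (LBINT x:range exp. (cmod (f x))\<^sup>2)"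
    by (rule set_integral_substitution_real(2)[OF _ _ DERIV_exp])
       (use int in \<open>auto simp: exp_image_UNIV inj_on_def set_integrable_def intro!: continuous_intros continuous_on_subset[OF cf]\<close>)
  have "(LBINT t. (cmod (g t))\<^sup>2) = (LBINT t:UNIV. \<bar>exp t\<bar> * (cmod (f (exp t)))\<^sup>2)"
    unfolding set_lebesgue_integral_def
  proof (intro Bochner_Integration.integral_cong refl)
    fix t :: real
    have "(exp (t / 2))\<^sup>2 = exp t" by (simp add: power2_eq_square exp_add[symmetric])
    thus "(cmod (g t))\<^sup>2 = indicator UNIV t *\<^sub>R (\<bar>exp t\<bar> * (cmod (f (exp t)))\<^sup>2)"
      by (simp add: g_def norm_mult power_mult_distrib)
  qed
  also have "\<dots> = (LBINT x. indicator {0<..} x *\<^sub>R (cmod (f x))\<^sup>2)"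
    unfolding sub by (simp add: set_lebesgue_integral_def exp_image_UNIV)
  finally have A: "(LBINT t. (cmod (g t))\<^sup>2) = (LBINT x. indicator {0<..} x *\<^sub>R (cmod (f x))\<^sup>2)" .
  have B: "(\<integral>\<^sup>+x\<in>{0<..}. ennreal ((cmod (f x))\<^sup>2) \<partial>lborel) = ennreal (LBINT x. indicator {0<..} x *\<^sub>R (cmod (f x))\<^sup>2)"
  proof -
    have "(\<integral>\<^sup>+x\<in>{0<..}. ennreal ((cmod (f x))\<^sup>2) \<partial>lborel) = (\<integral>\<^sup>+x. ennreal (indicator {0<..} x *\<^sub>R (cmod (f x))\<^sup>2) \<partial>lborel)"
      by (intro nn_integral_cong) (simp add: indicator_def)
    also have "\<dots> = ennreal (LBINT x. indicator {0<..} x *\<^sub>R (cmod (f x))\<^sup>2)"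
      using int by (intro nn_integral_eq_integral) auto
    finally show ?thesis .
  qed
  have "(\<integral>\<^sup>+\<xi>. ennreal ((cmod (mellin f (Complex (1 / 2) \<xi>)))\<^sup>2) \<partial>lborel) = ennreal (2 * pi * (LBINT t. (cmod (g t))\<^sup>2))"
    unfolding mellin_critical_line[OF f] g_def[symmetric]
    using plancherel_compact_support[OF cg sg] by (simp add: g_def)
  also have "\<dots> = ennreal (2 * pi) * ennreal (LBINT t. (cmod (g t))\<^sup>2)"
    by (intro ennreal_mult) (auto intro!: integral_nonneg_AE)
  finally show ?thesis unfolding A B .
qed

section \<open>The norm as an essential supremum\<close>

definition bump_fourier :: "real \<Rightarrow> complex" where
  "bump_fourier \<eta> = (LBINT u. iexp (\<eta> * u) * of_real (flat_exp 0 u * flat_exp 0 (1 - u)))"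

lemma bump_fourier_measurable [measurable]: "bump_fourier \<in> borel_measurable borel"
proof -
  have [measurable]: "flat_exp 0 \<in> borel_measurable borel"
    unfolding flat_exp_def by measurable
  show ?thesis unfolding bump_fourier_def[abs_def] by measurable
qed

text \<open>In the variable t = ln x the exponent -1/2 cancels exp (t / 2), the imaginary part
  shifts frequencies by \<xi>0, and dilating the bump by n contracts its transform to width 1 /
  n.\<close>

lemma mellin_log_bump:
  assumes n: "n > 0"
  shows "mellin (log_bump n (- 1 / 2 - \<i> * of_real \<xi>0) 0 0) (Complex (1 / 2) \<xi>) = of_nat n * bump_fourier (real n * (\<xi> - \<xi>0))"
proof -
  let ?\<alpha> = "- 1 / 2 - \<i> * of_real \<xi>0"
  let ?\<psi> = "\<lambda>u. complex_of_real (flat_exp 0 u * flat_exp 0 (1 - u))"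
  have "mellin (log_bump n ?\<alpha> 0 0) (Complex (1 / 2) \<xi>) =
     (LBINT t. iexp (\<xi> * t) * (of_real (exp (t / 2)) * log_bump n ?\<alpha> 0 0 (exp t)))"
    by (rule mellin_critical_line[OF log_bump_test_fun[OF n]])
  also have "\<dots> = (LBINT t. iexp ((\<xi> - \<xi>0) * t) * ?\<psi> (t / n))"
  proof (intro Bochner_Integration.integral_cong refl)
    fix t :: real
    have "complex_of_real (exp t) powr ?\<alpha> = exp (?\<alpha> * of_real t)"
      by (simp add: powr_def Ln_of_real exp_of_real[symmetric])
    hence "iexp (\<xi> * t) * (of_real (exp (t / 2)) * complex_of_real (exp t) powr ?\<alpha>) =
       exp (\<i> * of_real (\<xi> * t) + (of_real (t / 2) + ?\<alpha> * of_real t))"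
      by (simp only: exp_add exp_of_real)
    also have "\<i> * of_real (\<xi> * t) + (of_real (t / 2) + ?\<alpha> * of_real t) = \<i> * of_real ((\<xi> - \<xi>0) * t)"
      by (simp add: algebra_simps)
    finally show "iexp (\<xi> * t) * (of_real (exp (t / 2)) * log_bump n ?\<alpha> 0 0 (exp t)) = iexp ((\<xi> - \<xi>0) * t) * ?\<psi> (t / n)"
      unfolding log_bump_def ln_exp using exp_gt_zero[of t] by (simp only: if_True mult.assoc[symmetric])
  qed
  also have "\<dots> = of_nat n * (LBINT u. iexp (real n * (\<xi> - \<xi>0) * u) * ?\<psi> u)"
    using n lborel_integral_real_affine[of "real n" "\<lambda>t. iexp ((\<xi> - \<xi>0) * t) * ?\<psi> (t / n)" 0]
    by (simp add: scaleR_conv_of_real mult_ac)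
  finally show ?thesis by (simp add: bump_fourier_def)
qed

text \<open>Plancherel applied to the concentrating functions: their energy grows like n, and this
  factor cancels when the norm bound is tested on them.\<close>

lemma bump_energy:
  assumes n: "n > 0"
  shows "(\<integral>\<^sup>+\<eta>. ennreal ((cmod (bump_fourier \<eta>))\<^sup>2) \<partial>lborel) * ennreal (real n) =
    ennreal (2 * pi) * (\<integral>\<^sup>+x\<in>{0<..}. ennreal ((cmod (log_bump n (- 1 / 2 - \<i> * of_real \<xi>0) 0 0 x))\<^sup>2) \<partial>lborel)"
proof -
  have "ennreal (2 * pi) * (\<integral>\<^sup>+x\<in>{0<..}. ennreal ((cmod (log_bump n (- 1 / 2 - \<i> * of_real \<xi>0) 0 0 x))\<^sup>2) \<partial>lborel)
    = (\<integral>\<^sup>+\<xi>. ennreal ((cmod (of_nat n * bump_fourier (real n * (\<xi> - \<xi>0))))\<^sup>2) \<partial>lborel)"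
    unfolding plancherel_mellin[OF log_bump_test_fun[OF n], symmetric] mellin_log_bump[OF n] ..
  also have "\<dots> = ennreal \<bar>1 / real n\<bar> * (\<integral>\<^sup>+\<eta>. ennreal ((cmod (of_nat n * bump_fourier (real n * (\<xi>0 + (1 / real n) * \<eta> - \<xi>0))))\<^sup>2) \<partial>lborel)"
    using n by (intro nn_integral_real_affine) auto
  also have "\<dots> = ennreal \<bar>1 / real n\<bar> * (\<integral>\<^sup>+\<eta>. ennreal ((real n)\<^sup>2) * ennreal ((cmod (bump_fourier \<eta>))\<^sup>2) \<partial>lborel)"
    using n by (simp add: norm_mult power_mult_distrib ennreal_mult)
  also have "\<dots> = ennreal \<bar>1 / real n\<bar> * (ennreal ((real n)\<^sup>2) * (\<integral>\<^sup>+\<eta>. ennreal ((cmod (bump_fourier \<eta>))\<^sup>2) \<partial>lborel))"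
    by (subst nn_integral_cmult) auto
  also have "\<dots> = (ennreal \<bar>1 / real n\<bar> * ennreal ((real n)\<^sup>2)) * (\<integral>\<^sup>+\<eta>. ennreal ((cmod (bump_fourier \<eta>))\<^sup>2) \<partial>lborel)"
    by (simp only: mult.assoc)
  also have "ennreal \<bar>1 / real n\<bar> * ennreal ((real n)\<^sup>2) = ennreal (real n)"
    using n by (subst ennreal_mult[symmetric]) (auto simp: power2_eq_square)
  finally show ?thesis by (simp add: mult.commute)
qed

text \<open>The bump has no zero in the interval (1, e), which has positive measure.\<close>

lemma log_bump_energy_pos:
  "(\<integral>\<^sup>+x\<in>{0<..}. ennreal ((cmod (log_bump 1 \<alpha> 0 0 x))\<^sup>2) \<partial>lborel) \<noteq> 0"
proof
  define f where "f = log_bump 1 \<alpha> 0 0"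
  assume "(\<integral>\<^sup>+x\<in>{0<..}. ennreal ((cmod (log_bump 1 \<alpha> 0 0 x))\<^sup>2) \<partial>lborel) = 0"
  hence 0: "(\<integral>\<^sup>+x. ennreal ((cmod (f x))\<^sup>2) * indicator {0<..} x \<partial>lborel) = 0"
    by (simp only: f_def)
  have [measurable]: "f \<in> borel_measurable borel"
    unfolding f_def by (intro borel_measurable_continuous_onI continuous_on_test_fun log_bump_test_fun) simp
  have "(\<lambda>x. ennreal ((cmod (f x))\<^sup>2) * indicator {0<..} x) \<in> borel_measurable lborel" by measurable
  from nn_integral_0_iff_AE[OF this] 0
  have AE0: "AE x in lborel. ennreal ((cmod (f x))\<^sup>2) * indicator {0<..} x = 0" by blast
  have nz: "f x \<noteq> 0" if "1 < x" "x < exp 1" for x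
  proof -
    have "0 < ln x" using that by simp
    moreover have "ln x < ln (exp 1)" using that by (subst ln_less_cancel_iff) auto
    ultimately show ?thesis using that by (simp add: f_def log_bump_def flat_exp_def)
  qed
  from AE0 have AE: "AE x in lborel. x \<notin> {1<..<exp 1 :: real}"
  proof eventually_elim
    case (elim x)
    show ?case
    proof
      assume x: "x \<in> {1<..<exp 1 :: real}"
      hence "f x \<noteq> 0" by (intro nz) auto
      moreover have "indicator {0<..} x = (1 :: ennreal)" using x by (simp add: indicator_def)
      ultimately show False using elim by (simp add: ennreal_eq_0_iff)
    qed
  qed
  have "{1<..<exp 1 :: real} \<in> null_sets lborel"
    using AE by (subst AE_iff_null_sets) auto
  hence "emeasure lborel {1<..<exp 1 :: real} = 0" by (rule null_setsD1)
  moreover have "emeasure lborel {1<..<exp 1 :: real} = ennreal (exp 1 - 1)"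
    by (rule emeasure_lborel_Ioo) simp
  moreover have "exp 1 > (1::real)" by simp
  ultimately show False by (simp add: ennreal_eq_0_iff)
qed

lemma bump_fourier_energy:
  defines "Q \<equiv> (\<integral>\<^sup>+\<eta>. ennreal ((cmod (bump_fourier \<eta>))\<^sup>2) \<partial>lborel)"
  shows "Q \<noteq> 0" "Q < \<infinity>"
proof -
  let ?f = "log_bump 1 (- 1 / 2 - \<i> * of_real 0) 0 0"
  have e: "Q = ennreal (2 * pi) * (\<integral>\<^sup>+x\<in>{0<..}. ennreal ((cmod (?f x))\<^sup>2) \<partial>lborel)"
    using bump_energy[of 1 0] by (simp add: Q_def)
  have "ennreal (2 * pi) \<noteq> 0" using pi_gt_zero by (simp add: ennreal_eq_0_iff not_le)
  thus "Q \<noteq> 0" unfolding e using log_bump_energy_pos by simp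
  have f: "?f \<in> test_funs" by (rule log_bump_test_fun) simp
  obtain a b where ab: "0 < a" "a < b" and z: "\<forall>x. x \<notin> {a..b} \<longrightarrow> ?f x = 0"
    using test_fun_derivative[OF f] by blast
  have "set_integrable lborel {a..b} (\<lambda>x. (cmod (?f x))\<^sup>2)"
    by (rule borel_integrable_atLeastAtMost') (intro continuous_intros continuous_on_subset[OF continuous_on_test_fun[OF f]], auto)
  hence "(\<integral>\<^sup>+x. ennreal (indicator {a..b} x *\<^sub>R (cmod (?f x))\<^sup>2) \<partial>lborel) < \<infinity>"
    unfolding set_integrable_def integrable_iff_bounded by (simp add: abs_mult)
  also have "(\<integral>\<^sup>+x. ennreal (indicator {a..b} x *\<^sub>R (cmod (?f x))\<^sup>2) \<partial>lborel) = (\<integral>\<^sup>+x\<in>{0<..}. ennreal ((cmod (?f x))\<^sup>2) \<partial>lborel)"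
    by (intro nn_integral_cong) (use z ab in \<open>auto simp: indicator_def\<close>)
  finally show "Q < \<infinity>" unfolding e by (simp add: ennreal_mult_less_top)
qed

text \<open>By Plancherel a bump of positive energy cannot have a transform that vanishes on the
  critical line. It is the test function that the uniqueness of the symbol calls for.\<close>

lemma exists_test_fun_mellin_nonzero: "\<exists>f\<in>test_funs. \<exists>z. mellin f z \<noteq> 0"
proof (rule ccontr)
  assume "\<not> (\<exists>f\<in>test_funs. \<exists>z. mellin f z \<noteq> 0)"
  hence "mellin (log_bump 1 0 0 0) (Complex (1 / 2) \<xi>) = 0" for \<xi>
    using log_bump_test_fun[of 1 0 0 0] by auto
  hence "ennreal (2 * pi) * (\<integral>\<^sup>+x\<in>{0<..}. ennreal ((cmod (log_bump 1 0 0 0 x))\<^sup>2) \<partial>lborel) = 0"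
    using plancherel_mellin[OF log_bump_test_fun[of 1 0 0 0]] by simp
  moreover have "ennreal (2 * pi) \<noteq> 0" using pi_gt_zero by (simp add: ennreal_eq_0_iff not_le)
  ultimately show False using log_bump_energy_pos[of 0] by simp
qed

context
  fixes A :: "(real \<Rightarrow> complex) \<Rightarrow> real \<Rightarrow> complex" and h :: "real \<Rightarrow> real"
  assumes h: "AE \<xi> in lborel. (cmod (mellin_symbol A (Complex (1 / 2) \<xi>)))\<^sup>2 = h \<xi>"
    and h_meas [measurable]: "h \<in> borel_measurable borel" and h_nonneg: "\<And>\<xi>. h \<xi> \<ge> 0"
begin

text \<open>The chosen symbol is known only almost everywhere on the line; inside the integral it
  can be replaced by the explicit function h.\<close>

lemma L2_bound_iff:
  "L2_bound A C \<longleftrightarrow> (\<forall>f\<in>test_funs. ennreal (1 / (2 * pi)) *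
     (\<integral>\<^sup>+\<xi>. ennreal (h \<xi>) * ennreal ((cmod (mellin f (Complex (1 / 2) \<xi>)))\<^sup>2) \<partial>lborel)
     \<le> C\<^sup>2 * (\<integral>\<^sup>+x\<in>{0<..}. ennreal ((cmod (f x))\<^sup>2) \<partial>lborel))"
proof -
  have "(\<integral>\<^sup>+\<xi>. ennreal ((cmod (mellin_symbol A (Complex (1 / 2) \<xi>) * mellin f (Complex (1 / 2) \<xi>)))\<^sup>2) \<partial>lborel) =
     (\<integral>\<^sup>+\<xi>. ennreal (h \<xi>) * ennreal ((cmod (mellin f (Complex (1 / 2) \<xi>)))\<^sup>2) \<partial>lborel)" for f
  proof (rule nn_integral_cong_AE)
    show "AE \<xi> in lborel. ennreal ((cmod (mellin_symbol A (Complex (1 / 2) \<xi>) * mellin f (Complex (1 / 2) \<xi>)))\<^sup>2) =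
       ennreal (h \<xi>) * ennreal ((cmod (mellin f (Complex (1 / 2) \<xi>)))\<^sup>2)"
      using h by eventually_elim (simp add: norm_mult power_mult_distrib ennreal_mult h_nonneg)
  qed
  thus ?thesis by (simp add: L2_bound_def)
qed

lemma L2_bound_upper:
  assumes c: "c \<ge> 0" "\<And>\<xi>. h \<xi> \<le> c\<^sup>2"
  shows "L2_bound A (ennreal c)"
  unfolding L2_bound_iff
proof
  fix f assume f: "f \<in> test_funs"
  have [measurable]: "(\<lambda>\<xi>. mellin f (Complex (1 / 2) \<xi>)) \<in> borel_measurable borel"
  proof (rule borel_measurable_continuous_onI)
    have "continuous_on UNIV (mellin f)"
      by (rule holomorphic_on_imp_continuous_on) (rule mellin_test_fun_holomorphic[OF f])
    thus "continuous_on UNIV (\<lambda>\<xi>. mellin f (Complex (1 / 2) \<xi>))"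
      by (rule continuous_on_compose2) (auto simp: Complex_eq intro!: continuous_intros)
  qed
  let ?F = "(\<integral>\<^sup>+x\<in>{0<..}. ennreal ((cmod (f x))\<^sup>2) \<partial>lborel)"
  have "(\<integral>\<^sup>+\<xi>. ennreal (h \<xi>) * ennreal ((cmod (mellin f (Complex (1 / 2) \<xi>)))\<^sup>2) \<partial>lborel)
     \<le> (\<integral>\<^sup>+\<xi>. ennreal (c\<^sup>2) * ennreal ((cmod (mellin f (Complex (1 / 2) \<xi>)))\<^sup>2) \<partial>lborel)"
    by (intro nn_integral_mono mult_right_mono ennreal_leI c) auto
  also have "\<dots> = ennreal (c\<^sup>2) * (ennreal (2 * pi) * ?F)"
    by (subst nn_integral_cmult) (auto simp: plancherel_mellin[OF f])
  finally have "ennreal (1 / (2 * pi)) * (\<integral>\<^sup>+\<xi>. ennreal (h \<xi>) * ennreal ((cmod (mellin f (Complex (1 / 2) \<xi>)))\<^sup>2) \<partial>lborel)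
     \<le> ennreal (1 / (2 * pi)) * (ennreal (c\<^sup>2) * (ennreal (2 * pi) * ?F))"
    by (rule mult_left_mono) simp
  also have "\<dots> = (ennreal (1 / (2 * pi)) * ennreal (2 * pi)) * (ennreal (c\<^sup>2) * ?F)"
    by (simp only: mult_ac)
  also have "ennreal (1 / (2 * pi)) * ennreal (2 * pi) = 1"
    by (subst ennreal_mult[symmetric]) auto
  also have "1 * (ennreal (c\<^sup>2) * ?F) = (ennreal c)\<^sup>2 * ?F"
    using c(1) by (simp add: ennreal_power)
  finally show "ennreal (1 / (2 * pi)) *
     (\<integral>\<^sup>+\<xi>. ennreal (h \<xi>) * ennreal ((cmod (mellin f (Complex (1 / 2) \<xi>)))\<^sup>2) \<partial>lborel) \<le> (ennreal c)\<^sup>2 * ?F" .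
qed

text \<open>Tested on the bumps concentrating at \<xi>0 and rescaled by \<eta> = n (\<xi> - \<xi>0),
  the bound states that the integral of h (\<xi>0 + \<eta> / n) against the fixed density
  |\<open>bump_fourier\<close> \<eta>|^2 is at most C^2 Q. Fatou's lemma and continuity at \<xi>0
  give the limit without any integrable majorant for h.\<close>

lemma L2_bound_lower:
  assumes L: "L2_bound A C" and cont: "isCont h \<xi>0"
  shows "ennreal (h \<xi>0) \<le> C\<^sup>2"
proof -
  define Q where "Q = (\<integral>\<^sup>+\<eta>. ennreal ((cmod (bump_fourier \<eta>))\<^sup>2) \<partial>lborel)"
  have Q: "Q \<noteq> 0" "Q < \<infinity>" unfolding Q_def by (rule bump_fourier_energy)+
  have bound: "(\<integral>\<^sup>+\<eta>. ennreal (h (\<xi>0 + \<eta> / real (Suc k))) * ennreal ((cmod (bump_fourier \<eta>))\<^sup>2) \<partial>lborel) \<le> C\<^sup>2 * Q" for k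
  proof -
    define n where "n = Suc k"
    have n: "n > 0" by (simp add: n_def)
    let ?f = "log_bump n (- 1 / 2 - \<i> * of_real \<xi>0) 0 0"
    let ?E = "(\<integral>\<^sup>+x\<in>{0<..}. ennreal ((cmod (?f x))\<^sup>2) \<partial>lborel)"
    define I where "I = (\<integral>\<^sup>+\<eta>. ennreal (h (\<xi>0 + \<eta> / real n)) * ennreal ((cmod (bump_fourier \<eta>))\<^sup>2) \<partial>lborel)"
    have "(\<integral>\<^sup>+\<xi>. ennreal (h \<xi>) * ennreal ((cmod (mellin ?f (Complex (1 / 2) \<xi>)))\<^sup>2) \<partial>lborel) =
       (\<integral>\<^sup>+\<xi>. ennreal (h \<xi>) * ennreal ((cmod (of_nat n * bump_fourier (real n * (\<xi> - \<xi>0))))\<^sup>2) \<partial>lborel)"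
      unfolding mellin_log_bump[OF n] ..
    also have "\<dots> = ennreal \<bar>1 / real n\<bar> * (\<integral>\<^sup>+\<eta>. ennreal (h (\<xi>0 + (1 / real n) * \<eta>)) *
       ennreal ((cmod (of_nat n * bump_fourier (real n * (\<xi>0 + (1 / real n) * \<eta> - \<xi>0))))\<^sup>2) \<partial>lborel)"
      using n by (intro nn_integral_real_affine) auto
    also have "\<dots> = ennreal \<bar>1 / real n\<bar> * (\<integral>\<^sup>+\<eta>. ennreal ((real n)\<^sup>2) * (ennreal (h (\<xi>0 + \<eta> / real n)) * ennreal ((cmod (bump_fourier \<eta>))\<^sup>2)) \<partial>lborel)"
      using n by (simp add: norm_mult power_mult_distrib ennreal_mult mult_ac)
    also have "\<dots> = ennreal \<bar>1 / real n\<bar> * (ennreal ((real n)\<^sup>2) * I)"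
      unfolding I_def by (subst nn_integral_cmult) auto
    also have "\<dots> = (ennreal \<bar>1 / real n\<bar> * ennreal ((real n)\<^sup>2)) * I"
      by (simp only: mult.assoc)
    also have "ennreal \<bar>1 / real n\<bar> * ennreal ((real n)\<^sup>2) = ennreal (real n)"
      using n by (subst ennreal_mult[symmetric]) (auto simp: power2_eq_square)
    finally have J: "(\<integral>\<^sup>+\<xi>. ennreal (h \<xi>) * ennreal ((cmod (mellin ?f (Complex (1 / 2) \<xi>)))\<^sup>2) \<partial>lborel) = ennreal (real n) * I" .
    have "ennreal (1 / (2 * pi)) * (ennreal (real n) * I) \<le> C\<^sup>2 * ?E"
      using bspec[OF L[unfolded L2_bound_iff] log_bump_test_fun[OF n, of "- 1 / 2 - \<i> * of_real \<xi>0" 0 0]] unfolding J .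
    hence "ennreal (2 * pi) * (ennreal (1 / (2 * pi)) * (ennreal (real n) * I)) \<le> ennreal (2 * pi) * (C\<^sup>2 * ?E)"
      by (rule mult_left_mono) simp
    also have "ennreal (2 * pi) * (C\<^sup>2 * ?E) = C\<^sup>2 * (ennreal (2 * pi) * ?E)"
      by (simp only: mult_ac)
    also have "\<dots> = C\<^sup>2 * (Q * ennreal (real n))"
      unfolding Q_def bump_energy[OF n, of \<xi>0] ..
    also have "ennreal (2 * pi) * (ennreal (1 / (2 * pi)) * (ennreal (real n) * I)) = (ennreal (2 * pi) * ennreal (1 / (2 * pi))) * (ennreal (real n) * I)"
      by (simp only: mult_ac)
    also have "ennreal (2 * pi) * ennreal (1 / (2 * pi)) = 1"
      by (subst ennreal_mult[symmetric]) auto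
    finally have le: "ennreal (real n) * I \<le> ennreal (real n) * (C\<^sup>2 * Q)" by (simp add: mult_ac)
    have "ennreal (1 / real n) * (ennreal (real n) * I) \<le> ennreal (1 / real n) * (ennreal (real n) * (C\<^sup>2 * Q))"
      by (rule mult_left_mono[OF le]) simp
    moreover have "ennreal (1 / real n) * (ennreal (real n) * X) = X" for X
      using n by (simp add: mult.assoc[symmetric] ennreal_mult[symmetric])
    ultimately have "I \<le> C\<^sup>2 * Q" by simp
    thus ?thesis by (simp only: I_def n_def)
  qed
  have lim: "liminf (\<lambda>k. ennreal (h (\<xi>0 + \<eta> / real (Suc k))) * ennreal ((cmod (bump_fourier \<eta>))\<^sup>2)) =
      ennreal (h \<xi>0) * ennreal ((cmod (bump_fourier \<eta>))\<^sup>2)" for \<eta>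
  proof (rule lim_imp_Liminf)
    have "(\<lambda>k. \<eta> / real (Suc k)) \<longlonglongrightarrow> 0"
      using tendsto_mult[OF tendsto_const[of \<eta>] LIMSEQ_Suc[OF lim_inverse_n]] by (simp add: divide_inverse)
    hence "(\<lambda>k. \<xi>0 + \<eta> / real (Suc k)) \<longlonglongrightarrow> \<xi>0 + 0" by (intro tendsto_add tendsto_const)
    hence "(\<lambda>k. h (\<xi>0 + \<eta> / real (Suc k))) \<longlonglongrightarrow> h \<xi>0"
      using isCont_tendsto_compose[OF cont] by simp
    hence "(\<lambda>k. ennreal (h (\<xi>0 + \<eta> / real (Suc k)) * (cmod (bump_fourier \<eta>))\<^sup>2)) \<longlonglongrightarrow> ennreal (h \<xi>0 * (cmod (bump_fourier \<eta>))\<^sup>2)"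
      by (intro tendsto_ennrealI tendsto_mult tendsto_const)
    thus "(\<lambda>k. ennreal (h (\<xi>0 + \<eta> / real (Suc k))) * ennreal ((cmod (bump_fourier \<eta>))\<^sup>2)) \<longlonglongrightarrow>
      ennreal (h \<xi>0) * ennreal ((cmod (bump_fourier \<eta>))\<^sup>2)"
      by (simp only: ennreal_mult[OF h_nonneg] zero_le_power2)
  qed simp
  have "ennreal (h \<xi>0) * Q = (\<integral>\<^sup>+\<eta>. ennreal (h \<xi>0) * ennreal ((cmod (bump_fourier \<eta>))\<^sup>2) \<partial>lborel)"
    unfolding Q_def by (rule nn_integral_cmult[symmetric]) measurable
  also have "\<dots> = (\<integral>\<^sup>+\<eta>. liminf (\<lambda>k. ennreal (h (\<xi>0 + \<eta> / real (Suc k))) * ennreal ((cmod (bump_fourier \<eta>))\<^sup>2)) \<partial>lborel)"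
    unfolding lim ..
  also have "\<dots> \<le> liminf (\<lambda>k. \<integral>\<^sup>+\<eta>. ennreal (h (\<xi>0 + \<eta> / real (Suc k))) * ennreal ((cmod (bump_fourier \<eta>))\<^sup>2) \<partial>lborel)"
    by (rule nn_integral_liminf) measurable
  also have "\<dots> \<le> liminf (\<lambda>k. C\<^sup>2 * Q)"
    by (intro Liminf_mono always_eventually allI bound)
  also have "\<dots> = C\<^sup>2 * Q" by (simp add: Liminf_const)
  finally have "Q * ennreal (h \<xi>0) \<le> Q * C\<^sup>2" by (simp only: mult.commute)
  \<comment> \<open>Q is neither 0 nor infinite, so it can be cancelled in the extended
    reals.\<close>
  thus ?thesis using Q by (subst (asm) ennreal_mult_le_mult_iff) auto
qed

text \<open>The upper bound comes from Plancherel. The lower bound is available at points of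
  continuity of h, so these must come arbitrarily close to the supremum.\<close>

lemma L2_norm_eqI:
  assumes c: "c \<ge> 0" "\<And>\<xi>. h \<xi> \<le> c\<^sup>2" and sup: "\<And>e. e > 0 \<Longrightarrow> \<exists>\<xi>. isCont h \<xi> \<and> h \<xi> > c\<^sup>2 - e"
  shows "L2_norm A = ennreal c" "L2_bounded A"
proof -
  have b: "L2_bound A (ennreal c)" by (rule L2_bound_upper[OF c])
  thus "L2_bounded A" unfolding L2_bounded_def by blast
  have "ennreal c \<le> C" if C: "L2_bound A C" for C
  proof (cases C)
    case (real r)
    have le: "h \<xi> \<le> r\<^sup>2" if "isCont h \<xi>" for \<xi>
      using L2_bound_lower[OF C that] real h_nonneg[of \<xi>] by (simp add: ennreal_power)
    have "c\<^sup>2 - e \<le> r\<^sup>2" if "e > 0" for e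
    proof -
      obtain \<xi> where "isCont h \<xi>" "h \<xi> > c\<^sup>2 - e" using sup[OF \<open>e > 0\<close>] by blast
      with le[of \<xi>] show ?thesis by linarith
    qed
    hence "c\<^sup>2 \<le> r\<^sup>2 + e" if "e > 0" for e using that by (simp add: diff_le_eq)
    hence "c\<^sup>2 \<le> r\<^sup>2" by (rule field_le_epsilon)
    hence "c \<le> r" using real by (rule_tac power2_le_imp_le) auto
    thus ?thesis using real by (auto intro: ennreal_leI)
  qed auto
  thus "L2_norm A = ennreal c"
    unfolding L2_norm_def using b by (intro antisym Inf_lower Inf_greatest) auto
qed

lemma L2_norm_infinite:
  assumes sup: "\<And>K. \<exists>\<xi>. isCont h \<xi> \<and> h \<xi> > K"
  shows "L2_norm A = \<infinity>" "\<not> L2_bounded A"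
proof -
  have no: "\<not> L2_bound A (ennreal r)" if "r \<ge> 0" for r
  proof
    assume C: "L2_bound A (ennreal r)"
    obtain \<xi> where x: "isCont h \<xi>" "h \<xi> > r\<^sup>2" using sup by blast
    have "h \<xi> \<le> r\<^sup>2"
      using L2_bound_lower[OF C x(1)] that by (simp add: ennreal_power)
    thus False using x by simp
  qed
  show "\<not> L2_bounded A"
  proof
    assume "L2_bounded A"
    then obtain r where "L2_bound A (ennreal r)" by (auto simp: L2_bounded_def)
    \<comment> \<open>A negative real constant in \<open>L2_bounded\<close> stands for the bound
      0.\<close>
    moreover have "ennreal r = ennreal (max 0 r)" by (simp add: max_def ennreal_neg)
    ultimately have "L2_bound A (ennreal (max 0 r))" by (simp only:)
    thus False using no[of "max 0 r"] by simp
  qed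
  have "C = \<infinity>" if "L2_bound A C" for C
    using that no by (cases C) auto
  hence "{C. L2_bound A C} \<subseteq> {\<infinity>}" by auto
  hence "Inf {\<infinity>} \<le> Inf {C. L2_bound A C}" by (rule Inf_superset_mono)
  thus "L2_norm A = \<infinity>" by (simp add: L2_norm_def top_unique)
qed

end

section \<open>The symbols on the critical line\<close>

text \<open>Conjugation commutes with \<open>rGamma\<close> and preserves moduli, so w may be
  replaced by 1 - z, where the reflection formula applies.\<close>

lemma norm_rGamma_reflection:
  assumes "cnj w = 1 - z"
  shows "norm (rGamma z * rGamma w) = norm (sin (of_real pi * z)) / pi"
proof -
  have "norm (rGamma z * rGamma w) = norm (rGamma z * rGamma (cnj w))"
    by (simp add: norm_mult cnj_rGamma[symmetric])
  also have "\<dots> = norm (sin (of_real pi * z) / of_real pi)"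
    unfolding assms rGamma_reflection_complex ..
  finally show ?thesis by (simp add: norm_divide)
qed

text \<open>Reflection leaves a quotient of sines, evaluated by |sin (x + i y)|^2 = (cosh (2 y) -
  cos (2 x)) / 2. The doubled real parts are 3 pi / 2 in the numerator and 3 pi / 2 + pi \<nu> in
  the denominator.\<close>

lemma norm_symbol_S0plus_critical:
  fixes \<nu> \<xi> :: real
  shows "(cmod (symbol_S0plus \<nu> (Complex (1 / 2) \<xi>)))\<^sup>2 = cosh (pi * \<xi>) / (cosh (pi * \<xi>) - sin (pi * \<nu>))"
proof -
  define s where "s = Complex (1 / 2) \<xi>"
  define z1 z2 w1 w2 where "z1 = - s / 2 + of_real \<nu> / 2 + 1" and "z2 = - s / 2 - of_real \<nu> / 2 + 1 / 2"
    and "w1 = 1 / 2 - s / 2" and "w2 = 1 - s / 2"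
  \<comment> \<open>Both relations express that Re s = 1/2; the first one also uses that \<nu> is
    real.\<close>
  have c: "cnj z2 = 1 - z1" "cnj w1 = 1 - w2"
    by (simp_all add: complex_eq_iff z1_def z2_def w1_def w2_def s_def)
  have "symbol_S0plus \<nu> s = (rGamma w2 * rGamma w1) / (rGamma z1 * rGamma z2)"
    unfolding symbol_S0plus_def z1_def[symmetric] z2_def[symmetric] w1_def[symmetric] w2_def[symmetric]
    by (simp add: Gamma_def field_simps)
  hence "norm (symbol_S0plus \<nu> s) = norm (sin (of_real pi * w2)) / norm (sin (of_real pi * z1))"
    by (simp only: norm_divide norm_rGamma_reflection[OF c(1)] norm_rGamma_reflection[OF c(2)]) simp
  hence "(norm (symbol_S0plus \<nu> s))\<^sup>2 = (norm (sin (of_real pi * w2)))\<^sup>2 / (norm (sin (of_real pi * z1)))\<^sup>2"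
    by (simp add: power_divide)
  also have "(norm (sin (of_real pi * w2)))\<^sup>2 = cosh (pi * \<xi>) / 2"
  proof -
    have "cos (2 * Re (of_real pi * w2)) = 0"
    proof -
      have eq: "2 * Re (of_real pi * w2) = pi / 2 + pi" by (simp add: w2_def s_def field_simps)
      show ?thesis unfolding eq cos_add by simp
    qed
    moreover have "2 * Im (of_real pi * w2) = - (pi * \<xi>)" by (simp add: w2_def s_def)
    ultimately show ?thesis by (simp only: norm_sin_squared) (simp add: cosh_field_def exp_minus)
  qed
  also have "(norm (sin (of_real pi * z1)))\<^sup>2 = (cosh (pi * \<xi>) - sin (pi * \<nu>)) / 2"
  proof -
    have "cos (2 * Re (of_real pi * z1)) = sin (pi * \<nu>)"
    proof -
      have "2 * Re (of_real pi * z1) = pi / 2 + (pi + pi * \<nu>)" by (simp add: z1_def s_def field_simps)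
      hence "cos (2 * Re (of_real pi * z1)) = - sin (pi + pi * \<nu>)" by (simp only: cos_add) simp
      also have "\<dots> = sin (pi * \<nu>)" by (simp add: sin_add)
      finally show ?thesis .
    qed
    moreover have "2 * Im (of_real pi * z1) = - (pi * \<xi>)" by (simp add: z1_def s_def)
    ultimately show ?thesis by (simp only: norm_sin_squared) (simp add: cosh_field_def exp_minus)
  qed
  finally show ?thesis by (simp add: s_def)
qed

text \<open>Exact also at poles and zeros, because 1 / (a / b) = b / a persists under the convention
  w / 0 = 0.\<close>

lemma symbol_reciprocal:
  "symbol_P0plus \<nu> s = 1 / symbol_S0plus \<nu> s" "symbol_Pminus \<nu> s = 1 / symbol_Sminus \<nu> s"
  by (simp_all add: symbol_P0plus_def symbol_S0plus_def symbol_Pminus_def symbol_Sminus_def)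

lemma norm_symbol_critical:
  fixes \<nu> \<xi> :: real
  shows "(cmod (symbol_P0plus \<nu> (Complex (1 / 2) \<xi>)))\<^sup>2 = (cosh (pi * \<xi>) - sin (pi * \<nu>)) / cosh (pi * \<xi>)"
    "(cmod (symbol_Pminus \<nu> (Complex (1 / 2) \<xi>)))\<^sup>2 = cosh (pi * \<xi>) / (cosh (pi * \<xi>) - sin (pi * \<nu>))"
    "(cmod (symbol_Sminus \<nu> (Complex (1 / 2) \<xi>)))\<^sup>2 = (cosh (pi * \<xi>) - sin (pi * \<nu>)) / cosh (pi * \<xi>)"
proof -
  have P: "(cmod (symbol_P0plus \<nu> (Complex (1 / 2) \<xi>)))\<^sup>2 = (cosh (pi * \<xi>) - sin (pi * \<nu>)) / cosh (pi * \<xi>)" for \<xi>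
    by (simp add: symbol_reciprocal norm_divide power_divide norm_symbol_S0plus_critical)
  show "(cmod (symbol_P0plus \<nu> (Complex (1 / 2) \<xi>)))\<^sup>2 = (cosh (pi * \<xi>) - sin (pi * \<nu>)) / cosh (pi * \<xi>)" by (rule P)
  have r: "1 - Complex (1 / 2) \<xi> = Complex (1 / 2) (- \<xi>)" by (simp add: complex_eq_iff)
  have "symbol_Sminus \<nu> (Complex (1 / 2) \<xi>) = symbol_P0plus \<nu> (1 - Complex (1 / 2) \<xi>)"
    by (simp add: symbol_reflection)
  thus "(cmod (symbol_Sminus \<nu> (Complex (1 / 2) \<xi>)))\<^sup>2 = (cosh (pi * \<xi>) - sin (pi * \<nu>)) / cosh (pi * \<xi>)"
    unfolding r by (simp add: P)
  show "(cmod (symbol_Pminus \<nu> (Complex (1 / 2) \<xi>)))\<^sup>2 = cosh (pi * \<xi>) / (cosh (pi * \<xi>) - sin (pi * \<nu>))"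
    unfolding symbol_reflection r by (simp add: norm_symbol_S0plus_critical)
qed

text \<open>Legendre's duplication formula at z = (1 - s) / 2, extended to every s by the
  conventions at the poles.\<close>

lemma symbol_S0plus_duplication:
  "symbol_S0plus \<nu> s = 2 powr (- s) / complex_of_real (sqrt pi) *
     (Gamma (- s / 2 - \<nu> / 2 + 1 / 2) * Gamma (- s / 2 + \<nu> / 2 + 1) / Gamma (1 - s))"
proof -
  define z where "z = 1 / 2 - s / 2"
  have z: "1 - s / 2 = z + 1 / 2" "1 - s = 2 * z" "1 - 2 * z = s" by (simp_all add: z_def field_simps)
  have G: "Gamma z * Gamma (z + 1 / 2) = 2 powr s * complex_of_real (sqrt pi) * Gamma (1 - s)"
  proof (cases "z \<in> \<int>\<^sub>\<le>\<^sub>0 \<or> z + 1 / 2 \<in> \<int>\<^sub>\<le>\<^sub>0")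
    \<comment> \<open>If z or z + 1/2 is a pole of Gamma, so is 2 z = 1 - s, and both sides take the
      value 0.\<close>
    case True
    hence G0: "Gamma z * Gamma (z + 1 / 2) = 0" by (auto simp: Gamma_eq_zero_iff)
    have "1 - s \<in> \<int>\<^sub>\<le>\<^sub>0"
      using True
    proof
      assume "z \<in> \<int>\<^sub>\<le>\<^sub>0"
      then obtain n where "z = - of_nat n" by (elim nonpos_Ints_cases')
      hence "1 - s = - of_nat (2 * n)" unfolding z(2) by simp
      thus ?thesis by (simp only: uminus_in_nonpos_Ints_iff of_nat_in_Nats)
    next
      assume "z + 1 / 2 \<in> \<int>\<^sub>\<le>\<^sub>0"
      then obtain n where "z + 1 / 2 = - of_nat n" by (elim nonpos_Ints_cases')
      hence "z = - of_nat n - 1 / 2" by (simp add: eq_diff_eq)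
      hence "1 - s = - of_nat (2 * n + 1)" unfolding z(2) by simp
      thus ?thesis by (simp only: uminus_in_nonpos_Ints_iff of_nat_in_Nats)
    qed
    hence "Gamma (1 - s) = 0" by (simp only: Gamma_eq_zero_iff)
    thus ?thesis unfolding G0 by (simp only: mult_zero_right)
  next
    case False
    have "2 powr s = exp (s * of_real (ln 2))" by (simp add: powr_def Ln_of_real[of 2, simplified])
    thus ?thesis using Gamma_legendre_duplication[of z] False unfolding z by (simp add: z)
  qed
  have p: "2 powr (- s) = 1 / (2 powr s :: complex)" by (simp add: powr_minus divide_inverse)
  show ?thesis
    unfolding symbol_S0plus_def z(1) z_def[symmetric] G p by (simp add: mult_ac)
qed

text \<open>Gamma is by definition the inverse of the entire function \<open>rGamma\<close>, so
  products and quotients of affine compositions are meromorphic.\<close>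

lemma symbols_meromorphic:
  "symbol_S0plus \<nu> meromorphic_on UNIV" "symbol_P0plus \<nu> meromorphic_on UNIV"
  "symbol_Pminus \<nu> meromorphic_on UNIV" "symbol_Sminus \<nu> meromorphic_on UNIV"
proof -
  have r: "(\<lambda>s. rGamma (a * s + b)) meromorphic_on UNIV" for a b
    by (intro analytic_on_imp_meromorphic_on analytic_intros)
  have G: "(\<lambda>s. Gamma (a * s + b)) meromorphic_on UNIV" for a b
    unfolding Gamma_def by (intro meromorphic_intros r)
  have G1: "(\<lambda>s. Gamma (- s / 2 + c / 2 + d)) meromorphic_on UNIV" "(\<lambda>s. Gamma (- s / 2 - c / 2 + d)) meromorphic_on UNIV"
    "(\<lambda>s. Gamma (d - s / 2)) meromorphic_on UNIV" "(\<lambda>s. Gamma (s / 2 + c / 2 + d)) meromorphic_on UNIV"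
    "(\<lambda>s. Gamma (s / 2 - c / 2)) meromorphic_on UNIV" "(\<lambda>s. Gamma (s / 2)) meromorphic_on UNIV"
    "(\<lambda>s. Gamma (s / 2 + d)) meromorphic_on UNIV" for c d
    using G[of "- 1 / 2" "c / 2 + d"] G[of "- 1 / 2" "- c / 2 + d"] G[of "- 1 / 2" d]
      G[of "1 / 2" "c / 2 + d"] G[of "1 / 2" "- c / 2"] G[of "1 / 2" 0] G[of "1 / 2" d]
    by (simp_all add: algebra_simps)
  show "symbol_S0plus \<nu> meromorphic_on UNIV" "symbol_P0plus \<nu> meromorphic_on UNIV"
    "symbol_Pminus \<nu> meromorphic_on UNIV" "symbol_Sminus \<nu> meromorphic_on UNIV"
    unfolding symbol_S0plus_def[abs_def] symbol_P0plus_def[abs_def] symbol_Pminus_def[abs_def] symbol_Sminus_def[abs_def]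
    by (intro meromorphic_intros G1)+
qed

lemma mellin_multiplier_mono: "mellin_multiplier A m S \<Longrightarrow> T \<subseteq> S \<Longrightarrow> mellin_multiplier A m T"
  unfolding mellin_multiplier_def by blast

lemma mellin_symbol_AE:
  "AE \<xi> in lborel. mellin_symbol (BE_S0plus \<nu>) (Complex (1 / 2) \<xi>) = symbol_S0plus \<nu> (Complex (1 / 2) \<xi>)"
  "AE \<xi> in lborel. mellin_symbol (BE_P0plus \<nu>) (Complex (1 / 2) \<xi>) = symbol_P0plus \<nu> (Complex (1 / 2) \<xi>)"
  "AE \<xi> in lborel. mellin_symbol (BE_Pminus \<nu>) (Complex (1 / 2) \<xi>) = symbol_Pminus \<nu> (Complex (1 / 2) \<xi>)"
  "AE \<xi> in lborel. mellin_symbol (BE_Sminus \<nu>) (Complex (1 / 2) \<xi>) = symbol_Sminus \<nu> (Complex (1 / 2) \<xi>)"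
proof -
  obtain f z where f: "f \<in> test_funs" "mellin f z \<noteq> 0"
    using exists_test_fun_mellin_nonzero by blast
  define c where "c = min (2 + Re \<nu>) (1 - Re \<nu>)"
  define d where "d = max (Re \<nu>) (- 1 - Re \<nu>)"
  show "AE \<xi> in lborel. mellin_symbol (BE_S0plus \<nu>) (Complex (1 / 2) \<xi>) = symbol_S0plus \<nu> (Complex (1 / 2) \<xi>)"
  proof (rule cosparse_imp_AE_line, rule mellin_symbol_eq[OF f symbols_meromorphic(1)])
    \<comment> \<open>A bounded strip inside the half-plane suffices to pin down the symbol; it may
      well miss the critical line, which is reached by continuation.\<close>
    show "mellin_multiplier (BE_S0plus \<nu>) (symbol_S0plus \<nu>) {s. c - 1 < Re s \<and> Re s < c}"
      by (rule mellin_multiplier_mono[OF mellin_multiplier_S0plus]) (auto simp: c_def)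
    show "(\<exists>c>0. \<forall>x. 0 < x \<and> x < c \<longrightarrow> BE_S0plus \<nu> f x = 0) \<or> (\<exists>c>0. \<forall>x. x > c \<longrightarrow> BE_S0plus \<nu> f x = 0)"
      by (rule disjI1, rule convolution_vanishes(1)[OF f(1)], rule BE_S0plus_eq[OF f(1)])
  qed simp
  show "AE \<xi> in lborel. mellin_symbol (BE_P0plus \<nu>) (Complex (1 / 2) \<xi>) = symbol_P0plus \<nu> (Complex (1 / 2) \<xi>)"
  proof (rule cosparse_imp_AE_line, rule mellin_symbol_eq[OF f symbols_meromorphic(2)])
    show "mellin_multiplier (BE_P0plus \<nu>) (symbol_P0plus \<nu>) {s. 0 < Re s \<and> Re s < 1}"
      by (rule mellin_multiplier_mono[OF mellin_multiplier_P0plus]) auto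
    show "(\<exists>c>0. \<forall>x. 0 < x \<and> x < c \<longrightarrow> BE_P0plus \<nu> f x = 0) \<or> (\<exists>c>0. \<forall>x. x > c \<longrightarrow> BE_P0plus \<nu> f x = 0)"
      by (rule disjI1, rule convolution_vanishes(1)[OF f(1)], rule BE_P0plus_eq[OF f(1)])
  qed simp
  show "AE \<xi> in lborel. mellin_symbol (BE_Pminus \<nu>) (Complex (1 / 2) \<xi>) = symbol_Pminus \<nu> (Complex (1 / 2) \<xi>)"
  proof (rule cosparse_imp_AE_line, rule mellin_symbol_eq[OF f symbols_meromorphic(3)])
    show "mellin_multiplier (BE_Pminus \<nu>) (symbol_Pminus \<nu>) {s. d < Re s \<and> Re s < d + 1}"
      by (rule mellin_multiplier_mono[OF mellin_multiplier_Pminus]) (auto simp: d_def)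
    show "(\<exists>c>0. \<forall>x. 0 < x \<and> x < c \<longrightarrow> BE_Pminus \<nu> f x = 0) \<or> (\<exists>c>0. \<forall>x. x > c \<longrightarrow> BE_Pminus \<nu> f x = 0)"
      by (rule disjI2, rule convolution_vanishes(2)[OF f(1)], rule BE_Pminus_eq[OF f(1)])
  qed simp
  show "AE \<xi> in lborel. mellin_symbol (BE_Sminus \<nu>) (Complex (1 / 2) \<xi>) = symbol_Sminus \<nu> (Complex (1 / 2) \<xi>)"
  proof (rule cosparse_imp_AE_line, rule mellin_symbol_eq[OF f symbols_meromorphic(4)])
    show "mellin_multiplier (BE_Sminus \<nu>) (symbol_Sminus \<nu>) {s. 0 < Re s \<and> Re s < 1}"
      by (rule mellin_multiplier_mono[OF mellin_multiplier_Sminus]) auto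
    show "(\<exists>c>0. \<forall>x. 0 < x \<and> x < c \<longrightarrow> BE_Sminus \<nu> f x = 0) \<or> (\<exists>c>0. \<forall>x. x > c \<longrightarrow> BE_Sminus \<nu> f x = 0)"
      by (rule disjI2, rule convolution_vanishes(2)[OF f(1)], rule BE_Sminus_eq[OF f(1)])
  qed simp
qed

section \<open>The norms\<close>

lemma cosh_unbounded: "\<exists>\<xi>. cosh (pi * \<xi>) > (K::real)"
proof (intro exI)
  let ?\<xi> = "2 * \<bar>K\<bar> / pi"
  have "\<bar>K\<bar> < exp (2 * \<bar>K\<bar>) / 2"
    using exp_ge_add_one_self[of "2 * \<bar>K\<bar>"] by linarith
  also have "\<dots> \<le> cosh (2 * \<bar>K\<bar>)" by (simp add: cosh_field_def)
  also have "2 * \<bar>K\<bar> = pi * ?\<xi>" by simp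
  finally show "cosh (pi * ?\<xi>) > K" by linarith
qed

lemma cosh_minus_nonneg: "\<bar>p\<bar> \<le> 1 \<Longrightarrow> cosh (pi * \<xi>) - p \<ge> (0::real)"
  using cosh_real_ge_1[of "pi * \<xi>"] by linarith

text \<open>The quotient cosh / (cosh - p) increases to 1 at infinity for p < 0, is constant for p =
  0, has its maximum 1 / (1 - p) at \<xi> = 0 for 0 < p < 1, and has a pole there for p = 1.\<close>

lemma L2_norm_large_symbol:
  fixes p :: real
  assumes h: "AE \<xi> in lborel. (cmod (mellin_symbol A (Complex (1 / 2) \<xi>)))\<^sup>2 = cosh (pi * \<xi>) / (cosh (pi * \<xi>) - p)"
    and p: "\<bar>p\<bar> \<le> 1"
  shows "L2_norm A = 1 / ennreal (min 1 (sqrt (1 - p)))" "L2_bounded A \<longleftrightarrow> p \<noteq> 1"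
proof -
  define h where "h = (\<lambda>\<xi>::real. cosh (pi * \<xi>) / (cosh (pi * \<xi>) - p))"
  have AE: "AE \<xi> in lborel. (cmod (mellin_symbol A (Complex (1 / 2) \<xi>)))\<^sup>2 = h \<xi>"
    unfolding h_def by (rule assms(1))
  have m: "h \<in> borel_measurable borel"
  proof -
    have [measurable]: "(\<lambda>\<xi>::real. cosh (pi * \<xi>)) \<in> borel_measurable borel"
      by (intro borel_measurable_continuous_onI continuous_intros)
    show ?thesis unfolding h_def by measurable
  qed
  have nn: "h \<xi> \<ge> 0" for \<xi> unfolding h_def using cosh_minus_nonneg[OF p] by (intro divide_nonneg_nonneg) auto
  have cont: "isCont h \<xi>" if "cosh (pi * \<xi>) \<noteq> p" for \<xi>
    unfolding h_def using that by (intro continuous_intros) auto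
  have c1: "cosh (pi * \<xi>) \<ge> 1" for \<xi> :: real by (rule cosh_real_ge_1)
  show "L2_norm A = 1 / ennreal (min 1 (sqrt (1 - p)))" "L2_bounded A \<longleftrightarrow> p \<noteq> 1"
  proof (atomize(full), cases "p = 1")
    \<comment> \<open>At \<xi> = 0 itself the division by zero gives the value 0, so points near 0
      but distinct from it are used. The stated norm is 1 / 0, which is infinite in the extended
      reals.\<close>
    case True
    have "\<exists>\<xi>. isCont h \<xi> \<and> h \<xi> > K" for K
    proof -
      have "((\<lambda>\<xi>::real. cosh (pi * \<xi>) - 1) \<longlongrightarrow> cosh (pi * 0) - 1) (at 0)"
        by (intro tendsto_intros)
      hence "((\<lambda>\<xi>::real. cosh (pi * \<xi>) - 1) \<longlongrightarrow> 0) (at 0)" by simp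
      moreover have "1 / (\<bar>K\<bar> + 1) > 0" by simp
      ultimately have "eventually (\<lambda>\<xi>::real. cosh (pi * \<xi>) - 1 < 1 / (\<bar>K\<bar> + 1)) (at 0)"
        by (rule order_tendstoD(2))
      moreover have "eventually (\<lambda>\<xi>::real. \<xi> \<noteq> 0) (at 0)" by (rule eventually_neq_at_within)
      ultimately have "eventually (\<lambda>\<xi>::real. cosh (pi * \<xi>) - 1 < 1 / (\<bar>K\<bar> + 1) \<and> \<xi> \<noteq> 0) (at 0)"
        by eventually_elim simp
      then obtain \<xi> :: real where x: "cosh (pi * \<xi>) - 1 < 1 / (\<bar>K\<bar> + 1)" "\<xi> \<noteq> 0"
        using eventually_happens'[OF trivial_limit_at] by blast
      have ne: "cosh (pi * \<xi>) \<noteq> 1" using x(2) cosh_real_one_iff[of "pi * \<xi>"] by simp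
      hence pos: "cosh (pi * \<xi>) - 1 > 0" using c1[of \<xi>] by linarith
      have "(\<bar>K\<bar> + 1) * (cosh (pi * \<xi>) - 1) < 1" using x(1) by (simp add: pos_less_divide_eq mult.commute)
      also have "1 \<le> cosh (pi * \<xi>)" by (rule c1)
      finally have "\<bar>K\<bar> + 1 < h \<xi>" using pos True by (simp add: h_def pos_less_divide_eq)
      thus ?thesis using cont[of \<xi>] ne True by (intro exI[of _ \<xi>]) auto
    qed
    note inf = L2_norm_infinite[OF AE m nn this]
    show "L2_norm A = 1 / ennreal (min 1 (sqrt (1 - p))) \<and> (L2_bounded A \<longleftrightarrow> p \<noteq> 1)"
      using inf True by simp
  next
    case False
    hence p1: "p < 1" using p by auto
    define q where "q = min 1 (sqrt (1 - p))"
    have q: "q > 0" using p1 by (simp add: q_def)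
    have pos: "cosh (pi * \<xi>) - p > 0" for \<xi> :: real using c1[of \<xi>] p1 by linarith
    have ct: "isCont h \<xi>" for \<xi> using pos[of \<xi>] by (intro cont) auto
    have q2: "(1 / q)\<^sup>2 = 1 / min 1 (1 - p)"
    proof (cases "p \<le> 0")
      case True
      hence "q = 1" by (simp add: q_def)
      thus ?thesis using True by simp
    next
      case False
      hence "q = sqrt (1 - p)" by (simp add: q_def)
      thus ?thesis using False p1 by (simp add: power_divide)
    qed
    have "h \<xi> \<le> (1 / q)\<^sup>2" for \<xi>
    proof (cases "p \<le> 0")
      case True
      hence "h \<xi> \<le> 1" using pos[of \<xi>] by (simp add: h_def pos_divide_le_eq)
      thus ?thesis unfolding q2 using True by simp
    next
      case False
      have "p * 1 \<le> p * cosh (pi * \<xi>)" using False c1[of \<xi>] by (intro mult_left_mono) auto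
      hence "h \<xi> \<le> 1 / (1 - p)" using pos[of \<xi>] p1 by (simp add: h_def frac_le_eq divide_simps algebra_simps)
      thus ?thesis unfolding q2 using False p1 by simp
    qed
    moreover have "\<exists>\<xi>. isCont h \<xi> \<and> h \<xi> > (1 / q)\<^sup>2 - e" if e: "e > 0" for e
    proof (cases "p \<le> 0")
      case True
      obtain \<xi> :: real where x: "cosh (pi * \<xi>) > 1 / e" using cosh_unbounded by blast
      hence "1 < e * cosh (pi * \<xi>)" using e by (simp add: pos_divide_less_eq mult.commute)
      moreover have "- p \<le> 1" using p by simp
      moreover have "e * (- p) \<ge> 0" using e True by (intro mult_nonneg_nonneg) auto
      \<comment> \<open>Expanded, this asks for -p + e p < e cosh, which follows from -p \<le> 1 < e
        cosh and e p \<le> 0.\<close>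
      ultimately have "(1 - e) * (cosh (pi * \<xi>) - p) < cosh (pi * \<xi>)" by (simp add: algebra_simps)
      hence "1 - e < h \<xi>" using pos[of \<xi>] by (simp add: h_def pos_less_divide_eq)
      thus ?thesis unfolding q2 using True ct by (intro exI[of _ \<xi>]) auto
    next
      case False
      have "h 0 = 1 / min 1 (1 - p)" using False p1 by (simp add: h_def)
      thus ?thesis unfolding q2 using e ct by (intro exI[of _ 0]) auto
    qed
    ultimately have fin: "L2_norm A = ennreal (1 / q)" "L2_bounded A"
      using L2_norm_eqI[OF AE m nn, of "1 / q"] q by auto
    have "ennreal (1 / q) = 1 / ennreal q"
      using q by (simp add: divide_ennreal[symmetric])
    with fin show "L2_norm A = 1 / ennreal (min 1 (sqrt (1 - p))) \<and> (L2_bounded A \<longleftrightarrow> p \<noteq> 1)"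
      using False by (simp add: q_def)
  qed
qed

text \<open>For p \<le> 0 the function 1 - p / cosh attains its maximum 1 - p at \<xi> = 0; for p >
  0 its supremum 1 is approached at infinity but not attained.\<close>

lemma L2_norm_small_symbol:
  fixes p :: real
  assumes h: "AE \<xi> in lborel. (cmod (mellin_symbol A (Complex (1 / 2) \<xi>)))\<^sup>2 = (cosh (pi * \<xi>) - p) / cosh (pi * \<xi>)"
    and p: "\<bar>p\<bar> \<le> 1"
  shows "L2_norm A = ennreal (max 1 (sqrt (1 - p)))" "L2_bounded A"
proof -
  define h where "h = (\<lambda>\<xi>::real. (cosh (pi * \<xi>) - p) / cosh (pi * \<xi>))"
  have AE: "AE \<xi> in lborel. (cmod (mellin_symbol A (Complex (1 / 2) \<xi>)))\<^sup>2 = h \<xi>"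
    unfolding h_def by (rule assms(1))
  have c1: "cosh (pi * \<xi>) \<ge> 1" for \<xi> :: real by (rule cosh_real_ge_1)
  have nz: "cosh (pi * \<xi>) \<noteq> 0" for \<xi> :: real using c1[of \<xi>] by linarith
  have ct: "isCont h \<xi>" for \<xi>
    unfolding h_def using nz by (intro continuous_intros) auto
  have m: "h \<in> borel_measurable borel"
    using ct by (intro borel_measurable_continuous_onI) (simp add: continuous_on_eq_continuous_at)
  have nn: "h \<xi> \<ge> 0" for \<xi> unfolding h_def using cosh_minus_nonneg[OF p] by (intro divide_nonneg_nonneg) auto
  have h_eq: "h \<xi> = 1 - p / cosh (pi * \<xi>)" for \<xi> using nz[of \<xi>] by (simp add: h_def diff_divide_distrib)
  define q where "q = max 1 (sqrt (1 - p))"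
  have q: "q \<ge> 0" by (simp add: q_def)
  have q2: "q\<^sup>2 = max 1 (1 - p)"
  proof (cases "p \<le> 0")
    case True
    hence "q = sqrt (1 - p)" by (simp add: q_def)
    thus ?thesis using True by simp
  next
    case False
    hence "q = 1" by (simp add: q_def)
    thus ?thesis using False by simp
  qed
  have up: "h \<xi> \<le> q\<^sup>2" for \<xi>
  proof (cases "p \<le> 0")
    case True
    have "(- p) / cosh (pi * \<xi>) \<le> - p" using True c1[of \<xi>] mult_left_mono[of 1 "cosh (pi * \<xi>)" "- p"]
      by (subst pos_divide_le_eq) auto
    thus ?thesis unfolding q2 h_eq by simp
  next
    case False
    hence "p / cosh (pi * \<xi>) \<ge> 0" by simp
    thus ?thesis unfolding q2 h_eq by linarith
  qed
  have sup: "\<exists>\<xi>. isCont h \<xi> \<and> h \<xi> > q\<^sup>2 - e" if e: "e > 0" for e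
  proof (cases "p \<le> 0")
    case True
    have "h 0 = 1 - p" by (simp add: h_eq)
    moreover have "q\<^sup>2 = 1 - p" unfolding q2 using True by simp
    ultimately show ?thesis using e ct by (intro exI[of _ 0]) auto
  next
    case False
    obtain \<xi> :: real where x: "cosh (pi * \<xi>) > 1 / e" using cosh_unbounded by blast
    hence "1 < e * cosh (pi * \<xi>)" using e by (simp add: pos_divide_less_eq mult.commute)
    moreover have "p \<le> 1" using p by simp
    ultimately have "p / cosh (pi * \<xi>) < e"
      by (subst pos_divide_less_eq) auto
    moreover have "q\<^sup>2 = 1" unfolding q2 using False by simp
    ultimately have "h \<xi> > q\<^sup>2 - e" by (simp add: h_eq)
    thus ?thesis using ct by blast
  qed
  show "L2_norm A = ennreal (max 1 (sqrt (1 - p)))" "L2_bounded A"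
    using L2_norm_eqI[OF AE m nn q up sup] by (auto simp: q_def)
qed

lemma BE_L2_norms:
  fixes \<nu> :: real
  shows "L2_norm (BE_S0plus \<nu>) = 1 / ennreal (min 1 (sqrt (1 - sin (pi * \<nu>))))"
    "L2_norm (BE_Pminus \<nu>) = 1 / ennreal (min 1 (sqrt (1 - sin (pi * \<nu>))))"
    "L2_norm (BE_P0plus \<nu>) = ennreal (max 1 (sqrt (1 - sin (pi * \<nu>))))"
    "L2_norm (BE_Sminus \<nu>) = ennreal (max 1 (sqrt (1 - sin (pi * \<nu>))))"
    "L2_bounded (BE_S0plus \<nu>) \<longleftrightarrow> sin (pi * \<nu>) \<noteq> 1" "L2_bounded (BE_Pminus \<nu>) \<longleftrightarrow> sin (pi * \<nu>) \<noteq> 1"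
    "L2_bounded (BE_P0plus \<nu>)" "L2_bounded (BE_Sminus \<nu>)"
proof -
  have p: "\<bar>sin (pi * \<nu>)\<bar> \<le> 1" by simp
  have "AE \<xi> in lborel. (cmod (mellin_symbol (BE_S0plus \<nu>) (Complex (1 / 2) \<xi>)))\<^sup>2 = cosh (pi * \<xi>) / (cosh (pi * \<xi>) - sin (pi * \<nu>))"
    using mellin_symbol_AE(1)[of "of_real \<nu>"] by eventually_elim (simp add: norm_symbol_S0plus_critical)
  note S = L2_norm_large_symbol[OF this p]
  have "AE \<xi> in lborel. (cmod (mellin_symbol (BE_Pminus \<nu>) (Complex (1 / 2) \<xi>)))\<^sup>2 = cosh (pi * \<xi>) / (cosh (pi * \<xi>) - sin (pi * \<nu>))"
    using mellin_symbol_AE(3)[of "of_real \<nu>"] by eventually_elim (simp add: norm_symbol_critical)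
  note P = L2_norm_large_symbol[OF this p]
  have "AE \<xi> in lborel. (cmod (mellin_symbol (BE_P0plus \<nu>) (Complex (1 / 2) \<xi>)))\<^sup>2 = (cosh (pi * \<xi>) - sin (pi * \<nu>)) / cosh (pi * \<xi>)"
    using mellin_symbol_AE(2)[of "of_real \<nu>"] by eventually_elim (simp add: norm_symbol_critical)
  note P' = L2_norm_small_symbol[OF this p]
  have "AE \<xi> in lborel. (cmod (mellin_symbol (BE_Sminus \<nu>) (Complex (1 / 2) \<xi>)))\<^sup>2 = (cosh (pi * \<xi>) - sin (pi * \<nu>)) / cosh (pi * \<xi>)"
    using mellin_symbol_AE(4)[of "of_real \<nu>"] by eventually_elim (simp add: norm_symbol_critical)
  note S' = L2_norm_small_symbol[OF this p]
  show "L2_norm (BE_S0plus \<nu>) = 1 / ennreal (min 1 (sqrt (1 - sin (pi * \<nu>))))"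
    "L2_norm (BE_Pminus \<nu>) = 1 / ennreal (min 1 (sqrt (1 - sin (pi * \<nu>))))"
    "L2_norm (BE_P0plus \<nu>) = ennreal (max 1 (sqrt (1 - sin (pi * \<nu>))))"
    "L2_norm (BE_Sminus \<nu>) = ennreal (max 1 (sqrt (1 - sin (pi * \<nu>))))"
    "L2_bounded (BE_S0plus \<nu>) \<longleftrightarrow> sin (pi * \<nu>) \<noteq> 1" "L2_bounded (BE_Pminus \<nu>) \<longleftrightarrow> sin (pi * \<nu>) \<noteq> 1"
    "L2_bounded (BE_P0plus \<nu>)" "L2_bounded (BE_Sminus \<nu>)"
    by (fact S P S' P')+
qed

section \<open>Dependence of the norms on the parameter\<close>

lemma sin_pi_add_2: "sin (pi * (\<nu> + 2)) = sin (pi * \<nu>)"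
proof -
  have "pi * (\<nu> + 2) = pi * \<nu> + 2 * pi" by (simp add: algebra_simps)
  thus ?thesis by (simp only: sin_periodic)
qed

lemma sin_pi_eq_1_iff: "sin (pi * \<nu>) = 1 \<longleftrightarrow> (\<exists>k::int. \<nu> = 2 * of_int k + 1 / 2)"
proof
  assume "sin (pi * \<nu>) = 1"
  hence "cos (pi / 2 - pi * \<nu>) = 1" by (simp add: cos_diff)
  then obtain k :: int where "pi / 2 - pi * \<nu> = of_int k * 2 * pi"
    by (auto simp: cos_one_2pi_int)
  hence "pi * (1 / 2 - \<nu>) = pi * (2 * of_int k)" by (simp add: algebra_simps)
  hence "\<nu> = 2 * of_int (- k) + 1 / 2" by simp
  thus "\<exists>k::int. \<nu> = 2 * of_int k + 1 / 2" by blast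
next
  assume "\<exists>k::int. \<nu> = 2 * of_int k + 1 / 2"
  then obtain k :: int where "\<nu> = 2 * of_int k + 1 / 2" by blast
  hence "pi / 2 - pi * \<nu> = of_int (- k) * 2 * pi" by (simp add: algebra_simps)
  hence "cos (pi / 2 - pi * \<nu>) = 1" by (auto simp only: cos_one_2pi_int)
  thus "sin (pi * \<nu>) = 1" by (simp add: cos_diff)
qed

lemma sin_pi_eq_minus_1_iff: "sin (pi * \<nu>) = - 1 \<longleftrightarrow> (\<exists>k::int. \<nu> = - 1 / 2 + 2 * of_int k)"
proof -
  have "sin (pi * \<nu>) = - 1 \<longleftrightarrow> sin (pi * (- \<nu>)) = 1"
  proof -
    have "sin (pi * (- \<nu>)) = - sin (pi * \<nu>)" by simp
    thus ?thesis by linarith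
  qed
  also have "\<dots> \<longleftrightarrow> (\<exists>k::int. - \<nu> = 2 * of_int k + 1 / 2)" by (rule sin_pi_eq_1_iff)
  also have "\<dots> \<longleftrightarrow> (\<exists>k::int. \<nu> = - 1 / 2 + 2 * of_int k)"
  proof
    assume "\<exists>k::int. - \<nu> = 2 * of_int k + 1 / 2"
    then obtain k :: int where "- \<nu> = 2 * of_int k + 1 / 2" by blast
    hence "\<nu> = - 1 / 2 + 2 * of_int (- k)" by simp
    thus "\<exists>k::int. \<nu> = - 1 / 2 + 2 * of_int k" by blast
  next
    assume "\<exists>k::int. \<nu> = - 1 / 2 + 2 * of_int k"
    then obtain k :: int where "\<nu> = - 1 / 2 + 2 * of_int k" by blast
    hence "- \<nu> = 2 * of_int (- k) + 1 / 2" by simp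
    thus "\<exists>k::int. - \<nu> = 2 * of_int k + 1 / 2" by blast
  qed
  finally show ?thesis .
qed

lemma large_norm_ge_1: "1 \<le> 1 / ennreal (min 1 (sqrt (1 - sin (pi * \<nu>))))"
proof (cases "sin (pi * \<nu>) = 1")
  case False
  define q where "q = min 1 (sqrt (1 - sin (pi * \<nu>)))"
  have "sin (pi * \<nu>) < 1" using False sin_le_one[of "pi * \<nu>"] by linarith
  hence q: "q > 0" "q \<le> 1" by (auto simp: q_def)
  have "1 / ennreal q = ennreal (1 / q)" using q by (simp add: divide_ennreal[symmetric])
  moreover have "ennreal 1 \<le> ennreal (1 / q)" using q by (intro ennreal_leI) simp
  ultimately show ?thesis by (simp add: q_def)
qed simp

text \<open>The parameter is chosen with 1 - sin (pi \<nu>) = r^2, so the norm is 1 / r = |C| + 1.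
  It is finite: the norms are unbounded already among the bounded operators.\<close>

lemma large_norm_arbitrarily_large:
  "\<exists>\<nu>::real. ennreal C < 1 / ennreal (min 1 (sqrt (1 - sin (pi * \<nu>)))) \<and>
     1 / ennreal (min 1 (sqrt (1 - sin (pi * \<nu>)))) < \<infinity>"
proof -
  define r where "r = 1 / (\<bar>C\<bar> + 1)"
  have r: "0 < r" "r \<le> 1" by (auto simp: r_def)
  define \<nu> where "\<nu> = arcsin (1 - r\<^sup>2) / pi"
  have r2: "r\<^sup>2 \<le> 1" using r by (intro power_le_one) auto
  have "sin (pi * \<nu>) = 1 - r\<^sup>2" using r r2 zero_le_power2[of r] unfolding \<nu>_def by (simp add: sin_arcsin)
  hence q: "min 1 (sqrt (1 - sin (pi * \<nu>))) = r" using r by simp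
  have "1 / ennreal r = ennreal (1 / r)" using r by (simp add: divide_ennreal[symmetric])
  moreover have "C < 1 / r" by (simp add: r_def)
  ultimately show ?thesis using r by (intro exI[of _ \<nu>]) (auto simp: q ennreal_lessI)
qed

lemma small_norm_le_sqrt_2: "max 1 (sqrt (1 - sin (pi * \<nu>))) \<le> sqrt 2"
  using sin_ge_minus_one[of "pi * \<nu>"] by simp

lemma small_norm_eq_sqrt_2_iff:
  "ennreal (max 1 (sqrt (1 - sin (pi * \<nu>)))) = ennreal (sqrt 2) \<longleftrightarrow> sin (pi * \<nu>) = - 1"
proof -
  have "ennreal (max 1 (sqrt (1 - sin (pi * \<nu>)))) = ennreal (sqrt 2) \<longleftrightarrow> max 1 (sqrt (1 - sin (pi * \<nu>))) = sqrt 2"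
    by (subst ennreal_inj) auto
  also have "\<dots> \<longleftrightarrow> 1 - sin (pi * \<nu>) = 2"
    by (auto simp: max_def split: if_splits)
  finally show ?thesis by auto
qed

theorem theorem3p1p7:
  shows
    "(\<forall>\<nu>::complex.
        mellin_multiplier (BE_S0plus \<nu>) (symbol_S0plus \<nu>) {s. Re s < min (2 + Re \<nu>) (1 - Re \<nu>)} \<and>
        (\<forall>s. Re s < min (2 + Re \<nu>) (1 - Re \<nu>) \<longrightarrow>
           symbol_S0plus \<nu> s =
             2 powr (- s) / complex_of_real (sqrt pi) *
             (Gamma (- s / 2 - \<nu> / 2 + 1 / 2) * Gamma (- s / 2 + \<nu> / 2 + 1) / Gamma (1 - s))) \<and>
        mellin_multiplier (BE_P0plus \<nu>) (symbol_P0plus \<nu>) {s. Re s < 1} \<and>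
        mellin_multiplier (BE_Pminus \<nu>) (symbol_Pminus \<nu>) {s. Re s > max (Re \<nu>) (- 1 - Re \<nu>)} \<and>
        mellin_multiplier (BE_Sminus \<nu>) (symbol_Sminus \<nu>) {s. Re s > 0}) \<and>
     (\<forall>(\<nu>::complex) s.
        symbol_P0plus \<nu> s = 1 / symbol_S0plus \<nu> s \<and>
        symbol_Pminus \<nu> s = 1 / symbol_Sminus \<nu> s \<and>
        symbol_Pminus \<nu> s = symbol_S0plus \<nu> (1 - s) \<and>
        symbol_P0plus \<nu> s = symbol_Sminus \<nu> (1 - s)) \<and>
     (\<forall>\<nu>::real.
        L2_norm (BE_S0plus \<nu>) = 1 / ennreal (min 1 (sqrt (1 - sin (pi * \<nu>)))) \<and>
        L2_norm (BE_Pminus \<nu>) = 1 / ennreal (min 1 (sqrt (1 - sin (pi * \<nu>)))) \<and>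
        L2_norm (BE_P0plus \<nu>) = ennreal (max 1 (sqrt (1 - sin (pi * \<nu>)))) \<and>
        L2_norm (BE_Sminus \<nu>) = ennreal (max 1 (sqrt (1 - sin (pi * \<nu>))))) \<and>
     (\<forall>\<nu>::real.
        L2_norm (BE_S0plus (\<nu> + 2)) = L2_norm (BE_S0plus \<nu>) \<and>
        L2_norm (BE_P0plus (\<nu> + 2)) = L2_norm (BE_P0plus \<nu>) \<and>
        L2_norm (BE_Pminus (\<nu> + 2)) = L2_norm (BE_Pminus \<nu>) \<and>
        L2_norm (BE_Sminus (\<nu> + 2)) = L2_norm (BE_Sminus \<nu>)) \<and>
     (\<forall>C::real. \<exists>\<nu>::real. ennreal C < L2_norm (BE_S0plus \<nu>) \<and> L2_norm (BE_S0plus \<nu>) < \<infinity>) \<and>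
     (\<forall>C::real. \<exists>\<nu>::real. ennreal C < L2_norm (BE_Pminus \<nu>) \<and> L2_norm (BE_Pminus \<nu>) < \<infinity>) \<and>
     (\<forall>\<nu>::real. 1 \<le> L2_norm (BE_S0plus \<nu>) \<and> 1 \<le> L2_norm (BE_Pminus \<nu>)) \<and>
     (\<forall>\<nu>::real. sin (pi * \<nu>) \<le> 0 \<longrightarrow>
        L2_norm (BE_S0plus \<nu>) = 1 \<and> L2_norm (BE_Pminus \<nu>) = 1) \<and>
     (\<forall>\<nu>::real.
        (\<not> L2_bounded (BE_S0plus \<nu>) \<longleftrightarrow> sin (pi * \<nu>) = 1) \<and>
        (\<not> L2_bounded (BE_Pminus \<nu>) \<longleftrightarrow> sin (pi * \<nu>) = 1) \<and>
        (sin (pi * \<nu>) = 1 \<longleftrightarrow> (\<exists>k::int. \<nu> = 2 * of_int k + 1 / 2))) \<and>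
     (\<exists>C::real. \<forall>\<nu>::real.
        L2_norm (BE_P0plus \<nu>) \<le> ennreal C \<and> L2_norm (BE_Sminus \<nu>) \<le> ennreal C) \<and>
     (\<forall>\<nu>::real.
        L2_norm (BE_P0plus \<nu>) \<le> ennreal (sqrt 2) \<and> L2_norm (BE_Sminus \<nu>) \<le> ennreal (sqrt 2)) \<and>
     (\<forall>\<nu>::real. L2_bounded (BE_P0plus \<nu>) \<and> L2_bounded (BE_Sminus \<nu>)) \<and>
     (\<forall>\<nu>::real. sin (pi * \<nu>) \<ge> 0 \<longrightarrow>
        L2_norm (BE_P0plus \<nu>) = 1 \<and> L2_norm (BE_Sminus \<nu>) = 1) \<and>
     (\<forall>\<nu>::real.
        (L2_norm (BE_P0plus \<nu>) = ennreal (sqrt 2) \<longleftrightarrow> sin (pi * \<nu>) = - 1) \<and>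
        (L2_norm (BE_Sminus \<nu>) = ennreal (sqrt 2) \<longleftrightarrow> sin (pi * \<nu>) = - 1) \<and>
        (sin (pi * \<nu>) = - 1 \<longleftrightarrow> (\<exists>k::int. \<nu> = - 1 / 2 + 2 * of_int k)))"
proof (intro conjI)
  show "\<forall>\<nu>::complex.
        mellin_multiplier (BE_S0plus \<nu>) (symbol_S0plus \<nu>) {s. Re s < min (2 + Re \<nu>) (1 - Re \<nu>)} \<and>
        (\<forall>s. Re s < min (2 + Re \<nu>) (1 - Re \<nu>) \<longrightarrow>
           symbol_S0plus \<nu> s =
             2 powr (- s) / complex_of_real (sqrt pi) *
             (Gamma (- s / 2 - \<nu> / 2 + 1 / 2) * Gamma (- s / 2 + \<nu> / 2 + 1) / Gamma (1 - s))) \<and>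
        mellin_multiplier (BE_P0plus \<nu>) (symbol_P0plus \<nu>) {s. Re s < 1} \<and>
        mellin_multiplier (BE_Pminus \<nu>) (symbol_Pminus \<nu>) {s. Re s > max (Re \<nu>) (- 1 - Re \<nu>)} \<and>
        mellin_multiplier (BE_Sminus \<nu>) (symbol_Sminus \<nu>) {s. Re s > 0}"
    using mellin_multiplier_S0plus symbol_S0plus_duplication mellin_multiplier_P0plus
      mellin_multiplier_Pminus mellin_multiplier_Sminus by blast
  show "\<forall>(\<nu>::complex) s.
        symbol_P0plus \<nu> s = 1 / symbol_S0plus \<nu> s \<and>
        symbol_Pminus \<nu> s = 1 / symbol_Sminus \<nu> s \<and>
        symbol_Pminus \<nu> s = symbol_S0plus \<nu> (1 - s) \<and>
        symbol_P0plus \<nu> s = symbol_Sminus \<nu> (1 - s)"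
    using symbol_reciprocal symbol_reflection by blast
  show "\<forall>\<nu>::real.
        L2_norm (BE_S0plus \<nu>) = 1 / ennreal (min 1 (sqrt (1 - sin (pi * \<nu>)))) \<and>
        L2_norm (BE_Pminus \<nu>) = 1 / ennreal (min 1 (sqrt (1 - sin (pi * \<nu>)))) \<and>
        L2_norm (BE_P0plus \<nu>) = ennreal (max 1 (sqrt (1 - sin (pi * \<nu>)))) \<and>
        L2_norm (BE_Sminus \<nu>) = ennreal (max 1 (sqrt (1 - sin (pi * \<nu>))))"
    using BE_L2_norms by blast
  show "\<forall>C::real. \<exists>\<nu>::real. ennreal C < L2_norm (BE_S0plus \<nu>) \<and> L2_norm (BE_S0plus \<nu>) < \<infinity>"
    unfolding BE_L2_norms by (intro allI large_norm_arbitrarily_large)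
  show "\<forall>C::real. \<exists>\<nu>::real. ennreal C < L2_norm (BE_Pminus \<nu>) \<and> L2_norm (BE_Pminus \<nu>) < \<infinity>"
    unfolding BE_L2_norms by (intro allI large_norm_arbitrarily_large)
  show "\<forall>\<nu>::real. 1 \<le> L2_norm (BE_S0plus \<nu>) \<and> 1 \<le> L2_norm (BE_Pminus \<nu>)"
    unfolding BE_L2_norms by (intro allI conjI large_norm_ge_1)
  show "\<forall>\<nu>::real. sin (pi * \<nu>) \<le> 0 \<longrightarrow>
        L2_norm (BE_S0plus \<nu>) = 1 \<and> L2_norm (BE_Pminus \<nu>) = 1"
    unfolding BE_L2_norms by (simp add: min_def)
  show "\<forall>\<nu>::real.
        (\<not> L2_bounded (BE_S0plus \<nu>) \<longleftrightarrow> sin (pi * \<nu>) = 1) \<and>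
        (\<not> L2_bounded (BE_Pminus \<nu>) \<longleftrightarrow> sin (pi * \<nu>) = 1) \<and>
        (sin (pi * \<nu>) = 1 \<longleftrightarrow> (\<exists>k::int. \<nu> = 2 * of_int k + 1 / 2))"
    using BE_L2_norms(5,6) sin_pi_eq_1_iff by blast
  show "\<exists>C::real. \<forall>\<nu>::real.
        L2_norm (BE_P0plus \<nu>) \<le> ennreal C \<and> L2_norm (BE_Sminus \<nu>) \<le> ennreal C"
    unfolding BE_L2_norms by (intro exI[of _ "sqrt 2"] allI conjI ennreal_leI small_norm_le_sqrt_2)
  show "\<forall>\<nu>::real.
        L2_norm (BE_P0plus \<nu>) \<le> ennreal (sqrt 2) \<and> L2_norm (BE_Sminus \<nu>) \<le> ennreal (sqrt 2)"
    unfolding BE_L2_norms by (intro allI conjI ennreal_leI small_norm_le_sqrt_2)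
  show "\<forall>\<nu>::real. L2_bounded (BE_P0plus \<nu>) \<and> L2_bounded (BE_Sminus \<nu>)"
    using BE_L2_norms(7,8) by blast
  show "\<forall>\<nu>::real. sin (pi * \<nu>) \<ge> 0 \<longrightarrow>
        L2_norm (BE_P0plus \<nu>) = 1 \<and> L2_norm (BE_Sminus \<nu>) = 1"
    unfolding BE_L2_norms by (simp add: max_def)
  show "\<forall>\<nu>::real.
        (L2_norm (BE_P0plus \<nu>) = ennreal (sqrt 2) \<longleftrightarrow> sin (pi * \<nu>) = - 1) \<and>
        (L2_norm (BE_Sminus \<nu>) = ennreal (sqrt 2) \<longleftrightarrow> sin (pi * \<nu>) = - 1) \<and>
        (sin (pi * \<nu>) = - 1 \<longleftrightarrow> (\<exists>k::int. \<nu> = - 1 / 2 + 2 * of_int k))"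
    unfolding BE_L2_norms using small_norm_eq_sqrt_2_iff sin_pi_eq_minus_1_iff by blast
\<comment> \<open>Periodicity is the conjunct left over: the norms depend on \<nu> only through sin
  (pi \<nu>).\<close>
qed (unfold BE_L2_norms sin_pi_add_2, intro allI conjI refl)

end
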